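(* Let $T$ be a triangle (a $2$-dimensional simplex with ordered vertices), and let $r \in \mathbb{N}_0 = \{0,1,2,\dots\}$. Let $\mathcal{A}\mathcal{P}_{r}\Lambda^{1}(T)$, $\mathcal{A}\mathcal{P}_{r}^{-}\Lambda^{1}(T)$, $\mathcal{A}\mathring{\mathcal{P}}_{r}\Lambda^{1}(T)$, $\mathcal{A}\mathring{\mathcal{P}}_{r}^{-}\Lambda^{1}(T)$ be the recursively constructed bases defined in the context. Then these four bases are $\mathbb{C}$-invariant. Furthermore: - The basis $\mathcal{A}\mathcal{P}_{r}\Lambda^{1}(T)$ is $\mathbb{R}$-invariant if and only if $r \notin 3\mathbb{N}_0$. - The basis $\mathcal{A}\mathcal{P}_{r}^{-}\Lambda^{1}(T)$ is $\mathbb{R}$-invariant if and only if $r \notin 3\mathbb{N}_0+2$. - The basis $\mathcal{A}\mathring{\mathcal{P}}_{r}\Lambda^{1}(T)$ is $\mathbb{R}$-invariant if and only if $r \notin 3\mathbb{N}_0+3$. - The basis $\mathcal{A}\mathring{\mathcal{P}}_{r}^{-}\Lambda^{1}(T)$ is $\mathbb{R}$-invariant if and only if $r \notin 3\mathbb{N}_0+2$.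
   Context: **Simplices.** An $n$-simplex $T$ is the convex hull of affinely independent points $v_0,\dots,v_n$ in a Euclidean space, with this vertex order fixed. A subsimplex $F\subseteq T$ is the convex hull of a nonempty subset of the vertices, ordered compatibly with $T$; if $\dim F=m$, then $\imath(F,T):\{0,\dots,m\}\to\{0,\dots,n\}$ is the strictly increasing map sending vertex indices of $F$ to the corresponding vertex indices of $T$. Write $[0:n]=\{0,\dots,n\}$, and let $\mathrm{Perm}(n)$ be the group of permutations of $[0:n]$. **Forms.** $\lambda_0,\dots,\lambda_n$ are the barycentric coordinates of $T$ (affine, $\lambda_i(v_j)=\delta_{ij}$), $d\lambda_i$ their exterior derivatives. $A(r,n)$ is the set of $\alpha:[0:n]\to\mathbb{N}_0$ with $\sum_i\alpha(i)=r$; $[\alpha]=\{i:\alpha(i)>0\}$; $\lambda^\alpha=\prod_i\lambda_i^{\alpha(i)}$. $\Sigma(k,n)$ and $\Sigma_0(k,n)$ are the sets of strictly increasing maps $\{1,\dots,k\}\to[0:n]$ and $\{0,\dots,k\}\to[0:n]$, respectively; $[\sigma]$ is the range of $\sigma$. $\Sigma(0,n)=\{\emptyset\}$. For $\sigma\in\Sigma(k,n)$: $d\lambda_\sigma=d\lambda_{\sigma(1)}\wedge\dots\wedge d\lambda_{\sigma(k)}$ (equal to $1$ if $k=0$). For $\rho\in\Sigma_0(k,n)$ the Whitney form is $\phi_\rho=\sum_{i=0}^k(-1)^i\lambda_{\rho(i)}\,d\lambda_{\rho(0)}\wedge\dots\widehat{d\lambda_{\rho(i)}}\dots\wedge d\lambda_{\rho(k)}$.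 Further $\lambda_\sigma=\prod_{i=1}^k\lambda_{\sigma(i)}$ and $\lambda_\rho=\prod_{i=0}^k\lambda_{\rho(i)}$. $\sigma^c\in\Sigma_0(n-k,n)$ and $\rho^c\in\Sigma(n-k,n)$ are the increasing enumerations of the complementary index sets; $\epsilon(\sigma,\sigma^c)$, resp. $\epsilon(\rho^c,\rho)$, is the sign of the permutation sorting the concatenated sequence ($\sigma$ then $\sigma^c$, resp. $\rho^c$ then $\rho$) in ascending order. Superscripts/subscripts $T$ or $F$ indicate the simplex. **Spaces** (complex coefficients). $\mathcal{P}_r\Lambda^k(T)$ is the span of all $\lambda^\alpha d\lambda_\sigma$ with $\alpha\in A(r,n),\sigma\in\Sigma(k,n)$; $\mathcal{P}_r^-\Lambda^k(T)$ is the span of all $\lambda^\alpha\phi_\rho$ with $\alpha\in A(r-1,n),\rho\in\Sigma_0(k,n)$. (Zero if $A(\cdot,n)$ is empty or $k\notin[0:n]$.) $\mathring{\mathcal{P}}_r\Lambda^k(T)$, $\mathring{\mathcal{P}}_r^-\Lambda^k(T)$ are the subspaces of forms whose trace (pullback along inclusion) to every proper subsimplex vanishes. For $r\ge1$, $\mathring{\mathcal{P}}_r\Lambda^k(T)$ is spanned by the $\lambda^\alpha d\lambda_\sigma$ with $\alpha\in A(r,n)$, $[\alpha]\cup[\sigma]=[0:n]$, and $\mathring{\mathcal{P}}_r^-\Lambda^k(T)$ by the $\lambda^\alpha\phi_\rho$ with $\alpha\in A(r-1,n)$, $[\alpha]\cup[\rho]=[0:n]$. **Canonical isomorphisms** ($r\ge0$):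 the well-defined linear isomorphisms $\mathcal{I}_{k,r}:\mathcal{P}_r\Lambda^k(T)\to\mathring{\mathcal{P}}^-_{r+k+1}\Lambda^{n-k}(T)$, $\mathcal{I}_{k,r}(\lambda^\alpha d\lambda_\sigma)=\epsilon(\sigma,\sigma^c)\lambda^\alpha\lambda_\sigma\phi_{\sigma^c}$, and $\mathcal{J}_{k,r}:\mathcal{P}^-_{r+1}\Lambda^k(T)\to\mathring{\mathcal{P}}_{r+k+1}\Lambda^{n-k}(T)$, $\mathcal{J}_{k,r}(\lambda^\alpha\phi_\rho)=\epsilon(\rho^c,\rho)\lambda^\alpha\lambda_\rho d\lambda_{\rho^c}$, for $\alpha\in A(r,n)$, $\sigma\in\Sigma(k,n)$, $\rho\in\Sigma_0(k,n)$. **Extension operators** ($r\ge1$, $F\subseteq T$ of dimension $m$). For $\alpha$ a multiindex on $[0:m]$, $\tilde\alpha$ is the multiindex on $[0:n]$ with $\tilde\alpha\circ\imath(F,T)=\alpha$ and zero elsewhere; $\tilde\sigma=\imath(F,T)\circ\sigma$, $\tilde\rho=\imath(F,T)\circ\rho$. $\mathrm{ext}^{k,r,-}_{F,T}:\mathring{\mathcal{P}}_r^-\Lambda^k(F)\to\mathcal{P}_r^-\Lambda^k(T)$ is the well-defined linear map with $\lambda_F^\alpha\phi^F_\rho\mapsto\lambda_T^{\tilde\alpha}\phi^T_{\tilde\rho}$; $\mathrm{ext}^{k,r}_{F,T}:\mathring{\mathcal{P}}_r\Lambda^k(F)\to\mathcal{P}_r\Lambda^k(T)$ is the well-defined linear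 map with $\lambda_F^\alpha d\lambda^F_\sigma\mapsto\lambda_T^{\tilde\alpha}\Psi_{\tilde\sigma(1)}\wedge\dots\wedge\Psi_{\tilde\sigma(k)}$, where $\Psi_i=d\lambda^T_i-\frac{\tilde\alpha(i)}{|\tilde\alpha|}\sum_{j\in[\imath(F,T)]}d\lambda_j^T$, $[\imath(F,T)]$ is the range of $\imath(F,T)$ and $|\tilde\alpha|=\sum_i\tilde\alpha(i)$ (both on the spanning sets of the spaces with vanishing traces above). **Invariance.** For $\pi\in\mathrm{Perm}(n)$ let $S_\pi:T\to T$ be the affine automorphism with $S_\pi(v_i)=v_{\pi^{-1}(i)}$. A finite set $\{\omega_1,\dots,\omega_M\}$ of pairwise distinct complex-valued forms on $T$ is $\mathbb{F}$-invariant ($\mathbb{F}\in\{\mathbb{R},\mathbb{C}\}$) if for every $\pi\in\mathrm{Perm}(n)$ there are a permutation $\tau$ of $\{1,\dots,M\}$ and $\chi_1,\dots,\chi_M\in\mathbb{F}$ with $|\chi_i|=1$ and $S_\pi^*\omega_i=\chi_i\omega_{\tau(i)}$ for all $i$. (The empty set is invariant.) **Recursive bases.** For every simplex $T$, with $n=\dim T$ and $0\le k\le n$: (0) Fixed lowest-degree bases: $\mathcal{A}\mathcal{P}_0\Lambda^0(T)=\{1\}$; $\mathcal{A}\mathcal{P}_0\Lambda^n(T)=\mathcal{A}\mathring{\mathcal{P}}_0\Lambda^n(T)=\{\mathrm{vol}_T\}$ with $\mathrm{vol}_T=d\lambda_1\wedge\dots\wedge d\lambda_n$ (the Whitney form of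 $T$; $\mathrm{vol}_T=1$ if $n=0$); if $n=2$, $\mathcal{A}\mathcal{P}_0\Lambda^1(T)=\{d\lambda_0+\xi d\lambda_1+\xi^2d\lambda_2,\ d\lambda_0+\xi^2d\lambda_1+\xi d\lambda_2\}$, $\xi=e^{2\pi \mathrm{i}/3}$; if $n=3$, $\mathcal{A}\mathcal{P}_0\Lambda^1(T)=\{\psi_w,\psi_p,\psi_k\}$ and $\mathcal{A}\mathcal{P}_0\Lambda^2(T)=\{\psi_w\wedge\psi_p,\psi_w\wedge\psi_k,\psi_p\wedge\psi_k\}$ with $\psi_w=d\lambda_0-d\lambda_1+d\lambda_2-d\lambda_3$, $\psi_p=d\lambda_0+d\lambda_1-d\lambda_2-d\lambda_3$, $\psi_k=d\lambda_0-d\lambda_1-d\lambda_2+d\lambda_3$; for all other $(n,k)$ some basis of $\mathcal{P}_0\Lambda^k(T)$ is fixed. (1) Empty bases: $\mathcal{A}\mathcal{P}_r\Lambda^k(T)=\emptyset$ for $r<0$; $\mathcal{A}\mathcal{P}_r^-\Lambda^k(T)=\emptyset$ for $r\le0$; $\mathcal{A}\mathring{\mathcal{P}}^-_r\Lambda^k(T)=\emptyset$ for $r<n-k+1$; $\mathcal{A}\mathring{\mathcal{P}}_r\Lambda^k(T)=\emptyset$ if $k<n$ and $r<n-k+1$, or if $k=n$ and $r<0$. All are empty if $k\notin[0:n]$. (2) For $r\ge n-k+1$: $\mathcal{A}\mathring{\mathcal{P}}^-_r\Lambda^k(T)=\mathcal{I}_{n-k,r-n+k-1}\big(\mathcal{A}\mathcal{P}_{r-n+k-1}\Lambda^{n-k}(T)\big)$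 and $\mathcal{A}\mathring{\mathcal{P}}_r\Lambda^k(T)=\mathcal{J}_{n-k,r-n+k-1}\big(\mathcal{A}\mathcal{P}^-_{r-n+k}\Lambda^{n-k}(T)\big)$. (3) For $r\ge1$: $\mathcal{A}\mathcal{P}_r\Lambda^k(T)=\bigcup_{F\subseteq T}\mathrm{ext}^{k,r}_{F,T}\mathcal{A}\mathring{\mathcal{P}}_r\Lambda^k(F)$ and $\mathcal{A}\mathcal{P}^-_r\Lambda^k(T)=\bigcup_{F\subseteq T}\mathrm{ext}^{k,r,-}_{F,T}\mathcal{A}\mathring{\mathcal{P}}^-_r\Lambda^k(F)$, over all subsimplices $F$ of $T$ (including $T$). *)

theory Defs
  imports
    "HOL-Analysis.Analysis"
    "HOL-Library.Function_Algebras"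
    "HOL-Library.Sublist"
    "HOL-Combinatorics.Permutations"
begin

section \<open>Simplices\<close>

text \<open>A simplex is given by the list of its vertices, in their fixed order; the underlying
  point set is the convex hull. Vertex \<open>v\<^sub>i\<close> is \<^term>\<open>T ! i\<close>.\<close>

definition ordered_simplex :: "'a::euclidean_space list \<Rightarrow> bool" where
  "ordered_simplex T \<longleftrightarrow> T \<noteq> [] \<and> distinct T \<and> \<not> affine_dependent (set T)"

definition sdim :: "'a list \<Rightarrow> nat" where
  "sdim T = length T - 1"

definition body :: "'a::euclidean_space list \<Rightarrow> 'a set" where
  "body T = convex hull (set T)"

definition tangent :: "'a::euclidean_space list \<Rightarrow> 'a set" where
  "tangent T = span {v - w | v w. v \<in> set T \<and> w \<in> set T}"

definition subsimplices :: "'a list \<Rightarrow> 'a list set" where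
  "subsimplices T = {F. F \<noteq> [] \<and> subseq F T}"

text \<open>The map \<open>\<imath>(F,T)\<close> from vertex indices of \<open>F\<close> to vertex indices of \<open>T\<close>.\<close>

definition incl :: "'a list \<Rightarrow> 'a list \<Rightarrow> nat \<Rightarrow> nat" where
  "incl F T i = (THE j. j < length T \<and> T ! j = F ! i)"

definition incl_range :: "'a list \<Rightarrow> 'a list \<Rightarrow> nat set" where
  "incl_range F T = incl F T ` {..sdim F}"


section \<open>Affine maps and barycentric coordinates\<close>

definition affine_map :: "('a::real_vector \<Rightarrow> 'b::real_vector) \<Rightarrow> bool" where
  "affine_map f \<longleftrightarrow> (\<exists>g b. linear g \<and> f = (\<lambda>x. g x + b))"

text \<open>Affine functions on \<open>T\<close> are represented by an affine extension to the ambient space.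
  The vertex values determine the function only on the affine hull of \<open>T\<close>, and its derivative
  only on tangent vectors; all forms below are cut off outside of these, so the choice of the
  extension does not matter.\<close>

definition bary :: "'a::euclidean_space list \<Rightarrow> nat \<Rightarrow> 'a \<Rightarrow> real" where
  "bary T i = (SOME f. affine_map f \<and> (\<forall>j\<le>sdim T. f (T ! j) = (if j = i then 1 else 0)))"

definition vertex_map :: "'a::euclidean_space list \<Rightarrow> (nat \<Rightarrow> nat) \<Rightarrow> 'a \<Rightarrow> 'a" where
  "vertex_map T \<pi> = (SOME S. affine_map S \<and> (\<forall>i\<le>sdim T. S (T ! i) = T ! (inv \<pi> i)))"


section \<open>Complex-valued differential forms\<close>

text \<open>A \<open>k\<close>-form on \<open>T\<close> maps a point of \<open>T\<close> and a list of \<open>k\<close> tangent vectors to a complex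
  number. It is extended by \<open>0\<close> to all other arguments, so that equality of forms on \<open>T\<close> is
  equality of functions. Sums of forms are the pointwise ones of
  \<^theory>\<open>HOL-Library.Function_Algebras\<close>.\<close>

type_synonym 'a form = "'a \<Rightarrow> 'a list \<Rightarrow> complex"

definition form_scale :: "complex \<Rightarrow> 'a form \<Rightarrow> 'a form" where
  "form_scale c \<omega> = (\<lambda>x vs. c * \<omega> x vs)"

global_interpretation form: vector_space form_scale
  by unfold_locales (auto simp: form_scale_def algebra_simps fun_eq_iff)

definition func_mult :: "('a \<Rightarrow> real) \<Rightarrow> 'a form \<Rightarrow> 'a form" where
  "func_mult f \<omega> = (\<lambda>x vs. of_real (f x) * \<omega> x vs)"

definition admissible :: "'a::euclidean_space list \<Rightarrow> nat \<Rightarrow> 'a \<Rightarrow> 'a list \<Rightarrow> bool" where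
  "admissible T k x vs \<longleftrightarrow> x \<in> body T \<and> length vs = k \<and> set vs \<subseteq> tangent T"

definition differential :: "'a::euclidean_space list \<Rightarrow> ('a \<Rightarrow> real) \<Rightarrow> 'a form" where
  "differential T f = (\<lambda>x vs. if admissible T 1 x vs
     then of_real (frechet_derivative f (at x) (vs ! 0)) else 0)"

text \<open>The wedge product of a list of 1-forms, in the determinant convention; the empty product
  is the constant 0-form \<open>1\<close>.\<close>

definition wedge :: "'a::euclidean_space list \<Rightarrow> 'a form list \<Rightarrow> 'a form" where
  "wedge T \<omega>s = (\<lambda>x vs. if admissible T (length \<omega>s) x vs
     then \<Sum>p | p permutes {..<length \<omega>s}.
            of_int (sign p) * (\<Prod>i<length \<omega>s. (\<omega>s ! i) x [vs ! p i])
     else 0)"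

definition pullback ::
  "'a::euclidean_space list \<Rightarrow> ('a \<Rightarrow> 'a) \<Rightarrow> 'a form \<Rightarrow> 'a form" where
  "pullback T S \<omega> = (\<lambda>x vs. if x \<in> body T \<and> set vs \<subseteq> tangent T
     then \<omega> (S x) (map (frechet_derivative S (at x)) vs) else 0)"


section \<open>Multiindices and alternator indices\<close>

definition multiindices :: "nat \<Rightarrow> nat \<Rightarrow> (nat \<Rightarrow> nat) set" where
  "multiindices r n = {\<alpha>. (\<forall>i>n. \<alpha> i = 0) \<and> (\<Sum>i\<le>n. \<alpha> i) = r}"

definition support :: "(nat \<Rightarrow> nat) \<Rightarrow> nat set" where
  "support \<alpha> = {i. \<alpha> i > 0}"

text \<open>A strictly increasing map is represented by the list of its values. Thus
  \<open>\<sigma> \<in> \<Sigma>(k,n)\<close> has length \<open>k\<close> and \<open>\<sigma>(i)\<close> is \<^term>\<open>\<sigma> ! (i - 1)\<close>, whereas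
  \<open>\<rho> \<in> \<Sigma>\<^sub>0(k,n)\<close> has length \<open>k + 1\<close> and \<open>\<rho>(i)\<close> is \<^term>\<open>\<rho> ! i\<close>.\<close>

definition Sig :: "nat \<Rightarrow> nat \<Rightarrow> nat list set" where
  "Sig k n = {\<sigma>. length \<sigma> = k \<and> sorted_wrt (<) \<sigma> \<and> set \<sigma> \<subseteq> {..n}}"

definition Sig0 :: "nat \<Rightarrow> nat \<Rightarrow> nat list set" where
  "Sig0 k n = {\<rho>. length \<rho> = k + 1 \<and> sorted_wrt (<) \<rho> \<and> set \<rho> \<subseteq> {..n}}"

definition compl_index :: "nat \<Rightarrow> nat list \<Rightarrow> nat list" where
  "compl_index n \<sigma> = sorted_list_of_set ({..n} - set \<sigma>)"

definition sort_sign :: "nat list \<Rightarrow> complex" where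
  "sort_sign xs =
     of_int (sign (THE p. p permutes {..<length xs} \<and> sorted (permute_list p xs)))"

abbreviation eps :: "nat list \<Rightarrow> nat list \<Rightarrow> complex" where
  "eps \<sigma> \<rho> \<equiv> sort_sign (\<sigma> @ \<rho>)"


section \<open>Barycentric polynomial forms\<close>

abbreviation dbary :: "'a::euclidean_space list \<Rightarrow> nat \<Rightarrow> 'a form" where
  "dbary T i \<equiv> differential T (bary T i)"

definition monomial :: "'a::euclidean_space list \<Rightarrow> (nat \<Rightarrow> nat) \<Rightarrow> 'a \<Rightarrow> real" where
  "monomial T \<alpha> x = (\<Prod>i\<le>sdim T. bary T i x ^ \<alpha> i)"

definition bary_prod :: "'a::euclidean_space list \<Rightarrow> nat list \<Rightarrow> 'a \<Rightarrow> real" where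
  "bary_prod T \<sigma> x = (\<Prod>i\<leftarrow>\<sigma>. bary T i x)"

definition dbary_wedge :: "'a::euclidean_space list \<Rightarrow> nat list \<Rightarrow> 'a form" where
  "dbary_wedge T \<sigma> = wedge T (map (dbary T) \<sigma>)"

definition whitney :: "'a::euclidean_space list \<Rightarrow> nat list \<Rightarrow> 'a form" where
  "whitney T \<rho> = (\<Sum>i<length \<rho>. form_scale ((-1) ^ i)
     (func_mult (bary T (\<rho> ! i)) (dbary_wedge T (take i \<rho> @ drop (Suc i) \<rho>))))"

definition P_form :: "'a::euclidean_space list \<Rightarrow> (nat \<Rightarrow> nat) \<times> nat list \<Rightarrow> 'a form" where
  "P_form T = (\<lambda>(\<alpha>, \<sigma>). func_mult (monomial T \<alpha>) (dbary_wedge T \<sigma>))"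

definition Pm_form :: "'a::euclidean_space list \<Rightarrow> (nat \<Rightarrow> nat) \<times> nat list \<Rightarrow> 'a form" where
  "Pm_form T = (\<lambda>(\<alpha>, \<rho>). func_mult (monomial T \<alpha>) (whitney T \<rho>))"

definition P_space :: "'a::euclidean_space list \<Rightarrow> nat \<Rightarrow> nat \<Rightarrow> 'a form set" where
  "P_space T k r = form.span (P_form T ` (multiindices r (sdim T) \<times> Sig k (sdim T)))"


section \<open>Canonical isomorphisms and extension operators\<close>

text \<open>The linear map sending \<^term>\<open>g i\<close> to \<^term>\<open>h i\<close> for all \<^term>\<open>i \<in> I\<close>, where the family
  \<open>g\<close> is in general linearly dependent. If such a map is well-defined on the span of this
  family, then it is unique there; it is represented by some linear extension to all
  forms. The domains of the operators below are the spans of the respective families, and only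
  the values there are ever used.\<close>

definition linear_map_with ::
  "'i set \<Rightarrow> ('i \<Rightarrow> 'a form) \<Rightarrow> ('i \<Rightarrow> 'a form) \<Rightarrow> 'a form \<Rightarrow> 'a form" where
  "linear_map_with I g h =
     (SOME L. Vector_Spaces.linear form_scale form_scale L \<and> (\<forall>i\<in>I. L (g i) = h i))"

text \<open>\<open>\<I>\<^sub>k\<^sub>,\<^sub>r\<close>, defined on \<open>\<P>\<^sub>r\<Lambda>\<^sup>k(T)\<close>\<close>

definition iso_I :: "'a::euclidean_space list \<Rightarrow> nat \<Rightarrow> nat \<Rightarrow> 'a form \<Rightarrow> 'a form" where
  "iso_I T k r = (let n = sdim T in
     linear_map_with (multiindices r n \<times> Sig k n) (P_form T)
       (\<lambda>(\<alpha>, \<sigma>). form_scale (eps \<sigma> (compl_index n \<sigma>))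
          (func_mult (monomial T \<alpha>) (func_mult (bary_prod T \<sigma>)
             (whitney T (compl_index n \<sigma>))))))"

text \<open>\<open>\<J>\<^sub>k\<^sub>,\<^sub>r\<close>, defined on \<open>\<P>\<^sup>-\<^sub>r\<^sub>+\<^sub>1\<Lambda>\<^sup>k(T)\<close>\<close>

definition iso_J :: "'a::euclidean_space list \<Rightarrow> nat \<Rightarrow> nat \<Rightarrow> 'a form \<Rightarrow> 'a form" where
  "iso_J T k r = (let n = sdim T in
     linear_map_with (multiindices r n \<times> Sig0 k n) (Pm_form T)
       (\<lambda>(\<alpha>, \<rho>). form_scale (eps (compl_index n \<rho>) \<rho>)
          (func_mult (monomial T \<alpha>) (func_mult (bary_prod T \<rho>)
             (dbary_wedge T (compl_index n \<rho>))))))"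

definition lift_multi :: "'a list \<Rightarrow> 'a list \<Rightarrow> (nat \<Rightarrow> nat) \<Rightarrow> nat \<Rightarrow> nat" where
  "lift_multi F T \<alpha> j =
     (if j \<in> incl_range F T then \<alpha> (the_inv_into {..sdim F} (incl F T) j) else 0)"

text \<open>For \<open>r \<ge> 1\<close>: the extension operator on the subspace of \<open>\<P>\<^sup>-\<^sub>r\<Lambda>\<^sup>k(F)\<close> with vanishing
  traces, given on the spanning set of that subspace.\<close>

definition ext_Pm ::
  "'a::euclidean_space list \<Rightarrow> 'a list \<Rightarrow> nat \<Rightarrow> nat \<Rightarrow> 'a form \<Rightarrow> 'a form" where
  "ext_Pm F T k r = (let m = sdim F in
     linear_map_with
       {(\<alpha>, \<rho>). \<alpha> \<in> multiindices (r - 1) m \<and> \<rho> \<in> Sig0 k m \<and> support \<alpha> \<union> set \<rho> = {..m}}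
       (Pm_form F)
       (\<lambda>(\<alpha>, \<rho>). Pm_form T (lift_multi F T \<alpha>, map (incl F T) \<rho>)))"

text \<open>The 1-form \<open>\<Psi>\<^sub>i\<close> for a multiindex \<open>\<alpha>\<close> on the vertices of \<open>T\<close>\<close>

definition Psi ::
  "'a::euclidean_space list \<Rightarrow> 'a list \<Rightarrow> (nat \<Rightarrow> nat) \<Rightarrow> nat \<Rightarrow> 'a form" where
  "Psi F T \<alpha> i = dbary T i -
     form_scale (of_nat (\<alpha> i) / of_nat (\<Sum>j\<le>sdim T. \<alpha> j)) (\<Sum>j\<in>incl_range F T. dbary T j)"

text \<open>For \<open>r \<ge> 1\<close>: the extension operator on the subspace of \<open>\<P>\<^sub>r\<Lambda>\<^sup>k(F)\<close> with vanishing
  traces, given on the spanning set of that subspace.\<close>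

definition ext_P ::
  "'a::euclidean_space list \<Rightarrow> 'a list \<Rightarrow> nat \<Rightarrow> nat \<Rightarrow> 'a form \<Rightarrow> 'a form" where
  "ext_P F T k r = (let m = sdim F in
     linear_map_with
       {(\<alpha>, \<sigma>). \<alpha> \<in> multiindices r m \<and> \<sigma> \<in> Sig k m \<and> support \<alpha> \<union> set \<sigma> = {..m}}
       (P_form F)
       (\<lambda>(\<alpha>, \<sigma>). let \<alpha>' = lift_multi F T \<alpha>; \<sigma>' = map (incl F T) \<sigma> in
          func_mult (monomial T \<alpha>') (wedge T (map (Psi F T \<alpha>') \<sigma>'))))"


section \<open>The recursively constructed bases\<close>

definition vol :: "'a::euclidean_space list \<Rightarrow> 'a form" where
  "vol T = dbary_wedge T [1..<length T]"

definition xi :: complex where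
  "xi = exp (2 * of_real pi * \<i> / 3)"

definition psi_w :: "'a::euclidean_space list \<Rightarrow> 'a form" where
  "psi_w T = dbary T 0 - dbary T 1 + dbary T 2 - dbary T 3"

definition psi_p :: "'a::euclidean_space list \<Rightarrow> 'a form" where
  "psi_p T = dbary T 0 + dbary T 1 - dbary T 2 - dbary T 3"

definition psi_k :: "'a::euclidean_space list \<Rightarrow> 'a form" where
  "psi_k T = dbary T 0 - dbary T 1 - dbary T 2 + dbary T 3"

text \<open>The cases not covered by the explicit formulas below are \<open>dim T \<ge> 4\<close> and
  \<open>0 < k < dim T\<close>. There, \<open>B\<close> supplies the fixed basis of constant forms.\<close>

definition choice_of_constant_bases ::
  "('a::euclidean_space list \<Rightarrow> nat \<Rightarrow> 'a form set) \<Rightarrow> bool" where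
  "choice_of_constant_bases B \<longleftrightarrow>
     (\<forall>T k. ordered_simplex T \<and> sdim T \<ge> 4 \<and> 0 < k \<and> k < sdim T \<longrightarrow>
        form.independent (B T k) \<and> form.span (B T k) = P_space T k 0)"

definition constant_basis ::
  "('a::euclidean_space list \<Rightarrow> nat \<Rightarrow> 'a form set) \<Rightarrow> 'a list \<Rightarrow> nat \<Rightarrow> 'a form set" where
  "constant_basis B T k = (let n = sdim T in
     if k = 0 then {wedge T []}
     else if k = n then {vol T}
     else if n = 2 \<and> k = 1 then
       {dbary T 0 + form_scale xi (dbary T 1) + form_scale (xi\<^sup>2) (dbary T 2),
        dbary T 0 + form_scale (xi\<^sup>2) (dbary T 1) + form_scale xi (dbary T 2)}
     else if n = 3 \<and> k = 1 then {psi_w T, psi_p T, psi_k T}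
     else if n = 3 \<and> k = 2 then
       {wedge T [psi_w T, psi_p T], wedge T [psi_w T, psi_k T], wedge T [psi_p T, psi_k T]}
     else B T k)"

text \<open>\<open>AP\<close>, \<open>AP0\<close>, \<open>APm\<close>, \<open>APm0\<close> are the bases of \<open>\<P>\<^sub>r\<Lambda>\<^sup>k(T)\<close>, of its subspace with
  vanishing traces, of \<open>\<P>\<^sup>-\<^sub>r\<Lambda>\<^sup>k(T)\<close>, and of its subspace with vanishing traces.
  Degrees are natural numbers: the recursion never descends to a negative degree.
  The subtractions are not truncated where they are evaluated; with \<open>n = dim T\<close> one has
  \<open>r - (n - k + 1) = r - n + k - 1\<close> and \<open>r - (n - k) = r - n + k\<close>.\<close>

function
  AP :: "('a::euclidean_space list \<Rightarrow> nat \<Rightarrow> 'a form set) \<Rightarrow> 'a list \<Rightarrow> nat \<Rightarrow> nat \<Rightarrow> 'a form set"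
and
  AP0 :: "('a::euclidean_space list \<Rightarrow> nat \<Rightarrow> 'a form set) \<Rightarrow> 'a list \<Rightarrow> nat \<Rightarrow> nat \<Rightarrow> 'a form set"
and
  APm :: "('a::euclidean_space list \<Rightarrow> nat \<Rightarrow> 'a form set) \<Rightarrow> 'a list \<Rightarrow> nat \<Rightarrow> nat \<Rightarrow> 'a form set"
and
  APm0 :: "('a::euclidean_space list \<Rightarrow> nat \<Rightarrow> 'a form set) \<Rightarrow> 'a list \<Rightarrow> nat \<Rightarrow> nat \<Rightarrow> 'a form set"
where
  "AP B T k r =
     (if k > sdim T then {}
      else if r = 0 then constant_basis B T k
      else (\<Union>F\<in>subsimplices T. ext_P F T k r ` AP0 B F k r))"
| "AP0 B T k r =
     (if k > sdim T then {}
      else if k = sdim T \<and> r = 0 then {vol T}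
      else if r < sdim T - k + 1 then {}
      else iso_J T (sdim T - k) (r - (sdim T - k + 1)) `
             APm B T (sdim T - k) (r - (sdim T - k)))"
| "APm B T k r =
     (if k > sdim T then {}
      else if r = 0 then {}
      else (\<Union>F\<in>subsimplices T. ext_Pm F T k r ` APm0 B F k r))"
| "APm0 B T k r =
     (if k > sdim T then {}
      else if r < sdim T - k + 1 then {}
      else iso_I T (sdim T - k) (r - (sdim T - k + 1)) `
             AP B T (sdim T - k) (r - (sdim T - k + 1)))"
  by pat_completeness auto
termination
  by (relation "Wellfounded.measure (case_sum
        (case_sum (\<lambda>(B, T, k, r). 4 * r + 3) (\<lambda>(B, T, k, r). 4 * r + 2))
        (case_sum (\<lambda>(B, T, k, r). 4 * r + 1) (\<lambda>(B, T, k, r). 4 * r)))") auto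

declare AP.simps [simp del] AP0.simps [simp del] APm.simps [simp del] APm0.simps [simp del]


section \<open>Invariance\<close>

text \<open>\<open>K\<close> is the set of admissible coefficients, \<^term>\<open>\<real>\<close> or \<^term>\<open>UNIV\<close>. The elements of the
  finite set \<open>W\<close> index themselves.\<close>

definition invariant_set ::
  "complex set \<Rightarrow> 'a::euclidean_space list \<Rightarrow> 'a form set \<Rightarrow> bool" where
  "invariant_set K T W \<longleftrightarrow> finite W \<and>
     (\<forall>\<pi>. \<pi> permutes {..sdim T} \<longrightarrow>
        (\<exists>\<tau> c. bij_betw \<tau> W W \<and>
           (\<forall>\<omega>\<in>W. c \<omega> \<in> K \<and> cmod (c \<omega>) = 1 \<and>
              pullback T (vertex_map T \<pi>) \<omega> = form_scale (c \<omega>) (\<tau> \<omega>))))"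

abbreviation C_invariant :: "'a::euclidean_space list \<Rightarrow> 'a form set \<Rightarrow> bool" where
  "C_invariant \<equiv> invariant_set UNIV"

abbreviation R_invariant :: "'a::euclidean_space list \<Rightarrow> 'a form set \<Rightarrow> bool" where
  "R_invariant \<equiv> invariant_set \<real>"

end

theory Submission
  imports Defs
begin

text \<open>On a triangle, \<open>\<I>\<^sub>1\<close> and \<open>\<J>\<^sub>1\<close> act pointwise on
  1-forms. They commute with \<open>S\<^sub>\<pi>\<close> up to the sign of \<open>\<pi>\<close>, they
  preserve real coefficients, and both compositions are multiplication by \<open>\<lambda>\<^sub>0
  \<lambda>\<^sub>1 \<lambda>\<^sub>2\<close>, so both are injective. On edges the recursion produces the
  monomials (up to a symmetric sign) times \<open>d\<lambda>\<^sub>1\<close>, and their extensions to the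
  triangle are real and are permuted, up to sign, by \<open>S\<^sub>\<pi>\<close>. The image of
  \<open>\<I>\<^sub>1\<close> and of \<open>\<J>\<^sub>1\<close> has no tangential trace on the edges, so
  the edge part of a basis never interferes with the interior part. Hence each basis inherits its
  symmetry type from the interior part, and one cycle \<open>\<P>\<^sub>r \<rightarrow>
  \<P>\<^sup>-\<^sub>r\<^sub>+\<^sub>2 \<rightarrow> \<P>\<^sub>r\<^sub>+\<^sub>3\<close> raises the
  degree by three. It starts either with an edge part only, which is \<open>\<real>\<close>-invariant, or
  with the two constant forms of degree 0. The latter are eigenvectors of a rotation with two distinct
  non-real eigenvalues. Their images stay such eigenvectors while all other basis forms are real, which
  excludes \<open>\<real>\<close>-invariance.\<close>

text \<open>The operators of the statement are Hilbert choices of linear maps prescribed on linearly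
  dependent families, so nothing is known about them until one linear map with the prescribed values
  is exhibited. For the isomorphisms such a witness acts pointwise, on the triangle through the
  values of a 1-form on differences of vertices. Extension from an edge depends on the exponents of
  a monomial, so there the witness comes from linear independence. A second obstacle is that
  invariance asks for a bijection of the basis elements. Families are therefore kept free of
  proportional pairs; this survives injective operators, and it survives union with edge forms
  because traces of proportional forms vanish simultaneously. The factor
  \<open>\<lambda>\<^sub>0 \<lambda>\<^sub>1 \<lambda>\<^sub>2\<close> can be cancelled only in the
  interior of the triangle, hence the restriction to continuous coefficients. Finally, an invariance
  might send one eigenform to a multiple of the other; this is why their eigenvalues have to
  differ.\<close>

section \<open>Affine maps and barycentric coordinates\<close>

lemma affine_mapE:
  assumes "affine_map f" obtains g b where "linear g" "f = (\<lambda>x. g x + b)"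
  using assms unfolding affine_map_def by blast

text \<open>The points where two affine maps agree form a convex set, so it suffices to compare them
  on the points that generate the hull.\<close>

lemma affine_map_eqI:
  assumes "affine_map f" "affine_map g" "x \<in> convex hull S" "\<And>v. v \<in> S \<Longrightarrow> f
      v = g v"
  shows "f x = g x"
proof -
  have "convex {x. f x = g x}"
  proof -
    have "f (u *\<^sub>R y + v *\<^sub>R z) = g (u *\<^sub>R y + v *\<^sub>R z)"
      if yz: "f y = g y" "f z = g z" and uv: "u + v = 1" for y z and u v :: real
    proof -
      have aff: "h (u *\<^sub>R y + v *\<^sub>R z) = u *\<^sub>R h y + v *\<^sub>R h z" if "affine_map
          h" for h :: "'a \<Rightarrow> 'b"
      proof -
        obtain l b where l: "linear l" "h = (\<lambda>x. l x + b)" using affine_mapE[OF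
            \<open>affine_map h\<close>] .
        have v: "v = 1 - u" using uv by simp
        show ?thesis
          unfolding l(2) v by (simp add: linear_add[OF l(1)] linear_scale[OF l(1)]) (simp add:
              algebra_simps)
      qed
      show ?thesis using aff[OF assms(1)] aff[OF assms(2)] yz by simp
    qed
    then show ?thesis unfolding convex_def by blast
  qed
  then have "convex hull S \<subseteq> {x. f x = g x}" using assms(4) by (intro hull_minimal) auto
  then show ?thesis using assms(3) by blast
qed

lemma affine_map_continuous:
  fixes f :: "'a::euclidean_space \<Rightarrow> 'b::real_normed_vector"
  assumes "affine_map f" shows "continuous_on S f"
proof -
  obtain g b where g: "linear g" "f = (\<lambda>x. g x + b)" using affine_mapE[OF assms] .
  show ?thesis unfolding g(2)
    by (intro continuous_intros linear_continuous_on linear_conv_bounded_linear[THEN iffD1] g(1))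
qed

lemma affine_map_diff:
  assumes "affine_map f" shows "f x - f y = f (x - y) - f 0"
proof -
  obtain g b where g: "linear g" "f = (\<lambda>x. g x + b)" using affine_mapE[OF assms] .
  then show ?thesis by (simp add: linear_diff linear_0)
qed

lemma affine_map_linear_part:
  assumes "affine_map f" shows "linear (\<lambda>v. f v - f 0)"
proof -
  obtain g b where g: "linear g" "f = (\<lambda>x. g x + b)" using affine_mapE[OF assms] .
  then have "(\<lambda>v. f v - f 0) = g" by (simp add: linear_0)
  then show ?thesis using g by simp
qed

text \<open>The linear part is written as \<open>f v - f 0\<close>, so that no linear map has to be
  named later.\<close>

lemma frechet_derivative_affine_map:
  fixes f :: "'a::euclidean_space \<Rightarrow> 'b::real_normed_vector"
  assumes "affine_map f" shows "frechet_derivative f (at x) = (\<lambda>v. f v - f 0)"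
proof -
  obtain g b where g: "linear g" "f = (\<lambda>x. g x + b)" using affine_mapE[OF assms] .
  have "(f has_derivative g) (at x)"
    unfolding g(2) using g(1)
    by (auto intro!: derivative_eq_intros linear_imp_has_derivative)
  then have "frechet_derivative f (at x) = g" using frechet_derivative_at by metis
  then show ?thesis using g by (simp add: linear_0)
qed

text \<open>Affine independence makes the differences of the other vertices to \<open>T ! 0\<close>
  linearly independent, so a linear map can be prescribed on them; the constant is then fixed by
  \<open>y 0\<close>.\<close>

lemma affine_map_extension:
  fixes T :: "'a::euclidean_space list" and y :: "nat \<Rightarrow> 'b::real_vector"
  assumes "ordered_simplex T"
  shows "\<exists>f. affine_map f \<and> (\<forall>j\<le>sdim T. f (T ! j) = y j)"
proof -
  have T: "T \<noteq> []" "distinct T" "\<not> affine_dependent (set T)"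
    using assms by (auto simp: ordered_simplex_def)
  define a where "a = T ! 0"
  have a: "a \<in> set T" using T by (simp add: a_def)
  \<comment> \<open>Recovers the position of a vertex, so that the prescribed values become a
    function of the vector.\<close>
  define idx where "idx v = (THE j. j < length T \<and> T ! j = v)" for v
  have idx: "idx (T ! j) = j" if "j < length T" for j
    unfolding idx_def using that T(2) nth_eq_iff_index_eq by (intro the_equality) auto
  have "independent ((\<lambda>x. -a + x) ` (set T - {a}))"
    using affine_dependent_iff_dependent2[OF a] T(3) by blast
  then obtain g where g: "linear g"
    "\<forall>v\<in>(\<lambda>x. -a + x) ` (set T - {a}). g v = y (idx (v + a)) - y 0"
    using linear_independent_extend[of _ "\<lambda>v. y (idx (v + a)) - y 0"] by metis
  define f where "f x = g x + (y 0 - g a)" for x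
  have "affine_map f" using g(1) unfolding affine_map_def f_def by blast
  moreover have "f (T ! j) = y j" if j: "j \<le> sdim T" for j
  proof (cases "j = 0")
    case True then show ?thesis by (simp add: f_def a_def)
  next
    case False
    have jl: "j < length T" using j T(1) by (cases T) (auto simp: sdim_def)
    then have "T ! j \<noteq> a" using False T by (simp add: a_def nth_eq_iff_index_eq)
    then have "g (- a + T ! j) = y (idx (T ! j)) - y 0" using g(2) jl by auto
    then have "g (T ! j) - g a = y j - y 0"
      using idx[OF jl] by (simp add: linear_diff[OF g(1)])
    then show ?thesis by (simp add: f_def algebra_simps)
  qed
  ultimately show ?thesis by blast
qed

lemma bary_spec:
  assumes "ordered_simplex T"
  shows "affine_map (bary T i)" "j \<le> sdim T \<Longrightarrow> bary T i (T ! j) = (if j = i then 1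
      else 0)"
proof -
  have "affine_map (bary T i) \<and> (\<forall>j\<le>sdim T. bary T i (T ! j) = (if j = i then 1 else 0))"
    using someI_ex[OF affine_map_extension[OF assms]] unfolding bary_def .
  then show "affine_map (bary T i)" "j \<le> sdim T \<Longrightarrow> bary T i (T ! j) = (if j = i then
      1 else 0)" by auto
qed

lemma vertex_map_spec:
  assumes "ordered_simplex T"
  shows "affine_map (vertex_map T \<pi>)" "j \<le> sdim T \<Longrightarrow> vertex_map T \<pi> (T ! j)
      = T ! inv \<pi> j"
proof -
  have "affine_map (vertex_map T \<pi>) \<and> (\<forall>j\<le>sdim T. vertex_map T \<pi> (T ! j) = T !
      inv \<pi> j)"
    using someI_ex[OF affine_map_extension[OF assms]] unfolding vertex_map_def .
  then show "affine_map (vertex_map T \<pi>)" "j \<le> sdim T \<Longrightarrow> vertex_map T \<pi> (T !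
      j) = T ! inv \<pi> j" by auto
qed

lemma in_set_simplex:
  assumes "ordered_simplex T"
  shows "v \<in> set T \<longleftrightarrow> (\<exists>j\<le>sdim T. v = T ! j)"
proof -
  have "j < length T \<longleftrightarrow> j \<le> sdim T" for j
    using assms by (cases T) (auto simp: ordered_simplex_def sdim_def)
  then show ?thesis by (metis in_set_conv_nth)
qed

lemma vertex_in_body:
  assumes "ordered_simplex T" "j \<le> sdim T" shows "T ! j \<in> body T"
  using in_set_simplex[OF assms(1)] assms(2) hull_inc unfolding body_def by metis

lemma convex_body: "convex (body T)"
  by (simp add: body_def)

lemma edge_point_in_body:
  assumes "ordered_simplex T" "i \<le> sdim T" "j \<le> sdim T" "0 \<le> t" "t \<le> 1"
  shows "(1 - t) *\<^sub>R T ! i + t *\<^sub>R T ! j \<in> body T"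
  using convexD_alt[OF convex_body, of "T ! i" T "T ! j" t] vertex_in_body[OF assms(1)] assms by simp

lemma edge_in_tangent:
  assumes "ordered_simplex T" "i \<le> sdim T" "j \<le> sdim T"
  shows "T ! i - T ! j \<in> tangent T"
proof -
  have "T ! i \<in> set T" "T ! j \<in> set T" using assms in_set_simplex by metis+
  then show ?thesis unfolding tangent_def by (intro span_base) blast
qed

lemma bary_nonneg:
  assumes "ordered_simplex T" "x \<in> body T" shows "0 \<le> bary T i x"
proof -
  have "convex {x. 0 \<le> bary T i x}"
  proof -
    obtain g b where g: "linear g" "bary T i = (\<lambda>x. g x + b)"
      using affine_mapE[OF bary_spec(1)[OF assms(1)]] .
    have "{x. 0 \<le> bary T i x} = g -` {-b..}" using g(2) by auto
    then show ?thesis using convex_linear_vimage[OF g(1)] by simp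
  qed
  moreover have "set T \<subseteq> {x. 0 \<le> bary T i x}"
    using bary_spec(2)[OF assms(1)] in_set_simplex[OF assms(1)] by auto
  ultimately show ?thesis using assms(2) hull_minimal[of "set T" _ convex] unfolding body_def by blast
qed

lemma affine_map_bary_comb:
  assumes "ordered_simplex T"
  shows "affine_map (\<lambda>x. \<Sum>i\<le>sdim T. bary T i x *\<^sub>R y i)"
proof -
  have "\<exists>g b. linear g \<and> bary T i = (\<lambda>x. g x + b)" for i
    using bary_spec(1)[OF assms] unfolding affine_map_def by blast
  then obtain g b where g: "\<And>i. linear (g i)" "\<And>i. bary T i = (\<lambda>x. g i x + b i)" by metis
  have "linear (\<lambda>x. \<Sum>i\<le>sdim T. g i x *\<^sub>R y i)"
    by (rule linearI) (simp_all add: linear_add[OF g(1)] linear_scale[OF g(1)] scaleR_left_distrib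
        sum.distrib scaleR_sum_right)
  moreover have "(\<lambda>x. \<Sum>i\<le>sdim T. bary T i x *\<^sub>R y i) =
      (\<lambda>x. (\<Sum>i\<le>sdim T. g i x *\<^sub>R y i) + (\<Sum>i\<le>sdim T. b i *\<^sub>R y i))"
    by (simp add: g(2) scaleR_left_distrib sum.distrib)
  ultimately show ?thesis unfolding affine_map_def by blast
qed

text \<open>Barycentric interpolation. Applied to constant maps it gives \<open>sum_bary\<close>;
  applied to the identity it shows that barycentric coordinates determine the point.\<close>

lemma affine_map_eq_bary_comb:
  assumes "ordered_simplex T" "affine_map f" "x \<in> body T"
  shows "f x = (\<Sum>i\<le>sdim T. bary T i x *\<^sub>R f (T ! i))"
proof (rule affine_map_eqI[OF assms(2) affine_map_bary_comb[OF assms(1)] assms(3)[unfolded body_def]])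
  fix v assume "v \<in> set T"
  then obtain j where j: "j \<le> sdim T" "v = T ! j" using in_set_simplex[OF assms(1)] by blast
  then show "f v = (\<Sum>i\<le>sdim T. bary T i v *\<^sub>R f (T ! i))"
    by (simp add: bary_spec(2)[OF assms(1)] if_distrib[of "\<lambda>c. c *\<^sub>R _"] cong: if_cong)
qed

lemma affine_map_id: "affine_map (\<lambda>x. x)"
  unfolding affine_map_def by (intro exI[of _ "\<lambda>x. x"] exI[of _ 0]) (simp add: linear_ident)

lemma affine_map_const: "affine_map (\<lambda>x. c)"
  unfolding affine_map_def by (intro exI[of _ "\<lambda>x. 0"] exI[of _ c]) (simp add: linear_zero)

lemma sum_bary:
  assumes "ordered_simplex T" "x \<in> body T" shows "(\<Sum>i\<le>sdim T. bary T i x) = 1"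
  using affine_map_eq_bary_comb[OF assms(1) affine_map_const assms(2), of "1::real"] by simp

text \<open>The differential of lambda_i as a real functional on the ambient space, namely the
  linear part of the chosen affine extension.\<close>

definition dlam :: "'a::euclidean_space list \<Rightarrow> nat \<Rightarrow> 'a \<Rightarrow> real" where
  "dlam T i v = bary T i v - bary T i 0"

lemma linear_dlam: "ordered_simplex T \<Longrightarrow> linear (dlam T i)"
  using affine_map_linear_part[OF bary_spec(1)] unfolding dlam_def[abs_def] by blast

lemma dlam_diff: "ordered_simplex T \<Longrightarrow> dlam T i (x - y) = bary T i x - bary T i y"
  using affine_map_diff[OF bary_spec(1)] unfolding dlam_def by metis

text \<open>The derivative of the interpolation formula. Both sides are linear in \<open>v\<close>,
  so differences of vertices suffice.\<close>

lemma affine_map_tangent_comb: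
  fixes T :: "'a::euclidean_space list"
  assumes "ordered_simplex T" "affine_map f" "v \<in> tangent T"
  shows "f v - f 0 = (\<Sum>i\<le>sdim T. dlam T i v *\<^sub>R f (T ! i))"
proof -
  have "linear (\<lambda>v. \<Sum>i\<le>sdim T. dlam T i v *\<^sub>R f (T ! i))"
    using affine_map_linear_part[OF affine_map_bary_comb[OF assms(1), of "\<lambda>i. f (T ! i)"]]
    by (simp add: dlam_def scaleR_left_diff_distrib sum_subtractf)
  moreover note affine_map_linear_part[OF assms(2)]
  moreover have "f w - f 0 = (\<Sum>i\<le>sdim T. dlam T i w *\<^sub>R f (T ! i))"
    if "w \<in> {v - w | v w. v \<in> set T \<and> w \<in> set T}" for w
  proof -
    obtain a b where ab: "a \<in> set T" "b \<in> set T" "w = a - b" using \<open>w \<in> _\<close> by blast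
    then have "a \<in> body T" "b \<in> body T" by (auto simp: body_def hull_inc)
    then have "f a - f b = (\<Sum>i\<le>sdim T. dlam T i (a - b) *\<^sub>R f (T ! i))"
      using affine_map_eq_bary_comb[OF assms(1,2)] 
      by (simp add: dlam_diff[OF assms(1)] scaleR_left_diff_distrib sum_subtractf)
    then show ?thesis using affine_map_diff[OF assms(2)] ab by metis
  qed
  ultimately show ?thesis
    using linear_eq_on_span[of "\<lambda>v. f v - f 0"] assms(3) unfolding tangent_def by blast
qed

lemma sum_dlam:
  assumes "ordered_simplex T" "v \<in> tangent T" shows "(\<Sum>i\<le>sdim T. dlam T i v) = 0"
  using affine_map_tangent_comb[OF assms(1) affine_map_const assms(2), of "1::real"] by simp

lemma differential_bary:
  assumes "ordered_simplex T"
  shows "differential T (bary T i) =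
    (\<lambda>x vs. if admissible T 1 x vs then of_real (dlam T i (vs ! 0)) else 0)"
  unfolding differential_def frechet_derivative_affine_map[OF bary_spec(1)[OF assms]] dlam_def ..

lemma subspace_tangent: "subspace (tangent T)"
  unfolding tangent_def by simp

section \<open>Action of vertex permutations on points and tangent vectors\<close>

context
  fixes T :: "'a::euclidean_space list" and \<pi> :: "nat \<Rightarrow> nat"
  assumes T: "ordered_simplex T" and \<pi>: "\<pi> permutes {..sdim T}"
begin

lemma vertex_map_in_body:
  assumes "x \<in> body T" shows "vertex_map T \<pi> x \<in> body T"
proof -
  have "vertex_map T \<pi> x = (\<Sum>i\<le>sdim T. bary T i x *\<^sub>R T ! (inv \<pi> i))"
    using affine_map_eq_bary_comb[OF T vertex_map_spec(1)[OF T] assms] vertex_map_spec(2)[OF T] by simp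
  moreover have "\<dots> \<in> body T"
  proof (rule convex_sum[OF _ convex_body])
    show "T ! inv \<pi> i \<in> body T" if "i \<in> {..sdim T}" for i
      using that permutes_in_image[OF permutes_inv[OF \<pi>]] vertex_in_body[OF T] by auto
  qed (use sum_bary[OF T assms] bary_nonneg[OF T assms] in auto)
  ultimately show ?thesis by simp
qed

text \<open>Both sides are affine in \<open>x\<close>, and at vertex j the claim reads
  \<open>inv \<pi> j = i\<close> iff \<open>j = \<pi> i\<close>. The inverse in the definition of
  the vertex map thus puts \<open>\<pi>\<close> itself on the coordinates.\<close>

lemma bary_vertex_map:
  assumes "x \<in> body T" "i \<le> sdim T"
  shows "bary T i (vertex_map T \<pi> x) = bary T (\<pi> i) x"
proof -
  obtain g b where g: "linear g" "bary T i = (\<lambda>x. g x + b)"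
    using affine_mapE[OF bary_spec(1)[OF T]] .
  obtain h c where h: "linear h" "vertex_map T \<pi> = (\<lambda>x. h x + c)"
    using affine_mapE[OF vertex_map_spec(1)[OF T]] .
  have "affine_map (\<lambda>x. bary T i (vertex_map T \<pi> x))"
    unfolding affine_map_def g(2) h(2)
    by (intro exI[of _ "\<lambda>x. g (h x)"] exI[of _ "g c + b"])
      (auto simp: linear_add[OF g(1)] linear_compose[OF h(1) g(1), unfolded o_def])
  moreover have "bary T i (vertex_map T \<pi> v) = bary T (\<pi> i) v" if v: "v \<in> set T" for v
  proof -
    obtain j where j: "j \<le> sdim T" "v = T ! j" using in_set_simplex[OF T] v by blast
    have "inv \<pi> j \<le> sdim T" using permutes_in_image[OF permutes_inv[OF \<pi>]] j by auto
    moreover have "inv \<pi> j = i \<longleftrightarrow> j = \<pi> i" using permutes_inverses[OF \<pi>]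
        by metis
    ultimately show ?thesis using j by (simp add: bary_spec(2)[OF T] vertex_map_spec(2)[OF T])
  qed
  ultimately show ?thesis
    using affine_map_eqI[OF _ bary_spec(1)[OF T] assms(1)[unfolded body_def]] by blast
qed

text \<open>Both claims are linear in \<open>v\<close> and are proved by one induction over the span
  of the differences of vertices, where the second reduces to
  \<open>bary_vertex_map\<close>.\<close>

lemma
  assumes "v \<in> tangent T"
  shows vertex_map_tangent: "frechet_derivative (vertex_map T \<pi>) (at x) v \<in> tangent T"
    and dlam_vertex_map:
      "i \<le> sdim T \<Longrightarrow> dlam T i (frechet_derivative (vertex_map T \<pi>) (at x) v) =
          dlam T (\<pi> i) v"
proof -
  let ?D = "frechet_derivative (vertex_map T \<pi>) (at x)"
  have lin: "linear ?D"
    unfolding frechet_derivative_affine_map[OF vertex_map_spec(1)[OF T]]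
    by (rule affine_map_linear_part[OF vertex_map_spec(1)[OF T]])
  have D: "?D (a - b) = vertex_map T \<pi> a - vertex_map T \<pi> b" for a b
    unfolding frechet_derivative_affine_map[OF vertex_map_spec(1)[OF T]]
    by (rule affine_map_diff[OF vertex_map_spec(1)[OF T], symmetric])
  have "?D v \<in> tangent T \<and> (i \<le> sdim T \<longrightarrow> dlam T i (?D v) - dlam T (\<pi>
      i) v = 0)" for i
    using assms[unfolded tangent_def]
  proof (induction rule: span_induct)
    case base
    have "subspace {v. dlam T i (?D v) - dlam T (\<pi> i) v = 0}"
      using linear_subspace_kernel[OF linear_compose_sub[OF linear_compose[OF lin linear_dlam[OF T]]
          linear_dlam[OF T]]]
      by (simp add: o_def)
    moreover have "subspace {v. ?D v \<in> tangent T}"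
      using linear_subspace_vimage[OF lin subspace_tangent] by (simp add: vimage_def)
    ultimately show ?case 
      by (cases "i \<le> sdim T") (auto simp: Collect_conj_eq intro: subspace_inter)
  next
    case (step w)
    then obtain a b where ab: "a \<in> set T" "b \<in> set T" "w = a - b" by blast
    then have bd: "a \<in> body T" "b \<in> body T" by (auto simp: body_def hull_inc)
    obtain j k where jk: "j \<le> sdim T" "a = T ! j" "k \<le> sdim T" "b = T ! k" using
        in_set_simplex[OF T] ab by blast
    have "inv \<pi> j \<le> sdim T" "inv \<pi> k \<le> sdim T" using permutes_in_image[OF
        permutes_inv[OF \<pi>]] jk by auto
    then have "?D w \<in> tangent T" using jk ab edge_in_tangent[OF T] by (simp add: D
        vertex_map_spec(2)[OF T])
    then show ?case by (simp add: ab D dlam_diff[OF T] bary_vertex_map bd)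
  qed
  then show "?D v \<in> tangent T" "i \<le> sdim T \<Longrightarrow> dlam T i (?D v) = dlam T (\<pi> i)
      v" by auto
qed

end

section \<open>Chosen linear maps; 0-forms, 1-forms and sorting signs in coordinates\<close>

global_interpretation form_pair: vector_space_pair form_scale form_scale ..

lemma form_linearI:
  assumes "\<And>a b. L (a + b) = L a + L b" "\<And>c a. L (form_scale c a) = form_scale c (L a)"
  shows "Vector_Spaces.linear form_scale form_scale L"
  using assms by (simp add: Vector_Spaces.linear_iff form.vector_space_axioms)

text \<open>One linear map \<open>L\<close> with the prescribed values shows that the choice in
  \<open>linear_map_with\<close> succeeds; on the span of the family the chosen map then agrees with
  \<open>L\<close>. Supplying \<open>L\<close> is the proof that an operator is well
  defined.\<close>

lemma linear_map_with_eq: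
  assumes "Vector_Spaces.linear form_scale form_scale L" "\<And>i. i \<in> I \<Longrightarrow> L (g i)
      = h i"
    and "\<omega> \<in> form.span (g ` I)"
  shows "linear_map_with I g h \<omega> = L \<omega>"
proof -
  have *: "Vector_Spaces.linear form_scale form_scale (linear_map_with I g h) \<and>
      (\<forall>i\<in>I. linear_map_with I g h (g i) = h i)"
    using someI[of "\<lambda>L. Vector_Spaces.linear form_scale form_scale L \<and> (\<forall>i\<in>I.
        L (g i) = h i)" L]
      assms(1,2)
    unfolding linear_map_with_def by blast
  show ?thesis
    by (rule form_pair.linear_eq_on_span[of "linear_map_with I g h" L "g ` I"]) (use * assms in auto)
qed

lemma linear_map_with_id:
  assumes "\<And>i. i \<in> I \<Longrightarrow> g i = h i" "\<omega> \<in> form.span (g ` I)"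
  shows "linear_map_with I g h \<omega> = \<omega>"
  by (rule linear_map_with_eq[where L = "\<lambda>\<omega>. \<omega>"]) (use assms
      form.linear_id[unfolded id_def] in auto)

definition zero_form :: "'a::euclidean_space list \<Rightarrow> ('a \<Rightarrow> complex)
    \<Rightarrow> 'a form" where
  "zero_form T f = (\<lambda>x vs. if admissible T 0 x vs then f x else 0)"

text \<open>The form sum_i c_i dlambda_i with complex coefficient functions, cut off like every
  other form, so that equations of forms become equations of coefficients.\<close>

definition one_form :: "'a::euclidean_space list \<Rightarrow> (nat \<Rightarrow> 'a \<Rightarrow>
    complex) \<Rightarrow> 'a form" where
  "one_form T c = (\<lambda>x vs. if admissible T 1 x vs
     then \<Sum>i\<le>sdim T. c i x * of_real (dlam T i (vs ! 0)) else 0)"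

lemma zero_form_ops:
  "func_mult u (zero_form T f) = zero_form T (\<lambda>x. of_real (u x) * f x)"
  "form_scale c (zero_form T f) = zero_form T (\<lambda>x. c * f x)"
  "- zero_form T f = zero_form T (\<lambda>x. - f x)"
  by (auto simp: zero_form_def func_mult_def form_scale_def fun_eq_iff)

lemma one_form_ops:
  "func_mult u (one_form T f) = one_form T (\<lambda>i x. of_real (u x) * f i x)"
  "form_scale c (one_form T f) = one_form T (\<lambda>i x. c * f i x)"
  "- one_form T f = one_form T (\<lambda>i x. - f i x)"
  "one_form T f + one_form T g = one_form T (\<lambda>i x. f i x + g i x)"
  "one_form T f - one_form T g = one_form T (\<lambda>i x. f i x - g i x)"
  by (auto simp: one_form_def func_mult_def form_scale_def fun_eq_iff sum_distrib_left ac_simps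
      ring_distribs sum.distrib sum_subtractf sum_negf)

lemma zero_form_cong: "(\<And>x. x \<in> body T \<Longrightarrow> f x = g x) \<Longrightarrow>
    zero_form T f = zero_form T g"
  by (auto simp: zero_form_def admissible_def fun_eq_iff)

lemma wedge_Nil: "wedge T [] = zero_form T (\<lambda>x. 1)"
  by (intro ext) (simp add: wedge_def zero_form_def)

text \<open>\<open>wedge\<close> cuts off inadmissible arguments, so the factor must already vanish
  there.\<close>

lemma wedge_single:
  assumes "\<And>x vs. \<not> admissible T 1 x vs \<Longrightarrow> \<omega> x vs = 0"
  shows "wedge T [\<omega>] = \<omega>"
proof -
  have p: "{p. p permutes {..<Suc 0}} = {id}"
    by (auto simp: lessThan_Suc)
  have "wedge T [\<omega>] x vs = \<omega> x vs" for x vs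
  proof (cases "admissible T 1 x vs")
    case True
    then have "[vs ! 0] = vs" by (auto simp: admissible_def length_Suc_conv)
    then show ?thesis using True by (simp add: wedge_def p)
  qed (simp add: wedge_def assms)
  then show ?thesis by (simp add: fun_eq_iff)
qed

lemma dbary_one_form:
  assumes "ordered_simplex T" "i \<le> sdim T"
  shows "dbary T i = one_form T (\<lambda>j x. if j = i then 1 else 0)"
  using assms(2) unfolding differential_bary[OF assms(1)] one_form_def
  by (simp add: fun_eq_iff if_distrib[of "\<lambda>c. c * _"] cong: if_cong)

lemma wedge_one_form: "wedge T [one_form T c] = one_form T c"
  by (rule wedge_single) (simp add: one_form_def)

lemma dbary_wedge_Nil: "dbary_wedge T [] = zero_form T (\<lambda>x. 1)"
  by (simp add: dbary_wedge_def wedge_Nil)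

lemma dbary_wedge_single:
  assumes "ordered_simplex T" "i \<le> sdim T"
  shows "dbary_wedge T [i] = one_form T (\<lambda>j x. if j = i then 1 else 0)"
  by (simp add: dbary_wedge_def dbary_one_form[OF assms] wedge_one_form)

lemma whitney_single: "whitney T [i] = zero_form T (\<lambda>x. of_real (bary T i x))"
  by (simp add: whitney_def dbary_wedge_Nil zero_form_ops)

lemma whitney_pair:
  assumes "ordered_simplex T" "i \<le> sdim T" "j \<le> sdim T"
  shows "whitney T [i, j] = one_form T (\<lambda>k x.
    of_real (bary T i x) * (if k = j then 1 else 0) - of_real (bary T j x) * (if k = i then 1 else 0))"
proof -
  have "whitney T [i, j] = func_mult (bary T i) (dbary_wedge T [j]) +
      form_scale (- 1) (func_mult (bary T j) (dbary_wedge T [i]))"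
    by (simp add: whitney_def numeral_2_eq_2)
  then show ?thesis
    by (simp add: dbary_wedge_single assms one_form_ops)
qed

text \<open>A list without repetitions has only one sorting permutation, so any one that is found
  determines the \<open>THE\<close> in \<open>sort_sign\<close>.\<close>

lemma sort_sign_eq:
  assumes "distinct xs" "p permutes {..<length xs}" "sorted (permute_list p xs)"
  shows "sort_sign xs = of_int (sign p)"
proof -
  have "(THE p. p permutes {..<length xs} \<and> sorted (permute_list p xs)) = p"
  proof (rule the_equality)
    fix q assume q: "q permutes {..<length xs} \<and> sorted (permute_list q xs)"
    have "mset (permute_list q xs) = mset (permute_list p xs)" using q assms by simp
    then have eq: "permute_list q xs = permute_list p xs"
      using q assms(3) by (metis properties_for_sort)
    have "q i = p i" for i
    proof (cases "i < length xs")
      case True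
      then have "xs ! q i = xs ! p i"
        using eq q assms by (metis permute_list_nth)
      moreover have "q i < length xs" "p i < length xs"
        using True q assms(2) by (metis lessThan_iff permutes_in_image)+
      ultimately show ?thesis using assms(1) by (simp add: nth_eq_iff_index_eq)
    next
      case False
      then show ?thesis using q assms(2) by (metis lessThan_iff permutes_not_in)
    qed
    then show "q = p" by blast
  qed (use assms in auto)
  then show ?thesis by (simp add: sort_sign_def)
qed

lemma sort_sign_sorted: "sorted_wrt (<) xs \<Longrightarrow> sort_sign xs = 1"
  using sort_sign_eq[of xs id] by (simp add: strict_sorted_iff)

lemma sort_sign_swap:
  assumes "i < j" "j < length xs" "distinct xs" "sorted (permute_list (Transposition.transpose i j) xs)"
  shows "sort_sign xs = - 1"
  using sort_sign_eq[OF assms(3) permutes_swap_id[of i _ j] assms(4)] assms(1,2) by (simp add: sign_swap_id)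

text \<open>These cover every index pair that the isomorphisms meet on edges and on the
  triangle.\<close>

lemma sort_sign_values:
  "sort_sign [0, Suc 0] = 1" "sort_sign [Suc 0, 0] = - 1"
  "sort_sign [0, Suc 0, 2] = 1" "sort_sign [Suc 0, 0, 2] = - 1" "sort_sign [2, 0, Suc 0] = 1"
proof -
  show "sort_sign [0, Suc 0] = 1" "sort_sign [0, Suc 0, 2] = 1"
    by (rule sort_sign_sorted; simp)+
  show "sort_sign [Suc 0, 0] = - 1" "sort_sign [Suc 0, 0, 2] = - 1"
    by (rule sort_sign_swap[of 0 1]; simp add: permute_list_def Transposition.transpose_def upt_rec)+
  \<comment> \<open>A cyclic shift, factored into two transpositions and hence even.\<close>
  let ?p = "Transposition.transpose 0 (1::nat) \<circ> Transposition.transpose 1 2"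
  have "?p permutes {..<3}"
    by (intro permutes_compose permutes_swap_id) auto
  then have "sort_sign [2, 0, Suc 0] = of_int (sign ?p)"
    by (intro sort_sign_eq) (auto simp: permute_list_def Transposition.transpose_def upt_rec numeral_3_eq_3)
  moreover have "sign ?p = 1"
    by (subst sign_compose) (auto simp: sign_swap_id permutation_swap_id)
  ultimately show "sort_sign [2, 0, Suc 0] = 1" by simp
qed

section \<open>Index sets and self-extension\<close>

text \<open>A multiindex encoded by the list of its first values and extended by 0, so that in
  dimension at most 2 all multiindices can be enumerated explicitly.\<close>

definition mi :: "nat list \<Rightarrow> nat \<Rightarrow> nat" where
  "mi as i = (if i < length as then as ! i else 0)"

lemma mi_simps [simp]:
  "mi (a # as) 0 = a" "mi (a # as) (Suc i) = mi as i" "mi [] i = 0"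
  by (auto simp: mi_def)

lemma multiindices_0: "multiindices r 0 = {mi [r]}"
proof -
  have "\<alpha> = mi [r]" if "\<alpha> \<in> multiindices r 0" for \<alpha>
  proof
    fix i show "\<alpha> i = mi [r] i" using that by (cases i) (auto simp: multiindices_def)
  qed
  moreover have "mi [r] \<in> multiindices r 0" by (auto simp: multiindices_def mi_def)
  ultimately show ?thesis by blast
qed

lemma multiindices_1: "multiindices r (Suc 0) = {mi [a, b] | a b. a + b = r}"
proof -
  have "\<exists>a b. a + b = r \<and> \<alpha> = mi [a, b]" if "\<alpha> \<in> multiindices r (Suc 0)"
      for \<alpha>
  proof (intro exI conjI ext)
    show "\<alpha> 0 + \<alpha> 1 = r" using that by (auto simp: multiindices_def)
    fix i show "\<alpha> i = mi [\<alpha> 0, \<alpha> 1] i"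
      using that by (auto simp: multiindices_def mi_def nth_Cons split: nat.splits)
  qed
  moreover have "mi [a, b] \<in> multiindices (a + b) (Suc 0)" for a b by (auto simp: multiindices_def
      mi_def)
  ultimately show ?thesis by blast
qed

lemma multiindices_2: "multiindices r 2 = {mi [a, b, c] | a b c. a + b + c = r}"
proof -
  have "\<exists>a b c. a + b + c = r \<and> \<alpha> = mi [a, b, c]" if "\<alpha> \<in> multiindices r
      2" for \<alpha>
  proof (intro exI conjI ext)
    show "\<alpha> 0 + \<alpha> 1 + \<alpha> 2 = r" using that by (auto simp: multiindices_def
        numeral_2_eq_2)
    fix i show "\<alpha> i = mi [\<alpha> 0, \<alpha> 1, \<alpha> 2] i"
      using that by (auto simp: multiindices_def mi_def nth_Cons numeral_2_eq_2 split: nat.splits)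
  qed
  moreover have "mi [a, b, c] \<in> multiindices (a + b + c) 2" for a b c
    by (auto simp: multiindices_def mi_def numeral_2_eq_2)
  ultimately show ?thesis by blast
qed

lemma support_mi:
  "support (mi [a]) = (if a > 0 then {0} else {})"
  "support (mi [a, b]) = (if a > 0 then {0} else {}) \<union> (if b > 0 then {1} else {})"
  "support (mi [a, b, c]) = (if a > 0 then {0} else {}) \<union> (if b > 0 then {1} else {}) \<union>
      (if c > 0 then {2} else {})"
  by (auto simp: support_def mi_def less_Suc_eq numeral_2_eq_2 split: if_splits)

lemma Sig_0: "Sig 0 n = {[]}"
  by (auto simp: Sig_def)

lemma Sig_1: "Sig (Suc 0) n = (\<lambda>i. [i]) ` {..n}"
  by (auto simp: Sig_def length_Suc_conv)

lemma Sig0_0: "Sig0 0 n = (\<lambda>i. [i]) ` {..n}"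
  by (auto simp: Sig0_def length_Suc_conv)

lemma Sig0_1: "Sig0 (Suc 0) n = {[i, j] | i j. i < j \<and> j \<le> n}"
  by (auto simp: Sig0_def length_Suc_conv numeral_2_eq_2)

lemma atMost_2: "{..2::nat} = {0, 1, 2}"
  by auto

lemma compl_index_0: "compl_index 0 [] = [0]" "compl_index 0 [0] = []"
  by (simp_all add: compl_index_def)

lemma compl_index_1:
  "compl_index (Suc 0) [] = [0, 1]" "compl_index (Suc 0) [0] = [1]"
  "compl_index (Suc 0) [Suc 0] = [0]" "compl_index (Suc 0) [0, Suc 0] = []"
proof -
  have "{..Suc 0} = {0, 1}" "{..Suc 0} - {0} = {1}" "{..Suc 0} - {1} = {0}" by auto
  then show "compl_index (Suc 0) [] = [0, 1]" "compl_index (Suc 0) [0] = [1]"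
    "compl_index (Suc 0) [Suc 0] = [0]" "compl_index (Suc 0) [0, Suc 0] = []"
    by (simp_all add: compl_index_def)
qed

lemma compl_index_2:
  "compl_index 2 [0] = [1, 2]" "compl_index 2 [Suc 0] = [0, 2]" "compl_index 2 [2] = [0, 1]"
  "compl_index 2 [0, Suc 0] = [2]" "compl_index 2 [0, 2] = [1]" "compl_index 2 [Suc 0, 2] = [0]"
proof -
  have "{..2::nat} - {0} = {1, 2}" "{..2::nat} - {1} = {0, 2}" "{..2::nat} - {2} = {0, 1}"
    "{..2::nat} - {0, 1} = {2}" "{..2::nat} - {0, 2} = {1}" "{..2::nat} - {1, 2} = {0}" by auto
  then show "compl_index 2 [0] = [1, 2]" "compl_index 2 [Suc 0] = [0, 2]" "compl_index 2 [2] = [0, 1]"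
    "compl_index 2 [0, Suc 0] = [2]" "compl_index 2 [0, 2] = [1]" "compl_index 2 [Suc 0, 2] = [0]"
    by (simp_all add: compl_index_def)
qed

lemma incl_eq:
  assumes "distinct T" "j < length T" "F ! i = T ! j" shows "incl F T i = j"
  unfolding incl_def using assms by (intro the_equality) (auto simp: nth_eq_iff_index_eq)

lemma incl_self:
  assumes "ordered_simplex T" "i \<le> sdim T" shows "incl T T i = i"
  using assms by (intro incl_eq) (cases T; auto simp: ordered_simplex_def sdim_def)+

lemma incl_range_self: "ordered_simplex T \<Longrightarrow> incl_range T T = {..sdim T}"
  using incl_self unfolding incl_range_def by force

lemma lift_multi_incl:
  assumes "inj_on (incl F T) {..sdim F}" "i \<le> sdim F"
  shows "lift_multi F T \<alpha> (incl F T i) = \<alpha> i"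
  using assms by (simp add: lift_multi_def incl_range_def the_inv_into_f_f)

lemma lift_multi_outside: "j \<notin> incl_range F T \<Longrightarrow> lift_multi F T \<alpha> j = 0"
  by (simp add: lift_multi_def)

lemma lift_multi_self:
  assumes "ordered_simplex T" "\<alpha> \<in> multiindices r (sdim T)"
  shows "lift_multi T T \<alpha> = \<alpha>"
proof
  fix j
  have "inj_on (incl T T) {..sdim T}" using incl_self[OF assms(1)] by (auto intro!: inj_onI)
  then show "lift_multi T T \<alpha> j = \<alpha> j"
    using lift_multi_incl[of T T j \<alpha>] lift_multi_outside[of j T T \<alpha>] incl_self[OF assms(1)]
      incl_range_self[OF assms(1)] assms(2) by (cases "j \<le> sdim T") (auto simp: multiindices_def)
qed

lemma sum_dbary:
  assumes "ordered_simplex T" shows "(\<Sum>j\<le>sdim T. dbary T j) = 0"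
proof (intro ext)
  fix x vs
  have sum_apply: "(\<Sum>j\<in>A. f j) x vs = (\<Sum>j\<in>A. f j x vs)" for A and f :: "nat
      \<Rightarrow> 'a form"
    by (induction A rule: infinite_finite_induct) auto
  show "(\<Sum>j\<le>sdim T. dbary T j) x vs = 0 x vs"
  proof (cases "admissible T 1 x vs")
    case True
    then have "vs ! 0 \<in> tangent T" by (auto simp: admissible_def)
    then show ?thesis using sum_dlam[OF assms, of "vs ! 0"] True
      unfolding sum_apply differential_bary[OF assms] by (simp flip: of_real_sum)
  qed (simp add: sum_apply differential_bary[OF assms])
qed

text \<open>For F = T the correction in \<open>Psi\<close> is a multiple of the sum of all
  dlambda_j, which vanishes.\<close>

lemma Psi_self: "ordered_simplex T \<Longrightarrow> Psi T T \<alpha> = dbary T"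
  by (rule ext) (simp add: Psi_def incl_range_self sum_dbary)

abbreviation P0_index :: "'a list \<Rightarrow> nat \<Rightarrow> nat \<Rightarrow> ((nat \<Rightarrow>
    nat) \<times> nat list) set" where
  "P0_index T k r \<equiv>
    {(\<alpha>, \<sigma>). \<alpha> \<in> multiindices r (sdim T) \<and> \<sigma> \<in> Sig k (sdim T)
        \<and> support \<alpha> \<union> set \<sigma> = {..sdim T}}"

abbreviation Pm0_index :: "'a list \<Rightarrow> nat \<Rightarrow> nat \<Rightarrow> ((nat
    \<Rightarrow> nat) \<times> nat list) set" where
  "Pm0_index T k r \<equiv>
    {(\<alpha>, \<rho>). \<alpha> \<in> multiindices (r - 1) (sdim T) \<and> \<rho> \<in> Sig0 k (sdim
        T) \<and> support \<alpha> \<union> set \<rho> = {..sdim T}}"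

lemma map_incl_self:
  assumes "ordered_simplex T" "set \<sigma> \<subseteq> {..sdim T}" shows "map (incl T T) \<sigma> =
      \<sigma>"
  using incl_self[OF assms(1)] assms(2) by (intro map_idI) auto

text \<open>For F = T the prescribed values are the generators themselves, so the identity is a
  witness. The hypothesis restricts \<open>\<omega>\<close> to the span on which the choice is
  specified.\<close>

lemma ext_P_self:
  assumes "ordered_simplex T" "\<omega> \<in> form.span (P_form T ` P0_index T k r)"
  shows "ext_P T T k r \<omega> = \<omega>"
  unfolding ext_P_def Let_def
proof (rule linear_map_with_id[OF _ assms(2)], clarify)
  fix \<alpha> \<sigma> assume *: "\<alpha> \<in> multiindices r (sdim T)" "\<sigma> \<in> Sig k (sdim T)"
  then show "P_form T (\<alpha>, \<sigma>) = func_mult (monomial T (lift_multi T T \<alpha>))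
      (wedge T (map (Psi T T (lift_multi T T \<alpha>)) (map (incl T T) \<sigma>)))"
    by (simp add: P_form_def dbary_wedge_def Psi_self[OF assms(1)] lift_multi_self[OF assms(1)]
        map_incl_self[OF assms(1)] Sig_def)
qed

lemma ext_Pm_self:
  assumes "ordered_simplex T" "\<omega> \<in> form.span (Pm_form T ` Pm0_index T k r)"
  shows "ext_Pm T T k r \<omega> = \<omega>"
  unfolding ext_Pm_def Let_def
  by (rule linear_map_with_id[OF _ assms(2)])
    (auto simp: lift_multi_self[OF assms(1)] map_incl_self[OF assms(1)] Sig0_def)

section \<open>Vertices\<close>

lemma simplex_0_cases:
  assumes "ordered_simplex V" "sdim V = 0" obtains v where "V = [v]"
  using assms by (cases V) (auto simp: ordered_simplex_def sdim_def)

context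
  fixes V :: "'a::euclidean_space list"
  assumes V: "ordered_simplex V" and V0: "sdim V = 0"
begin

lemma bary_vertex: "x \<in> body V \<Longrightarrow> bary V 0 x = 1"
  using sum_bary[OF V] V0 by simp

lemma monomial_vertex: "x \<in> body V \<Longrightarrow> monomial V \<alpha> x = 1"
  by (simp add: monomial_def V0 bary_vertex)

lemma subsimplices_vertex: "subsimplices V = {V}"
proof -
  obtain v where "V = [v]" using simplex_0_cases[OF V V0] .
  then show ?thesis using set_subseqs_eq[of V] by (auto simp: subsimplices_def)
qed

lemma P_form_vertex: "P_form V (\<alpha>, []) = zero_form V (\<lambda>x. 1)"
  by (auto simp: P_form_def dbary_wedge_Nil zero_form_ops monomial_vertex intro!: zero_form_cong)

lemma Pm_form_vertex: "Pm_form V (\<alpha>, [0]) = zero_form V (\<lambda>x. 1)"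
  by (auto simp: Pm_form_def whitney_single zero_form_ops monomial_vertex bary_vertex intro!:
      zero_form_cong)

lemma iso_I_vertex: "iso_I V 0 r (zero_form V (\<lambda>x. 1)) = zero_form V (\<lambda>x. 1)"
  unfolding iso_I_def Let_def V0
proof (rule linear_map_with_id)
  show "zero_form V (\<lambda>x. 1) \<in> form.span (P_form V ` (multiindices r 0 \<times> Sig 0 0))"
    using P_form_vertex by (intro form.span_base) (force simp: multiindices_0 Sig_0)
qed (auto simp: Sig_0 P_form_vertex compl_index_0 sort_sign_sorted bary_prod_def whitney_single
    zero_form_ops monomial_vertex bary_vertex intro!: zero_form_cong)

lemma iso_J_vertex: "iso_J V 0 r (zero_form V (\<lambda>x. 1)) = zero_form V (\<lambda>x. 1)"
  unfolding iso_J_def Let_def V0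
proof (rule linear_map_with_id)
  show "zero_form V (\<lambda>x. 1) \<in> form.span (Pm_form V ` (multiindices r 0 \<times> Sig0 0 0))"
    using Pm_form_vertex by (intro form.span_base) (force simp: multiindices_0 Sig0_0)
qed (auto simp: Sig0_0 Pm_form_vertex compl_index_0 sort_sign_sorted bary_prod_def dbary_wedge_Nil
    zero_form_ops monomial_vertex bary_vertex intro!: zero_form_cong)

text \<open>Since lambda_0 = 1 on a vertex, every operator fixes the constant 1. The blocks
  \<open>I\<close>, \<open>M\<close>, \<open>J\<close> carry the claim from \<open>AP\<close> in
  degree r to the other three bases in degree r + 1, and \<open>A\<close> closes the circle by
  induction.\<close>

lemma vertex_bases:
  "AP B V 0 r = {zero_form V (\<lambda>x. 1)}"
  "APm0 B V 0 (Suc r) = {zero_form V (\<lambda>x. 1)}"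
  "APm B V 0 (Suc r) = {zero_form V (\<lambda>x. 1)}"
  "AP0 B V 0 (Suc r) = {zero_form V (\<lambda>x. 1)}"
proof -
  let ?one = "zero_form V (\<lambda>x. 1)"
  have I: "APm0 B V 0 (Suc r) = {?one}" if "AP B V 0 r = {?one}" for r
    using that by (subst APm0.simps) (simp add: V0 iso_I_vertex)
  have M: "APm B V 0 (Suc r) = {?one}" if "AP B V 0 r = {?one}" for r
  proof -
    have "?one \<in> form.span (Pm_form V ` Pm0_index V 0 (Suc r))"
      by (intro form.span_base image_eqI[where x = "(mi [r], [0])"])
        (auto simp: Pm_form_vertex multiindices_0 Sig0_0 V0 support_mi)
    then show ?thesis
      by (subst APm.simps) (simp add: V0 subsimplices_vertex I[OF that] ext_Pm_self[OF V])
  qed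
  have J: "AP0 B V 0 (Suc r) = {?one}" if "AP B V 0 r = {?one}" for r
    by (subst AP0.simps) (simp add: V0 M[OF that] iso_J_vertex)
  have A: "AP B V 0 r = {?one}" for r
  proof (induction r)
    case 0 show ?case by (subst AP.simps) (simp add: V0 constant_basis_def wedge_Nil)
  next
    case (Suc r)
    have "?one \<in> form.span (P_form V ` P0_index V 0 (Suc r))"
      by (intro form.span_base image_eqI[where x = "(mi [Suc r], [])"])
        (auto simp: P_form_vertex multiindices_0 Sig_0 V0 support_mi)
    then show ?case by (subst AP.simps) (simp add: V0 subsimplices_vertex J[OF Suc] ext_P_self[OF V])
  qed
  show "AP B V 0 r = {?one}" by (rule A)
  show "APm0 B V 0 (Suc r) = {?one}" by (rule I[OF A])
  show "APm B V 0 (Suc r) = {?one}" by (rule M[OF A])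
  show "AP0 B V 0 (Suc r) = {?one}" by (rule J[OF A])
qed

end

lemma
  assumes T: "ordered_simplex T" and j: "j \<le> sdim T"
  shows ext_P_vertex: "ext_P [T ! j] T 0 (Suc r) (zero_form [T ! j] (\<lambda>x. 1)) =
      zero_form T (\<lambda>x. of_real (bary T j x) ^ Suc r)"
    and ext_Pm_vertex: "ext_Pm [T ! j] T 0 (Suc r) (zero_form [T ! j] (\<lambda>x. 1)) =
      zero_form T (\<lambda>x. of_real (bary T j x) ^ Suc r)"
proof -
  let ?V = "[T ! j]" and ?h = "zero_form T (\<lambda>x. of_real (bary T j x) ^ Suc r)"
  have jl: "j < length T" using j T by (cases T) (auto simp: ordered_simplex_def sdim_def)
  have V: "ordered_simplex ?V" "sdim ?V = 0" by (auto simp: ordered_simplex_def sdim_def)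
  have incl: "incl ?V T 0 = j" using T jl by (intro incl_eq) (auto simp: ordered_simplex_def)
  have range: "incl_range ?V T = {j}" by (simp add: incl_range_def V incl)
  have lift: "lift_multi ?V T \<alpha> = (\<lambda>i. if i = j then \<alpha> 0 else 0)" for \<alpha>
    using lift_multi_incl[of ?V T 0 \<alpha>] lift_multi_outside[of _ ?V T \<alpha>]
    by (auto simp: range incl V fun_eq_iff)
  have mono: "monomial T (\<lambda>i. if i = j then a else 0) x = bary T j x ^ a" for a x
    using j by (simp add: monomial_def if_distrib[of "\<lambda>n. _ ^ n"] cong: if_cong)
  have one: "zero_form ?V (\<lambda>x. 1) (T ! j) [] = 1"
    using vertex_in_body[OF V(1), of 0] by (simp add: zero_form_def admissible_def)
  \<comment> \<open>Witness for both operators: a 0-form at a vertex is its value there, and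
    \<open>L\<close> multiplies the fixed image by this value.\<close>
  define L where "L \<omega> = form_scale (\<omega> (T ! j) []) ?h" for \<omega> :: "'a form"
  have L: "Vector_Spaces.linear form_scale form_scale L"
    by (rule form_linearI) (auto simp: L_def form_scale_def fun_eq_iff algebra_simps)
  have L1: "L (zero_form ?V (\<lambda>x. 1)) = ?h" by (simp add: L_def one)
  show "ext_P ?V T 0 (Suc r) (zero_form ?V (\<lambda>x. 1)) = ?h"
    unfolding ext_P_def L1[symmetric] V(2) Let_def[of 0]
  proof (rule linear_map_with_eq[OF L])
    show "zero_form ?V (\<lambda>x. 1) \<in> form.span (P_form ?V ` {(\<alpha>, \<sigma>). \<alpha>
        \<in> multiindices (Suc r) 0 \<and> \<sigma> \<in> Sig 0 0 \<and> support \<alpha> \<union> set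
            \<sigma> = {..0}})"
      by (intro form.span_base image_eqI[where x = "(mi [Suc r], [])"])
        (auto simp: P_form_vertex[OF V] multiindices_0 Sig_0 support_mi)
  next
    fix i assume "i \<in> {(\<alpha>, \<sigma>). \<alpha> \<in> multiindices (Suc r) 0 \<and> \<sigma>
        \<in> Sig 0 0 \<and> support \<alpha> \<union> set \<sigma> = {..0}}"
    then have i: "i = (mi [Suc r], [])" by (auto simp: multiindices_0 Sig_0)
    have "func_mult (monomial T (lift_multi ?V T (mi [Suc r]))) (wedge T []) = ?h"
      by (simp add: lift mono wedge_Nil zero_form_ops)
    then show "L (P_form ?V i) = (case i of (\<alpha>, \<sigma>) \<Rightarrow> let \<alpha>' =
        lift_multi ?V T \<alpha>; \<sigma>' = map (incl ?V T) \<sigma>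
        in func_mult (monomial T \<alpha>') (wedge T (map (Psi ?V T \<alpha>') \<sigma>')))"
      by (simp add: i P_form_vertex[OF V] L1)
  qed
  show "ext_Pm ?V T 0 (Suc r) (zero_form ?V (\<lambda>x. 1)) = ?h"
    unfolding ext_Pm_def Let_def V(2) L1[symmetric]
  proof (rule linear_map_with_eq[OF L])
    show "zero_form ?V (\<lambda>x. 1) \<in> form.span (Pm_form ?V ` {(\<alpha>, \<rho>). \<alpha>
        \<in> multiindices (Suc r - 1) 0 \<and> \<rho> \<in> Sig0 0 0 \<and> support \<alpha> \<union>
            set \<rho> = {..0}})"
      by (intro form.span_base image_eqI[where x = "(mi [r], [0])"])
        (auto simp: Pm_form_vertex[OF V] multiindices_0 Sig0_0 support_mi)
  next
    fix i assume "i \<in> {(\<alpha>, \<rho>). \<alpha> \<in> multiindices (Suc r - 1) 0 \<and> \<rho>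
        \<in> Sig0 0 0 \<and> support \<alpha> \<union> set \<rho> = {..0}}"
    then have i: "i = (mi [r], [0])" by (auto simp: multiindices_0 Sig0_0)
    have "Pm_form T (lift_multi ?V T (mi [r]), [j]) = ?h"
      by (simp add: Pm_form_def lift mono whitney_single zero_form_ops mult.commute)
    then show "L (Pm_form ?V i) = (case i of (\<alpha>, \<rho>) \<Rightarrow> Pm_form T (lift_multi ?V
        T \<alpha>, map (incl ?V T) \<rho>))"
      by (simp add: i Pm_form_vertex[OF V] L1 incl)
  qed
qed

section \<open>Edges\<close>

lemma single_vertex: "ordered_simplex [v]" "sdim [v] = 0"
  by (simp_all add: ordered_simplex_def sdim_def)

lemma mi_in_multiindices:
  "mi [a, b] \<in> multiindices r (Suc 0) \<longleftrightarrow> a + b = r"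
  "mi [a, b, c] \<in> multiindices r 2 \<longleftrightarrow> a + b + c = r"
  by (auto simp: multiindices_def mi_def numeral_2_eq_2)

lemma form_scale_apply: "form_scale c \<omega> x vs = c * \<omega> x vs"
  by (simp add: form_scale_def)

lemma func_mult_minus: "func_mult f (- \<omega>) = - func_mult f \<omega>"
  by (simp add: func_mult_def fun_eq_iff)

lemma func_mult_1: "func_mult (\<lambda>_. 1) \<omega> = \<omega>"
  by (simp add: func_mult_def)

lemma iso_I_eq:
  assumes "Vector_Spaces.linear form_scale form_scale L"
    and "\<And>\<alpha> \<sigma>. \<alpha> \<in> multiindices r (sdim T) \<Longrightarrow> \<sigma>
        \<in> Sig k (sdim T) \<Longrightarrow>
      L (P_form T (\<alpha>, \<sigma>)) = form_scale (eps \<sigma> (compl_index (sdim T) \<sigma>))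
          (func_mult (monomial T \<alpha>) (func_mult (bary_prod T \<sigma>) (whitney T (compl_index
              (sdim T) \<sigma>))))"
    and "\<omega> \<in> form.span (P_form T ` (multiindices r (sdim T) \<times> Sig k (sdim T)))"
  shows "iso_I T k r \<omega> = L \<omega>"
  unfolding iso_I_def Let_def by (rule linear_map_with_eq[OF assms(1) _ assms(3)]) (use assms(2) in auto)

lemma iso_J_eq:
  assumes "Vector_Spaces.linear form_scale form_scale L"
    and "\<And>\<alpha> \<rho>. \<alpha> \<in> multiindices r (sdim T) \<Longrightarrow> \<rho> \<in>
        Sig0 k (sdim T) \<Longrightarrow>
      L (Pm_form T (\<alpha>, \<rho>)) = form_scale (eps (compl_index (sdim T) \<rho>) \<rho>)
          (func_mult (monomial T \<alpha>) (func_mult (bary_prod T \<rho>) (dbary_wedge T (compl_index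
              (sdim T) \<rho>))))"
    and "\<omega> \<in> form.span (Pm_form T ` (multiindices r (sdim T) \<times> Sig0 k (sdim T)))"
  shows "iso_J T k r \<omega> = L \<omega>"
  unfolding iso_J_def Let_def by (rule linear_map_with_eq[OF assms(1) _ assms(3)]) (use assms(2) in auto)

text \<open>The coefficients of a 1-form are determined only up to a common summand, because the
  differentials of the barycentric coordinates sum to \<open>0\<close>.\<close>

lemma one_form_cong:
  assumes "ordered_simplex T" "\<And>x. x \<in> body T \<Longrightarrow> \<exists>k.
      \<forall>i\<le>sdim T. c i x = d i x + k"
  shows "one_form T c = one_form T d"
proof (intro ext)
  fix x vs
  show "one_form T c x vs = one_form T d x vs"
  proof (cases "admissible T 1 x vs")
    case True
    then have x: "x \<in> body T" and v: "vs ! 0 \<in> tangent T" by (auto simp: admissible_def)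
    obtain k where k: "\<And>i. i \<le> sdim T \<Longrightarrow> c i x = d i x + k" using assms(2)[OF
        x] by blast
    have "(\<Sum>i\<le>sdim T. k * of_real (dlam T i (vs ! 0))) = 0"
      using sum_dlam[OF assms(1) v] by (simp flip: sum_distrib_left of_real_sum)
    then show ?thesis using True k by (simp add: one_form_def distrib_right sum.distrib)
  qed (simp add: one_form_def)
qed

lemma dlam_edge:
  assumes "ordered_simplex T" "i \<le> sdim T" "j \<le> sdim T"
  shows "dlam T k (T ! i - T ! j) = (if i = k then 1 else 0) - (if j = k then 1 else 0)"
  using assms by (simp add: dlam_diff bary_spec(2))

text \<open>Edge vectors read off differences of coefficients. These are all that the form remembers
  of \<open>c\<close>, which is why the operators below are expressed through such values.\<close>

lemma one_form_edge:
  assumes "ordered_simplex T" "i \<le> sdim T" "j \<le> sdim T" "x \<in> body T"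
  shows "one_form T c x [T ! i - T ! j] = c i x - c j x"
proof -
  have "admissible T 1 x [T ! i - T ! j]"
    using assms edge_in_tangent by (simp add: admissible_def)
  then show ?thesis using assms
    by (simp add: one_form_def dlam_edge of_real_diff right_diff_distrib sum_subtractf
        if_distrib[of of_real] if_distrib[of "\<lambda>c. _ * c"] cong: if_cong)
qed

definition edge_fun :: "'a::euclidean_space list \<Rightarrow> nat \<Rightarrow> nat \<Rightarrow> 'a
    form" where
  "edge_fun E a b = zero_form E (\<lambda>x. of_real (bary E 0 x ^ a * bary E 1 x ^ b))"

definition edge_form :: "'a::euclidean_space list \<Rightarrow> nat \<Rightarrow> nat \<Rightarrow> 'a
    form" where
  "edge_form E a b = one_form E (\<lambda>j x. if j = 1 then of_real (bary E 0 x ^ a * bary E 1 x ^ b)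
      else 0)"

text \<open>The sign that the recursion attaches to \<open>\<lambda>\<^sub>0\<^sup>a
  \<lambda>\<^sub>1\<^sup>b d\<lambda>\<^sub>1\<close>.\<close>

definition edge_sign :: "nat \<Rightarrow> nat \<Rightarrow> complex" where
  "edge_sign a b = (if a = b then 1 else - 1)"

lemma subsimplices_edge:
  assumes "ordered_simplex E" "sdim E = Suc 0"
  shows "subsimplices E = {[E ! 0], [E ! 1], E}"
proof -
  obtain a b where "E = [a, b]"
    using assms by (cases E; cases "tl E") (auto simp: ordered_simplex_def sdim_def)
  then show ?thesis using set_subseqs_eq[of E] by (auto simp: subsimplices_def)
qed

context
  fixes E :: "'a::euclidean_space list"
  assumes E: "ordered_simplex E" and E1: "sdim E = Suc 0"
begin

lemma edge_evals:
  assumes "x \<in> body E"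
  shows "edge_fun E a b x [] = of_real (bary E 0 x ^ a * bary E 1 x ^ b)"
    "edge_form E a b x [E ! 1 - E ! 0] = of_real (bary E 0 x ^ a * bary E 1 x ^ b)"
  using assms by (auto simp: edge_fun_def edge_form_def zero_form_def admissible_def one_form_edge E E1)

lemma monomial_edge: "monomial E (mi [a, b]) x = bary E 0 x ^ a * bary E 1 x ^ b"
  by (simp add: monomial_def E1)

text \<open>On an edge dlambda_0 = - dlambda_1, so all 1-forms are written with dlambda_1.\<close>

lemma P_form_edge:
  "P_form E (mi [a, b], []) = edge_fun E a b"
  "P_form E (mi [a, b], [Suc 0]) = edge_form E a b"
  "P_form E (mi [a, b], [0]) = - (edge_form E a b)"
proof -
  show "P_form E (mi [a, b], []) = edge_fun E a b"
    by (auto simp: P_form_def edge_fun_def monomial_edge dbary_wedge_Nil zero_form_ops)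
  show "P_form E (mi [a, b], [Suc 0]) = edge_form E a b"
    by (auto simp: P_form_def edge_form_def monomial_edge dbary_wedge_single E E1 one_form_ops intro!:
        one_form_cong)
  show "P_form E (mi [a, b], [0]) = - (edge_form E a b)"
    by (auto simp: P_form_def edge_form_def monomial_edge dbary_wedge_single E E1 one_form_ops le_Suc_eq
        intro!: one_form_cong exI[of _ "of_real (bary E 0 _ ^ a * bary E 1 _ ^ b)"])
qed

lemma bary_edge_sum: "x \<in> body E \<Longrightarrow> bary E 0 x + bary E (Suc 0) x = 1"
  using sum_bary[OF E, of x] by (simp add: E1)

text \<open>Since lambda_0 + lambda_1 = 1, the form lambda_0 dlambda_1 - lambda_1 dlambda_0 equals
  dlambda_1.\<close>

lemma whitney_edge: "whitney E [0, Suc 0] = edge_form E 0 0"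
proof -
  have "whitney E [0, Suc 0] = one_form E (\<lambda>k x.
    of_real (bary E 0 x) * (if k = Suc 0 then 1 else 0) - of_real (bary E (Suc 0) x) * (if k = 0 then 1
        else 0))"
    using E E1 by (intro whitney_pair) auto
  also have "\<dots> = edge_form E 0 0"
    unfolding edge_form_def
  proof (intro one_form_cong[OF E] exI allI impI)
    fix x i assume x: "x \<in> body E" and "i \<le> sdim E"
    have "complex_of_real (bary E 0 x) + of_real (bary E (Suc 0) x) = 1"
      using bary_edge_sum[OF x] by (metis of_real_1 of_real_add)
    then show "of_real (bary E 0 x) * (if i = Suc 0 then 1 else 0) - of_real (bary E (Suc 0) x) * (if i
        = 0 then 1 else 0)
        = (if i = 1 then complex_of_real (bary E 0 x ^ 0 * bary E 1 x ^ 0) else 0) + (- of_real (bary E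
            (Suc 0) x))"
      using \<open>i \<le> sdim E\<close> by (auto simp: E1 le_Suc_eq algebra_simps)
  qed
  finally show ?thesis .
qed

lemma edge_form_mult: "func_mult (monomial E (mi [a, b])) (edge_form E c d) = edge_form E (a + c) (b + d)"
  by (auto simp: edge_form_def one_form_ops monomial_edge power_add intro!: one_form_cong[OF E])

lemma Pm_form_edge:
  "Pm_form E (mi [a, b], [0]) = edge_fun E (Suc a) b"
  "Pm_form E (mi [a, b], [Suc 0]) = edge_fun E a (Suc b)"
  "Pm_form E (mi [a, b], [0, Suc 0]) = edge_form E a b"
proof -
  show "Pm_form E (mi [a, b], [0]) = edge_fun E (Suc a) b" "Pm_form E (mi [a, b], [Suc 0]) = edge_fun E
      a (Suc b)"
    by (auto simp: Pm_form_def edge_fun_def monomial_edge whitney_single zero_form_ops ac_simps)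
  show "Pm_form E (mi [a, b], [0, Suc 0]) = edge_form E a b"
    by (simp add: Pm_form_def whitney_edge edge_form_mult)
qed

lemma edge_fun_mult:
  "func_mult (monomial E (mi [a, b])) (edge_fun E c d) = edge_fun E (a + c) (b + d)"
  by (auto simp: edge_fun_def zero_form_ops monomial_edge power_add ac_simps intro!: zero_form_cong)

lemma bary_prod_edge:
  "func_mult (bary_prod E []) \<omega> = \<omega>"
  "func_mult (bary_prod E [0]) (edge_form E a b) = edge_form E (Suc a) b"
  "func_mult (bary_prod E [Suc 0]) (edge_form E a b) = edge_form E a (Suc b)"
  "func_mult (bary_prod E [0]) (edge_fun E a b) = edge_fun E (Suc a) b"
  "func_mult (bary_prod E [Suc 0]) (edge_fun E a b) = edge_fun E a (Suc b)"
  "func_mult (bary_prod E [0, Suc 0]) (edge_fun E a b) = edge_fun E (Suc a) (Suc b)"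
  by (auto simp: edge_form_def edge_fun_def one_form_ops zero_form_ops bary_prod_def[abs_def] func_mult_1
      ac_simps intro!: one_form_cong[OF E] zero_form_cong)

lemma dbary_wedge_edge:
  "dbary_wedge E [] = edge_fun E 0 0"
  "dbary_wedge E [Suc 0] = edge_form E 0 0"
  "dbary_wedge E [0] = - (edge_form E 0 0)"
proof -
  have m: "func_mult (monomial E (mi [0, 0])) \<omega> = \<omega>" for \<omega> :: "'a form"
    by (simp add: func_mult_def monomial_edge fun_eq_iff)
  show "dbary_wedge E [] = edge_fun E 0 0" "dbary_wedge E [Suc 0] = edge_form E 0 0"
    "dbary_wedge E [0] = - (edge_form E 0 0)"
    using P_form_edge[of 0 0] by (simp_all add: P_form_def m)
qed

lemma whitney_edge_single: "whitney E [0] = edge_fun E (Suc 0) 0" "whitney E [Suc 0] = edge_fun E 0 (Suc 0)"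
  by (simp_all add: whitney_single edge_fun_def)

lemma edge_form_in_span: "edge_form E a b \<in> form.span (P_form E ` (multiindices (a + b) (Suc 0)
    \<times> Sig (Suc 0) (Suc 0)))"
  by (intro form.span_base image_eqI[where x = "(mi [a, b], [Suc 0])"])
    (auto simp: P_form_edge multiindices_1 Sig_1)

lemma edge_fun_in_span: "edge_fun E a b \<in> form.span (P_form E ` (multiindices (a + b) (Suc 0)
    \<times> Sig 0 (Suc 0)))"
  by (intro form.span_base image_eqI[where x = "(mi [a, b], [])"])
    (auto simp: P_form_edge multiindices_1 Sig_0)

lemma edge_form_in_span_Pm:
  "edge_form E a b \<in> form.span (Pm_form E ` (multiindices (a + b) (Suc 0) \<times> Sig0 (Suc 0)
      (Suc 0)))"
  by (intro form.span_base image_eqI[where x = "(mi [a, b], [0, Suc 0])"])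
    (auto simp: Pm_form_edge multiindices_1 Sig0_1)

text \<open>One factor of the monomial is absorbed by a Whitney 0-form lambda_i; for a = 0 it must
  be lambda_1.\<close>

lemma edge_fun_in_span_Pm:
  assumes "a + b = Suc r"
  shows "edge_fun E a b \<in> form.span (Pm_form E ` (multiindices r (Suc 0) \<times> Sig0 0 (Suc 0)))"
proof (cases a)
  case 0
  then show ?thesis using assms
    by (intro form.span_base image_eqI[where x = "(mi [0, r], [Suc 0])"])
      (auto simp: Pm_form_edge mi_in_multiindices Sig0_0)
next
  case (Suc c)
  then show ?thesis using assms
    by (intro form.span_base image_eqI[where x = "(mi [c, b], [0])"])
      (auto simp: Pm_form_edge multiindices_1 Sig0_0)
qed

text \<open>On an edge the isomorphisms are pointwise: \<open>iso_I\<close> sends f to f dlambda_1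
  and f dlambda_1 to - lambda_0 lambda_1 f, while \<open>iso_J\<close> sends f to - f dlambda_1 and
  f dlambda_1 to lambda_0 lambda_1 f. This and the next three lemmas verify it on monomials.\<close>

lemma iso_I_edge_0: "a + b = r \<Longrightarrow> iso_I E 0 r (edge_fun E a b) = edge_form E a b"
proof -
  assume r: "a + b = r"
  define L where "L \<omega> = one_form E (\<lambda>j x. if j = 1 then \<omega> x [] else 0)" for
      \<omega> :: "'a form"
  have L: "Vector_Spaces.linear form_scale form_scale L"
    by (rule form_linearI)
      (auto simp: L_def one_form_ops form_scale_apply intro!: one_form_cong[OF E] exI[of _ 0])
  have L_fun: "L (edge_fun E c d) = edge_form E c d" for c d
    unfolding L_def edge_form_def by (rule one_form_cong[OF E]) (auto simp: edge_evals intro!: exI[of _ 0])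
  have "iso_I E 0 r (edge_fun E a b) = L (edge_fun E a b)"
  proof (rule iso_I_eq[OF L])
    show "edge_fun E a b \<in> form.span (P_form E ` (multiindices r (sdim E) \<times> Sig 0 (sdim E)))"
      using edge_fun_in_span r E1 by metis
  qed (auto simp: E1 multiindices_1 Sig_0 P_form_edge L_fun compl_index_1 sort_sign_values
      bary_prod_edge whitney_edge edge_form_mult)
  then show ?thesis by (simp add: L_fun)
qed

text \<open>A scalar is carried along because the recursion feeds in multiples by
  \<open>edge_sign\<close>.\<close>

lemma iso_I_edge_1: "a + b = r \<Longrightarrow> iso_I E (Suc 0) r (form_scale c (edge_form E a b)) =
    form_scale c (- edge_fun E (Suc a) (Suc b))"
proof -
  assume r: "a + b = r"
  \<comment> \<open>The vector v_1 - v_0 has dlambda_1 = 1, so evaluation on it extracts the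
    coefficient of dlambda_1.\<close>
  define L where "L \<omega> = zero_form E (\<lambda>x. - (of_real (bary E 0 x * bary E 1 x) * \<omega>
      x [E ! 1 - E ! 0]))"
    for \<omega> :: "'a form"
  have L: "Vector_Spaces.linear form_scale form_scale L"
    by (rule form_linearI)
      (auto simp: L_def zero_form_ops form_scale_apply zero_form_def fun_eq_iff algebra_simps)
  have L_form: "L (edge_form E c d) = - (edge_fun E (Suc c) (Suc d))" for c d
    unfolding L_def edge_fun_def zero_form_ops
    by (rule zero_form_cong) (simp add: edge_evals[unfolded One_nat_def] ac_simps)
  have "iso_I E (Suc 0) r (form_scale c (edge_form E a b)) = L (form_scale c (edge_form E a b))"
  proof (rule iso_I_eq[OF L])
    show "form_scale c (edge_form E a b) \<in> form.span (P_form E ` (multiindices r (sdim E) \<times>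
        Sig (Suc 0) (sdim E)))"
      using form.span_scale edge_form_in_span r E1 by metis
  qed (auto simp: E1 multiindices_1 Sig_1 le_Suc_eq P_form_edge L_form compl_index_1 sort_sign_values
      form_pair.linear_neg[OF L] bary_prod_edge whitney_edge_single edge_fun_mult func_mult_minus)
  then show ?thesis by (simp add: L_form form_pair.linear_scale[OF L])
qed

lemma iso_J_edge_0: "a + b = Suc r \<Longrightarrow> iso_J E 0 r (form_scale c (edge_fun E a b)) =
    form_scale c (- edge_form E a b)"
proof -
  assume r: "a + b = Suc r"
  define L where "L \<omega> = one_form E (\<lambda>j x. if j = 1 then - \<omega> x [] else 0)" for
      \<omega> :: "'a form"
  have L: "Vector_Spaces.linear form_scale form_scale L"
    by (rule form_linearI)
      (auto simp: L_def one_form_ops form_scale_apply intro!: one_form_cong[OF E] exI[of _ 0])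
  have L_fun: "L (edge_fun E c d) = - (edge_form E c d)" for c d
    unfolding L_def edge_form_def one_form_ops
    by (rule one_form_cong[OF E]) (auto simp: edge_evals intro!: exI[of _ 0])
  have "iso_J E 0 r (form_scale c (edge_fun E a b)) = L (form_scale c (edge_fun E a b))"
  proof (rule iso_J_eq[OF L])
    show "form_scale c (edge_fun E a b) \<in> form.span (Pm_form E ` (multiindices r (sdim E) \<times>
        Sig0 0 (sdim E)))"
      using form.span_scale edge_fun_in_span_Pm[OF r] E1 by metis
  qed (auto simp: E1 multiindices_1 Sig0_0 le_Suc_eq Pm_form_edge L_fun compl_index_1 sort_sign_values
      bary_prod_edge dbary_wedge_edge edge_form_mult func_mult_minus)
  then show ?thesis by (simp add: L_fun form_pair.linear_scale[OF L])
qed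

lemma iso_J_edge_1: "a + b = r \<Longrightarrow> iso_J E (Suc 0) r (edge_form E a b) = edge_fun E (Suc
    a) (Suc b)"
proof -
  assume r: "a + b = r"
  define L where "L \<omega> = zero_form E (\<lambda>x. of_real (bary E 0 x * bary E 1 x) * \<omega> x
      [E ! 1 - E ! 0])"
    for \<omega> :: "'a form"
  have L: "Vector_Spaces.linear form_scale form_scale L"
    by (rule form_linearI)
      (auto simp: L_def zero_form_ops form_scale_apply zero_form_def fun_eq_iff algebra_simps)
  have L_form: "L (edge_form E c d) = edge_fun E (Suc c) (Suc d)" for c d
    unfolding L_def edge_fun_def zero_form_ops
    by (rule zero_form_cong) (simp add: edge_evals[unfolded One_nat_def] ac_simps)
  have "iso_J E (Suc 0) r (edge_form E a b) = L (edge_form E a b)"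
  proof (rule iso_J_eq[OF L])
    show "edge_form E a b \<in> form.span (Pm_form E ` (multiindices r (sdim E) \<times> Sig0 (Suc 0)
        (sdim E)))"
      using edge_form_in_span_Pm r E1 by metis
  qed (auto simp: E1 multiindices_1 Sig0_1 le_Suc_eq Pm_form_edge L_form compl_index_1 sort_sign_values
      bary_prod_edge dbary_wedge_edge edge_fun_mult)
  then show ?thesis by (simp add: L_form)
qed

end

lemma AP0_vertex_empty:
  assumes "sdim V = 0"
  shows "AP0 B V (Suc k) r = {}" "APm0 B V (Suc k) r = {}"
  using assms by (auto simp: AP0.simps[of B V] APm0.simps[of B V])

lemma image_sum_set:
  assumes "\<And>a b. a + b = r \<Longrightarrow> f (g a b) = h a b"
  shows "f ` {g a b | a b. a + b = r} = {h a b | a b. a + b = (r::nat)}" (is "?L = ?R")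
proof
  show "?L \<subseteq> ?R" using assms by blast
  show "?R \<subseteq> ?L"
  proof
    fix y assume "y \<in> ?R"
    then obtain a b where "y = h a b" "a + b = r" by blast
    then have "y = f (g a b)" "a + b = r" using assms by auto
    then show "y \<in> ?L" by blast
  qed
qed

text \<open>Used to split monomials by support: the two pure powers come from the vertices, the
  multiples of lambda_0 lambda_1 from the edge itself.\<close>

lemma sum_Suc_Suc_cases:
  "{f a b | a b. a + b = Suc (Suc q)} = {f (Suc (Suc q)) 0, f 0 (Suc (Suc q))} \<union> {f (Suc a) (Suc
      b) | a b. a + b = q}"
proof (intro equalityI subsetI)
  fix y assume "y \<in> {f a b | a b. a + b = Suc (Suc q)}"
  then obtain a b where y: "y = f a b" "a + b = Suc (Suc q)" by blast
  then show "y \<in> {f (Suc (Suc q)) 0, f 0 (Suc (Suc q))} \<union> {f (Suc a) (Suc b) | a b. a + b = q}"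
    by (cases a; cases b) auto
qed force+

lemma sum_Suc_0_cases: "{f a b | a b. a + b = Suc 0} = {f (Suc 0) 0, f 0 (Suc 0)}"
  by (auto simp: add_is_1)

context
  fixes E :: "'a::euclidean_space list"
  assumes E: "ordered_simplex E" and E1: "sdim E = Suc 0"
begin

lemma ext_vertices_edge:
  "ext_P [E ! 0] E 0 (Suc r) (zero_form [E ! 0] (\<lambda>x. 1)) = edge_fun E (Suc r) 0"
  "ext_P [E ! Suc 0] E 0 (Suc r) (zero_form [E ! Suc 0] (\<lambda>x. 1)) = edge_fun E 0 (Suc r)"
  "ext_Pm [E ! 0] E 0 (Suc r) (zero_form [E ! 0] (\<lambda>x. 1)) = edge_fun E (Suc r) 0"
  "ext_Pm [E ! Suc 0] E 0 (Suc r) (zero_form [E ! Suc 0] (\<lambda>x. 1)) = edge_fun E 0 (Suc r)"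
  using ext_P_vertex[OF E, of 0 r] ext_P_vertex[OF E, of "Suc 0" r]
    ext_Pm_vertex[OF E, of 0 r] ext_Pm_vertex[OF E, of "Suc 0" r]
  by (simp_all add: E1 edge_fun_def)

lemma APm0_edge:
  assumes "AP B E 0 q = {edge_fun E a b | a b. a + b = q}"
  shows "APm0 B E (Suc 0) (Suc q) = {edge_form E a b | a b. a + b = q}"
proof -
  have "APm0 B E (Suc 0) (Suc q) = iso_I E 0 q ` AP B E 0 q"
    by (subst APm0.simps) (simp add: E1)
  then show ?thesis unfolding assms using image_sum_set[where f = "iso_I E 0 q" and g = "edge_fun E"
      and h = "edge_form E"] iso_I_edge_0[OF E E1] by simp
qed

lemma APm_edge:
  assumes "AP B E 0 q = {edge_fun E a b | a b. a + b = q}"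
  shows "APm B E (Suc 0) (Suc q) = {edge_form E a b | a b. a + b = q}"
proof -
  have "ext_Pm E E (Suc 0) (Suc q) (edge_form E a b) = edge_form E a b" if "a + b = q" for a b
    by (rule ext_Pm_self[OF E], rule form.span_base, rule image_eqI[where x = "(mi [a, b], [0, Suc 0])"])
      (use that in \<open>auto simp: Pm_form_edge[OF E E1] E1 mi_in_multiindices Sig0_1 support_mi\<close>)
  then have "ext_Pm E E (Suc 0) (Suc q) ` APm0 B E (Suc 0) (Suc q) = {edge_form E a b | a b. a + b = q}"
    unfolding APm0_edge[OF assms] by (rule image_sum_set[where f = "ext_Pm E E (Suc 0) (Suc q)" and g =
        "edge_form E" and h = "edge_form E"])
  then show ?thesis
    by (subst APm.simps) (simp add: E1 subsimplices_edge[OF E E1] AP0_vertex_empty single_vertex)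
qed

text \<open>No signs occur: the step by two degrees composes \<open>iso_J\<close> with
  \<open>iso_I\<close>, which here is multiplication by + lambda_0 lambda_1.\<close>

lemma AP_edge_0: "AP B E 0 r = {edge_fun E a b | a b. a + b = r}"
proof (induction r rule: less_induct)
  case (less r)
  show ?case
  proof (cases r)
    case 0
    then show ?thesis
      by (subst AP.simps) (simp add: E1 constant_basis_def wedge_Nil edge_fun_def)
  next
    case (Suc q)
    have AP: "AP B E 0 r = {edge_fun E r 0, edge_fun E 0 r} \<union> ext_P E E 0 r ` AP0 B E 0 r"
      using Suc by (subst AP.simps)
        (simp add: E1 subsimplices_edge[OF E E1] vertex_bases single_vertex ext_vertices_edge
            insert_commute)
    show ?thesis
    proof (cases q)
      case 0
      have "AP0 B E 0 r = {}" by (subst AP0.simps) (simp add: E1 Suc 0)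
      then show ?thesis using AP Suc 0 sum_Suc_0_cases[of "edge_fun E"] by simp
    next
      case (Suc p)
      have r: "r = Suc (Suc p)" using Suc \<open>r = Suc q\<close> by simp
      have "AP0 B E 0 r = iso_J E (Suc 0) p ` APm B E (Suc 0) (Suc p)"
        by (subst AP0.simps) (simp add: E1 r)
      also have "\<dots> = {edge_fun E (Suc a) (Suc b) | a b. a + b = p}"
        unfolding APm_edge[OF less.IH[of p, unfolded r, simplified]]
        by (rule image_sum_set[where f = "iso_J E (Suc 0) p" and g = "edge_form E" and h = "\<lambda>a
            b. edge_fun E (Suc a) (Suc b)"]) (rule iso_J_edge_1[OF E E1])
      finally have A: "AP0 B E 0 r = {edge_fun E (Suc a) (Suc b) | a b. a + b = p}" .
      have "ext_P E E 0 r (edge_fun E (Suc a) (Suc b)) = edge_fun E (Suc a) (Suc b)" if "a + b = p" for a b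
        by (rule ext_P_self[OF E], rule form.span_base, rule image_eqI[where x = "(mi [Suc a, Suc b], [])"])
          (use that in \<open>auto simp: P_form_edge[OF E E1] E1 mi_in_multiindices Sig_0 support_mi
              r\<close>)
      then have "ext_P E E 0 r ` AP0 B E 0 r = {edge_fun E (Suc a) (Suc b) | a b. a + b = p}"
        unfolding A by (rule image_sum_set[where f = "ext_P E E 0 r" and g = "\<lambda>a b. edge_fun E
            (Suc a) (Suc b)" and h = "\<lambda>a b. edge_fun E (Suc a) (Suc b)"])
      then show ?thesis using AP sum_Suc_Suc_cases[of "edge_fun E" p] r by simp
    qed
  qed
qed

lemma APm0_edge_1: "APm0 B E (Suc 0) (Suc q) = {edge_form E a b | a b. a + b = q}"
  by (rule APm0_edge[OF AP_edge_0])

text \<open>The sign is constant along each diagonal of fixed a - b: two isomorphisms, each with a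
  minus sign, raise both exponents by one. The diagonal a = b starts at \<open>vol E\<close> with +;
  every other one starts at a pure power coming from a vertex, which meets only the minus sign of
  \<open>iso_J\<close>.\<close>

lemma AP_edge_1:
  "AP B E (Suc 0) r = {form_scale (edge_sign a b) (edge_form E a b) | a b. a + b = r}" (is "_ = ?R r")
  "AP0 B E (Suc 0) r = {form_scale (edge_sign a b) (edge_form E a b) | a b. a + b = r}"
proof -
  define m where "m a b = form_scale (- edge_sign a b) (edge_fun E a b)" for a b
  have APm: "APm B E 0 r = {m a b | a b. a + b = r}"
    if r: "r > 0" and IH: "\<And>q. r = Suc (Suc q) \<Longrightarrow> AP B E (Suc 0) q = ?R q" for r
  proof -
    obtain q where q: "r = Suc q" using r by (cases r) auto
    \<comment> \<open>As r > 0, the exponents of a pure power differ, so \<open>m\<close> has sign +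
      there and matches the extension from a vertex.\<close>
    have m0: "m r 0 = edge_fun E r 0" "m 0 r = edge_fun E 0 r"
      by (simp_all add: m_def edge_sign_def q)
    have U: "APm B E 0 r = {m r 0, m 0 r} \<union> ext_Pm E E 0 r ` APm0 B E 0 r"
      using q by (subst APm.simps)
        (simp add: E1 subsimplices_edge[OF E E1] vertex_bases single_vertex ext_vertices_edge
            insert_commute m0[unfolded q])
    show ?thesis
    proof (cases q)
      case 0
      have "APm0 B E 0 r = {}" by (subst APm0.simps) (simp add: E1 q 0)
      then show ?thesis using U q 0 sum_Suc_0_cases[of m] by simp
    next
      case (Suc p)
      have r': "r = Suc (Suc p)" using Suc q by simp
      have m': "iso_I E (Suc 0) p (form_scale (edge_sign a b) (edge_form E a b)) = m (Suc a) (Suc b)"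
        if "a + b = p" for a b
using iso_I_edge_1[OF E E1 that]
        by (simp add: m_def edge_sign_def)
      have "APm0 B E 0 r = iso_I E (Suc 0) p ` AP B E (Suc 0) p"
        by (subst APm0.simps) (simp add: E1 r')
      also have "\<dots> = {m (Suc a) (Suc b) | a b. a + b = p}"
        unfolding IH[OF r'] using m' by (rule image_sum_set[where f = "iso_I E (Suc 0) p" and g =
            "\<lambda>a b. form_scale (edge_sign a b) (edge_form E a b)" and h = "\<lambda>a b. m (Suc
                a) (Suc b)"])
      finally have A: "APm0 B E 0 r = {m (Suc a) (Suc b) | a b. a + b = p}" .
      have "ext_Pm E E 0 r (m (Suc a) (Suc b)) = m (Suc a) (Suc b)" if "a + b = p" for a b
        unfolding m_def
        by (rule ext_Pm_self[OF E], rule form.span_scale, rule form.span_base, rule image_eqI[where x =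
            "(mi [a, Suc b], [0])"])
          (use that in \<open>auto simp: Pm_form_edge[OF E E1] E1 mi_in_multiindices Sig0_0 support_mi
              r'\<close>)
      then have "ext_Pm E E 0 r ` APm0 B E 0 r = {m (Suc a) (Suc b) | a b. a + b = p}"
        unfolding A by (rule image_sum_set[where f = "ext_Pm E E 0 r" and g = "\<lambda>a b. m (Suc a)
            (Suc b)" and h = "\<lambda>a b. m (Suc a) (Suc b)"])
      then show ?thesis using U sum_Suc_Suc_cases[of m p] r' by simp
    qed
  qed
  have AP0: "AP0 B E (Suc 0) r = ?R r"
    if r: "r > 0" and IH: "\<And>q. r = Suc (Suc q) \<Longrightarrow> AP B E (Suc 0) q = ?R q" for r
  proof -
    obtain q where q: "r = Suc q" using r by (cases r) auto
    have "iso_J E 0 q (m a b) = form_scale (edge_sign a b) (edge_form E a b)" if "a + b = r" for a b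
      using iso_J_edge_0[OF E E1, of a b q "- edge_sign a b"] that q
      by (simp add: m_def)
    moreover have "AP0 B E (Suc 0) r = iso_J E 0 q ` APm B E 0 r"
      by (subst AP0.simps) (simp add: E1 q)
    moreover have "APm B E 0 r = {m a b | a b. a + b = r}" by (rule APm[OF r IH])
    ultimately show ?thesis
      using image_sum_set[where r = r and f = "iso_J E 0 q" and g = m and
          h = "\<lambda>a b. form_scale (edge_sign a b) (edge_form E a b)"] by simp
  qed
  have vol: "{vol E} = ?R 0"
  proof -
    have "length E = 2" using E1 by (simp add: sdim_def)
    then have "[1..<length E] = [Suc 0]" by (simp add: upt_rec)
    then show ?thesis using dbary_wedge_edge(2)[OF E E1] by (simp add: vol_def edge_sign_def)
  qed
  have AP: "AP B E (Suc 0) r = ?R r" for r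
  proof (induction r rule: less_induct)
    case (less r)
    show ?case
    proof (cases "r = 0")
      case True
      then show ?thesis using vol by (subst AP.simps) (simp add: E1 constant_basis_def)
    next
      case False
      have id: "ext_P E E (Suc 0) r (form_scale (edge_sign a b) (edge_form E a b)) = form_scale
          (edge_sign a b) (edge_form E a b)"
        if ab: "a + b = r" for a b
      proof (rule ext_P_self[OF E], rule form.span_scale, cases "a = 0")
        case True
        \<comment> \<open>For a = 0 the generator with dlambda_1 does not involve vertex 0 and is
          not among the spanning forms; the one with dlambda_0 = - dlambda_1 is.\<close>
        have "- edge_form E a b \<in> form.span (P_form E ` P0_index E (Suc 0) r)"
          by (rule form.span_base, rule image_eqI[where x = "(mi [a, b], [0])"])
            (use ab True False in \<open>auto simp: P_form_edge[OF E E1] E1 mi_in_multiindices Sig_1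
                support_mi\<close>)
        then show "edge_form E a b \<in> form.span (P_form E ` P0_index E (Suc 0) r)"
          using form.span_neg[of "- edge_form E a b"] by simp
      next
        case False
        then show "edge_form E a b \<in> form.span (P_form E ` P0_index E (Suc 0) r)"
          by (intro form.span_base image_eqI[where x = "(mi [a, b], [Suc 0])"])
            (use ab in \<open>auto simp: P_form_edge[OF E E1] E1 mi_in_multiindices Sig_1
                support_mi\<close>)
      qed
      have "AP0 B E (Suc 0) r = ?R r" by (rule AP0) (use False less.IH in simp_all)
      then have "ext_P E E (Suc 0) r ` AP0 B E (Suc 0) r = ?R r"
        using image_sum_set[where f = "ext_P E E (Suc 0) r" and g = "\<lambda>a b. form_scale
            (edge_sign a b) (edge_form E a b)" and h = "\<lambda>a b. form_scale (edge_sign a b)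
                (edge_form E a b)"] id by simp
      then show ?thesis using False
        by (subst AP.simps) (simp add: E1 subsimplices_edge[OF E E1] AP0_vertex_empty single_vertex)
    qed
  qed
  then show "AP B E (Suc 0) r = ?R r" .
  show "AP0 B E (Suc 0) r = ?R r"
  proof (cases "r = 0")
    case True
    then show ?thesis using vol by (subst AP0.simps) (simp add: E1)
  next
    case False
    show ?thesis by (rule AP0) (use False AP in simp_all)
  qed
qed

end

section \<open>Extension from edges\<close>

text \<open>Independence is stated for coefficients over the index set, so it also forces
  \<open>g\<close> to be injective: if g i = g j, the coefficients 1 and -1 would be a nontrivial
  relation.\<close>

lemma linear_extension_of_family:
  assumes "finite I"
    and indep: "\<And>c i. (\<Sum>i\<in>I. form_scale (c i) (g i)) = 0 \<Longrightarrow> i \<in> I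
        \<Longrightarrow> c i = 0"
  shows "\<exists>L. Vector_Spaces.linear form_scale form_scale L \<and> (\<forall>i\<in>I. L (g i) = h i)"
proof -
  have inj: "inj_on g I"
  proof (rule inj_onI, rule ccontr)
    fix i j assume ij: "i \<in> I" "j \<in> I" "g i = g j" "i \<noteq> j"
    let ?c = "\<lambda>k. if k = i then 1 else if k = j then - 1 else 0 :: complex"
    have "(\<Sum>k\<in>I. form_scale (?c k) (g k)) = (\<Sum>k\<in>{i, j}. form_scale (?c k) (g k))"
      using ij \<open>finite I\<close> by (intro sum.mono_neutral_right) auto
    also have "\<dots> = 0" using ij by simp
    finally show False using indep[of ?c i] ij by simp
  qed
  have "form.independent (g ` I)"
  proof (rule form.independent_if_scalars_zero)
    fix f x assume "(\<Sum>x\<in>g ` I. form_scale (f x) x) = 0" "x \<in> g ` I"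
    then show "f x = 0" using indep[of "f \<circ> g"] by (auto simp: sum.reindex[OF inj])
  qed (use \<open>finite I\<close> in simp)
  from form_pair.linear_independent_extend[OF this, of "h \<circ> the_inv_into I g"]
  show ?thesis by (auto simp: the_inv_into_f_f[OF inj])
qed

lemma bary_edge_point:
  assumes "ordered_simplex T" "i \<le> sdim T" "j \<le> sdim T"
  shows "bary T k ((1 - t) *\<^sub>R T ! i + t *\<^sub>R T ! j) = (if i = k then 1 - t else 0) + (if j
      = k then t else 0)"
proof -
  obtain g b where g: "linear g" "bary T k = (\<lambda>x. g x + b)"
    using affine_mapE[OF bary_spec(1)[OF assms(1)]] .
  have "bary T k ((1 - t) *\<^sub>R T ! i + t *\<^sub>R T ! j) = (1 - t) * bary T k (T ! i) + t * bary
      T k (T ! j)"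
    unfolding g(2) by (simp add: linear_add[OF g(1)] linear_scale[OF g(1)]) (simp add: algebra_simps)
  then show ?thesis using assms by (simp add: bary_spec(2))
qed

text \<open>At points with lambda_0 / lambda_1 = s, a homogeneous relation becomes a power of
  lambda_1 times a polynomial in s, which would have infinitely many roots.\<close>

lemma edge_forms_independent:
  assumes E: "ordered_simplex E" "sdim E = Suc 0"
    and 0: "(\<Sum>a\<le>r. form_scale (c a) (edge_form E a (r - a))) = 0" and a: "a \<le> r"
  shows "c a = 0"
proof (rule ccontr)
  assume "c a \<noteq> 0"
  then have "\<exists>k\<le>r. c k \<noteq> 0" using a by blast
  then have fin: "finite {z. (\<Sum>a\<le>r. c a * z ^ a) = 0}" using polyfun_rootbound by blast
  have "of_real s \<in> {z. (\<Sum>a\<le>r. c a * z ^ a) = 0}" if s: "0 < s" for s :: real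
  proof -
    \<comment> \<open>This value of t = lambda_1 makes lambda_0 = 1 - t equal to s t.\<close>
    define t where "t = 1 / (1 + s)"
    have t: "0 < t" "t \<le> 1" "1 - t = s * t" using s by (auto simp: t_def field_simps)
    define x where "x = (1 - t) *\<^sub>R E ! 0 + t *\<^sub>R E ! 1"
    have x: "x \<in> body E" unfolding x_def using E t by (intro edge_point_in_body) auto
    have b: "bary E 0 x = s * t" "bary E 1 x = t"
      using bary_edge_point[OF E(1), of 0 1 0 t] bary_edge_point[OF E(1), of 0 1 1 t] E(2) t(3)
      unfolding x_def by auto
    have eq: "(\<Sum>a\<in>A. form_scale (c a) (edge_form E a (r - a))) x [E ! 1 - E ! 0] =
        (\<Sum>a\<in>A. c a * of_real (bary E 0 x ^ a * bary E 1 x ^ (r - a)))" for A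
      by (induction A rule: infinite_finite_induct) (auto simp: form_scale_apply edge_evals(2)[OF E x,
          unfolded One_nat_def])
    have "0 = (\<Sum>a\<le>r. c a * of_real (bary E 0 x ^ a * bary E 1 x ^ (r - a)))"
      using 0 eq[of "{..r}"] by simp
    also have "\<dots> = (\<Sum>a\<le>r. of_real (t ^ r) * (c a * of_real s ^ a))"
    proof (rule sum.cong)
      fix a assume "a \<in> {..r}"
      then have "t ^ r = t ^ a * t ^ (r - a)" by (simp flip: power_add)
      then show "c a * of_real (bary E 0 x ^ a * bary E 1 x ^ (r - a)) = of_real (t ^ r) * (c a *
          of_real s ^ a)"
        unfolding b by (simp add: power_mult_distrib)
    qed simp
    finally have "of_real (t ^ r) * (\<Sum>a\<le>r. c a * complex_of_real s ^ a) = 0" by (simp add: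
        sum_distrib_left)
    then show ?thesis using t by simp
  qed
  then have "of_real ` {0<..} \<subseteq> {z. (\<Sum>a\<le>r. c a * z ^ a) = 0}" by blast
  then have "finite (complex_of_real ` {0<..})" using fin finite_subset by blast
  then have "finite {0::real<..}" using finite_imageD inj_of_real inj_on_subset by blast
  then show False using infinite_Ioi by blast
qed

text \<open>The extension from an edge depends on the exponents, so its witness comes from
  independence rather than from a pointwise formula.\<close>

lemma linear_extension_edge:
  assumes "ordered_simplex E" "sdim E = Suc 0"
  obtains L where "Vector_Spaces.linear form_scale form_scale L"
    "\<And>a b. a + b = r \<Longrightarrow> L (edge_form E a b) = h a b"
proof -
  obtain L where L: "Vector_Spaces.linear form_scale form_scale L"
    "\<forall>a\<in>{..r}. L (edge_form E a (r - a)) = h a (r - a)"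
    using linear_extension_of_family[of "{..r}" "\<lambda>a. edge_form E a (r - a)" "\<lambda>a. h a (r
        - a)"]
      edge_forms_independent[OF assms, of _ r] by auto
  have "L (edge_form E a b) = h a b" if "a + b = r" for a b
    using bspec[OF L(2), of a] that by auto
  then show ?thesis using that L(1) by blast
qed

text \<open>The monomial times \<open>Psi\<close> for vertex j: since 1 - b/(a+b) = a/(a+b), this
  \<open>Psi\<close> is (a dlambda_j - b dlambda_i)/(a+b). In degree 0 the quotients are 0, but the
  recursion uses positive degrees only. The indices i, j need not be ordered, so vertex permutations
  act on them directly.\<close>

definition edge_ext :: "'a::euclidean_space list \<Rightarrow> nat \<Rightarrow> nat \<Rightarrow> nat
    \<Rightarrow> nat \<Rightarrow> 'a form" where
  "edge_ext T i j a b = one_form T (\<lambda>k x. of_real (bary T i x ^ a * bary T j x ^ b) *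
     ((if k = j then of_nat a / of_nat (a + b) else 0) - (if k = i then of_nat b / of_nat (a + b) else 0)))"

definition edge_ext_m :: "'a::euclidean_space list \<Rightarrow> nat \<Rightarrow> nat \<Rightarrow>
    nat \<Rightarrow> nat \<Rightarrow> 'a form" where
  "edge_ext_m T i j a b = one_form T (\<lambda>k x. of_real (bary T i x ^ a * bary T j x ^ b) *
     ((if k = j then of_real (bary T i x) else 0) - (if k = i then of_real (bary T j x) else 0)))"

context
  fixes T :: "'a::euclidean_space list" and i j :: nat
  assumes T: "ordered_simplex T" and ij: "i < j" "j \<le> sdim T"
begin

lemma edge_length: "i < length T" "j < length T"
  using T ij by (cases T; auto simp: ordered_simplex_def sdim_def)+

lemma edge_of_simplex: "ordered_simplex [T ! i, T ! j]" "sdim [T ! i, T ! j] = Suc 0"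
proof -
  have "{T ! i, T ! j} \<subseteq> set T" using edge_length by simp
  moreover have "T ! i \<noteq> T ! j" using edge_length T ij by (simp add: nth_eq_iff_index_eq
      ordered_simplex_def)
  ultimately show "ordered_simplex [T ! i, T ! j]"
    using T affine_dependent_subset unfolding ordered_simplex_def by force
qed (simp add: sdim_def)

lemma incl_edge: "incl [T ! i, T ! j] T 0 = i" "incl [T ! i, T ! j] T (Suc 0) = j"
  using T edge_length by (auto intro!: incl_eq simp: ordered_simplex_def)

lemma incl_range_edge: "incl_range [T ! i, T ! j] T = {i, j}"
  by (auto simp: incl_range_def incl_edge sdim_def atMost_Suc)

lemma lift_multi_edge:
  "lift_multi [T ! i, T ! j] T (mi [a, b]) = (\<lambda>k. if k = i then a else if k = j then b else 0)"
proof
  fix k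
  have "inj_on (incl [T ! i, T ! j] T) {..sdim [T ! i, T ! j]}"
    using ij by (auto simp: sdim_def atMost_Suc incl_edge)
  then show "lift_multi [T ! i, T ! j] T (mi [a, b]) k = (if k = i then a else if k = j then b else 0)"
    using lift_multi_incl[of "[T ! i, T ! j]" T 0 "mi [a, b]"] lift_multi_incl[of "[T ! i, T ! j]" T
        "Suc 0" "mi [a, b]"]
      lift_multi_outside[of k "[T ! i, T ! j]" T "mi [a, b]"]
    by (auto simp: incl_edge incl_range_edge sdim_def)
qed

lemma monomial_edge_lift:
  "monomial T (\<lambda>k. if k = i then a else if k = j then b else 0) x = bary T i x ^ a * bary T j x ^ b"
proof -
  have "monomial T (\<lambda>k. if k = i then a else if k = j then b else 0) x =
      (\<Prod>k\<in>{i, j}. bary T k x ^ (if k = i then a else if k = j then b else 0))"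
    unfolding monomial_def using ij by (intro prod.mono_neutral_right) auto
  then show ?thesis using ij by simp
qed

lemma edge_ext_m_eq: "edge_ext_m T i j a b = Pm_form T (\<lambda>k. if k = i then a else if k = j then
    b else 0, [i, j])"
  using ij by (auto simp: Pm_form_def whitney_pair T one_form_ops monomial_edge_lift
      edge_ext_m_def intro!: one_form_cong[OF T] exI[of _ 0])

lemma edge_ext_eq: "edge_ext T i j a b =
    form_scale (of_nat a / of_nat (a + b)) (P_form T (\<lambda>k. if k = i then a else if k = j then b
        else 0, [j])) -
    form_scale (of_nat b / of_nat (a + b)) (P_form T (\<lambda>k. if k = i then a else if k = j then b
        else 0, [i]))"
  using ij by (auto simp: P_form_def dbary_wedge_single T one_form_ops monomial_edge_lift
      edge_ext_def intro!: one_form_cong[OF T] exI[of _ 0] simp del: of_nat_add)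

lemma edge_multiindex: "(\<lambda>k. if k = i then a else if k = j then b else 0) \<in> multiindices (a
    + b) (sdim T)"
proof -
  have "(\<Sum>k\<le>sdim T. if k = i then a else if k = j then b else 0) =
      (\<Sum>k\<in>{i, j}. if k = i then a else if k = j then b else 0)"
    using ij by (intro sum.mono_neutral_right) auto
  then show ?thesis using ij by (auto simp: multiindices_def)
qed

lemma edge_ext_in_span:
  "edge_ext T i j a b \<in> form.span (P_form T ` (multiindices (a + b) (sdim T) \<times> Sig (Suc 0)
      (sdim T)))"
  unfolding edge_ext_eq
  by (intro form.span_diff form.span_scale form.span_base imageI SigmaI edge_multiindex) (use ij in
      \<open>auto simp: Sig_1\<close>)

lemma edge_ext_m_in_span:
  "edge_ext_m T i j a b \<in> form.span (Pm_form T ` (multiindices (a + b) (sdim T) \<times> Sig0 (Suc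
      0) (sdim T)))"
  unfolding edge_ext_m_eq
  by (intro form.span_base imageI SigmaI edge_multiindex) (use ij in \<open>auto simp: Sig0_1\<close>)

lemma ext_Pm_edge:
  assumes "a + b = r"
  shows "ext_Pm [T ! i, T ! j] T (Suc 0) (Suc r) (edge_form [T ! i, T ! j] a b) = edge_ext_m T i j a b"
proof -
  let ?E = "[T ! i, T ! j]"
  note E = edge_of_simplex
  obtain L where L: "Vector_Spaces.linear form_scale form_scale L"
    "\<And>a b. a + b = r \<Longrightarrow> L (edge_form ?E a b) = edge_ext_m T i j a b"
    using linear_extension_edge[OF E] by blast
  have "ext_Pm ?E T (Suc 0) (Suc r) (edge_form ?E a b) = L (edge_form ?E a b)"
    unfolding ext_Pm_def Let_def
  proof (rule linear_map_with_eq[OF L(1)])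
    fix k assume "k \<in> {(\<alpha>, \<rho>). \<alpha> \<in> multiindices (Suc r - 1) (sdim ?E) \<and>
        \<rho> \<in> Sig0 (Suc 0) (sdim ?E) \<and> support \<alpha> \<union> set \<rho> = {..sdim ?E}}"
    then obtain a b where k: "k = (mi [a, b], [0, Suc 0])" "a + b = r"
      by (auto simp: E multiindices_1 Sig0_1)
    show "L (Pm_form ?E k) = (case k of (\<alpha>, \<rho>) \<Rightarrow> Pm_form T (lift_multi ?E T
        \<alpha>, map (incl ?E T) \<rho>))"
      by (simp add: k Pm_form_edge[OF E] L(2) incl_edge lift_multi_edge edge_ext_m_eq)
  next
    show "edge_form ?E a b \<in> form.span (Pm_form ?E ` {(\<alpha>, \<rho>). \<alpha> \<in>
        multiindices (Suc r - 1) (sdim ?E) \<and> \<rho> \<in> Sig0 (Suc 0) (sdim ?E) \<and> support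
            \<alpha> \<union> set \<rho> = {..sdim ?E}})"
      by (intro form.span_base image_eqI[where x = "(mi [a, b], [0, Suc 0])"])
        (use assms in \<open>auto simp: Pm_form_edge[OF E] E mi_in_multiindices Sig0_1 support_mi\<close>)
  qed
  then show ?thesis using L(2) assms by simp
qed

lemma Psi_edge:
  assumes "k \<le> sdim T" "\<And>l. l \<notin> {i, j} \<Longrightarrow> \<alpha> l = 0"
  shows "Psi [T ! i, T ! j] T \<alpha> k = one_form T (\<lambda>l x. (if l = k then 1 else 0) -
    of_nat (\<alpha> k) / of_nat (\<alpha> i + \<alpha> j) * ((if l = i then 1 else 0) + (if l = j then
        1 else 0)))"
proof -
  have "(\<Sum>l\<le>sdim T. \<alpha> l) = (\<Sum>l\<in>{i, j}. \<alpha> l)"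
    using ij assms(2) by (intro sum.mono_neutral_right) auto
  then have s: "(\<Sum>l\<le>sdim T. \<alpha> l) = \<alpha> i + \<alpha> j" using ij by simp
  show ?thesis unfolding Psi_def s incl_range_edge
    using ij assms(1) by (simp add: dbary_one_form T one_form_ops)
qed

text \<open>The generators with dlambda_0 and with dlambda_1 are opposite forms on the edge, and
  their prescribed images are opposite because the two \<open>Psi\<close> are; this makes the
  extension well defined.\<close>

lemma ext_P_edge:
  assumes "a + b = Suc r"
  shows "ext_P [T ! i, T ! j] T (Suc 0) (Suc r) (form_scale c (edge_form [T ! i, T ! j] a b)) =
    form_scale c (edge_ext T i j a b)"
proof -
  let ?E = "[T ! i, T ! j]"
  note E = edge_of_simplex
  let ?I = "{(\<alpha>, \<sigma>). \<alpha> \<in> multiindices (Suc r) (sdim ?E) \<and> \<sigma> \<in>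
      Sig (Suc 0) (sdim ?E) \<and> support \<alpha> \<union> set \<sigma> = {..sdim ?E}}"
  obtain L where L: "Vector_Spaces.linear form_scale form_scale L"
    "\<And>a b. a + b = Suc r \<Longrightarrow> L (edge_form ?E a b) = edge_ext T i j a b"
    using linear_extension_edge[OF E] by blast
  have "ext_P ?E T (Suc 0) (Suc r) (form_scale c (edge_form ?E a b)) = L (form_scale c (edge_form ?E a b))"
    unfolding ext_P_def Let_def
  proof (rule linear_map_with_eq[OF L(1)])
    fix k assume "k \<in> ?I"
    then obtain a b l where k: "k = (mi [a, b], [l])" "a + b = Suc r" "l = 0 \<or> l = Suc 0"
      by (auto simp: E multiindices_1 Sig_1 le_Suc_eq)
    let ?\<alpha> = "\<lambda>k. if k = i then a else if k = j then b else 0"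
    have fr: "of_nat a / of_nat (a + b) + of_nat b / of_nat (a + b) = (1::complex)"
      by (simp add: k(2) del: of_nat_Suc flip: add_divide_distrib of_nat_add)
    have n: "complex_of_nat b / of_nat (a + b) = 1 - of_nat a / of_nat (a + b)" using fr by (simp add:
        algebra_simps)
    have Psi: "Psi ?E T ?\<alpha> i = one_form T (\<lambda>l x. (if l = i then 1 else 0) -
        of_nat a / of_nat (a + b) * ((if l = i then 1 else 0) + (if l = j then 1 else 0)))"
      "Psi ?E T ?\<alpha> j = one_form T (\<lambda>l x. (if l = j then 1 else 0) -
        of_nat b / of_nat (a + b) * ((if l = i then 1 else 0) + (if l = j then 1 else 0)))"
      using ij by (subst Psi_edge; auto)+
    have "func_mult (monomial T ?\<alpha>) (wedge T [Psi ?E T ?\<alpha> i]) = - edge_ext T i j a b"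
      "func_mult (monomial T ?\<alpha>) (wedge T [Psi ?E T ?\<alpha> j]) = edge_ext T i j a b"
      using ij unfolding edge_ext_def one_form_ops Psi wedge_one_form monomial_edge_lift n
      by (auto intro!: one_form_cong[OF T] exI[of _ 0] simp: right_diff_distrib simp del: of_nat_add)
    then show "L (P_form ?E k) = (case k of (\<alpha>, \<sigma>) \<Rightarrow> func_mult (monomial T
        (lift_multi ?E T \<alpha>))
        (wedge T (map (Psi ?E T (lift_multi ?E T \<alpha>)) (map (incl ?E T) \<sigma>))))"
      using k(2,3) by (auto simp: k(1) P_form_edge[OF E] L(2) incl_edge lift_multi_edge
          form_pair.linear_neg[OF L(1)])
  next
    have "edge_form ?E a b \<in> form.span (P_form ?E ` ?I)"
    proof (cases "a = 0")
      case True
      then have "- edge_form ?E a b \<in> form.span (P_form ?E ` ?I)"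
        by (intro form.span_base image_eqI[where x = "(mi [a, b], [0])"])
          (use assms in \<open>auto simp: P_form_edge[OF E] E mi_in_multiindices Sig_1 support_mi\<close>)
      then show ?thesis using form.span_neg[of "- edge_form ?E a b"] by simp
    next
      case False
      then show ?thesis
        by (intro form.span_base image_eqI[where x = "(mi [a, b], [Suc 0])"])
          (use assms in \<open>auto simp: P_form_edge[OF E] E mi_in_multiindices Sig_1 support_mi\<close>)
    qed
    then show "form_scale c (edge_form ?E a b) \<in> form.span (P_form ?E ` ?I)" by (rule form.span_scale)
  qed
  then show ?thesis using L(2) assms by (simp add: form_pair.linear_scale[OF L(1)])
qed

end

section \<open>The operators on triangles\<close>

text \<open>Pointwise formulas for \<open>\<I>\<^sub>1\<close> and \<open>\<J>\<^sub>1\<close>. With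
  \<open>\<psi>\<^sub>0 = \<phi>\<^sub>1\<^sub>2\<close>, \<open>\<psi>\<^sub>1 = -
  \<phi>\<^sub>0\<^sub>2\<close>, \<open>\<psi>\<^sub>2 = \<phi>\<^sub>0\<^sub>1\<close>, one has
  \<open>\<I>\<^sub>1(d\<lambda>\<^sub>k) = \<lambda>\<^sub>k \<psi>\<^sub>k\<close>. For
  \<open>\<J>\<^sub>1\<close>, the numbers \<open>w\<^sub>i = \<lambda>\<^sub>i \<omega>(v\<^sub>i -
  x)\<close> sum to \<open>0\<close> and \<open>\<J>\<^sub>1 \<omega> = w\<^sub>1 d\<lambda>\<^sub>2 -
  w\<^sub>2 d\<lambda>\<^sub>1\<close>.\<close>

definition rotation_I :: "'a::euclidean_space list \<Rightarrow> 'a form \<Rightarrow> 'a form" where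
  "rotation_I T \<omega> = one_form T (\<lambda>k x.
     if k = 0 then of_real (bary T 1 x * bary T 2 x) * \<omega> x [T ! 1 - T ! 2]
     else if k = 1 then of_real (bary T 2 x * bary T 0 x) * \<omega> x [T ! 2 - T ! 0]
     else of_real (bary T 0 x * bary T 1 x) * \<omega> x [T ! 0 - T ! 1])"

definition radial :: "'a::euclidean_space list \<Rightarrow> 'a form \<Rightarrow> nat \<Rightarrow> 'a
    \<Rightarrow> complex" where
  "radial T \<omega> i x = of_real (bary T i x) * (\<Sum>l\<le>sdim T. of_real (bary T l x) * \<omega>
      x [T ! i - T ! l])"

definition rotation_J :: "'a::euclidean_space list \<Rightarrow> 'a form \<Rightarrow> 'a form" where
  "rotation_J T \<omega> = one_form T (\<lambda>k x.
     if k = 1 then - radial T \<omega> 2 x else if k = 2 then radial T \<omega> 1 x else 0)"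

lemma xi_cube: "xi ^ 3 = 1"
proof -
  have "xi ^ 3 = exp (of_nat 3 * (2 * of_real pi * \<i> / 3))"
    unfolding xi_def by (rule exp_of_nat_mult[symmetric])
  then show ?thesis using exp_two_pi_i by (simp add: ac_simps)
qed

lemma xi_neq_real: "xi \<notin> \<real>"
proof
  assume "xi \<in> \<real>"
  then have "Im xi = 0" by (simp add: complex_is_Real_iff)
  moreover have "Im xi = sin (2 * pi / 3)" by (simp add: xi_def Im_exp)
  moreover have "sin (2 * pi / 3) > 0" by (rule sin_gt_zero) (use pi_gt_zero in \<open>simp_all add:
      field_simps\<close>)
  ultimately show False by simp
qed

lemma cmod_xi: "cmod xi = 1"
  by (simp add: xi_def)

lemma all_le_2: "(\<forall>i\<le>2. P i) \<longleftrightarrow> P 0 \<and> P (Suc 0) \<and> P (2::nat)"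
  by (auto simp: numeral_2_eq_2 le_Suc_eq)

context
  fixes T :: "'a::euclidean_space list"
  assumes T: "ordered_simplex T" and T2: "sdim T = 2"
begin

lemma linear_rotation_I: "Vector_Spaces.linear form_scale form_scale (rotation_I T)"
  by (rule form_linearI)
    (auto simp: rotation_I_def one_form_ops form_scale_apply algebra_simps intro!: one_form_cong[OF T]
        exI[of _ 0])

lemma linear_rotation_J: "Vector_Spaces.linear form_scale form_scale (rotation_J T)"
  by (rule form_linearI)
    (auto simp: rotation_J_def radial_def one_form_ops form_scale_apply algebra_simps sum.distrib
        sum_distrib_left
      intro!: one_form_cong[OF T] exI[of _ 0])

text \<open>Coefficients may be shifted by a common summand, so the differences to coefficient 0
  decide equality.\<close>

lemma one_form_triangle_cong:
  assumes "\<And>x. x \<in> body T \<Longrightarrow> c (Suc 0) x - c 0 x = d (Suc 0) x - d 0 x"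
    and "\<And>x. x \<in> body T \<Longrightarrow> c 2 x - c 0 x = d 2 x - d 0 x"
  shows "one_form T c = one_form T d"
proof (rule one_form_cong[OF T], rule exI, unfold T2 all_le_2, intro conjI)
  fix x assume "x \<in> body T"
  note * = assms[OF this]
  show "c 0 x = d 0 x + (c 0 x - d 0 x)" by simp
  show "c (Suc 0) x = d (Suc 0) x + (c 0 x - d 0 x)" using *(1) by (simp add: algebra_simps)
  show "c 2 x = d 2 x + (c 0 x - d 0 x)" using *(2) by (simp add: algebra_simps)
qed

lemma one_form_triangle_edge:
  "i \<le> 2 \<Longrightarrow> j \<le> 2 \<Longrightarrow> x \<in> body T \<Longrightarrow> one_form T
      c x [T ! i - T ! j] = c i x - c j x"
  by (rule one_form_edge) (simp_all add: T T2)

lemma rotation_I_one_form: "rotation_I T (one_form T c) = one_form T (\<lambda>k x.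
     if k = 0 then of_real (bary T 1 x * bary T 2 x) * (c 1 x - c 2 x)
     else if k = 1 then of_real (bary T 2 x * bary T 0 x) * (c 2 x - c 0 x)
     else of_real (bary T 0 x * bary T 1 x) * (c 0 x - c 1 x))"
  unfolding rotation_I_def by (rule one_form_cong[OF T]) (auto simp: one_form_triangle_edge intro!:
      exI[of _ 0])

text \<open>Eliminating lambda_0 turns the identities below into polynomial identities in lambda_1
  and lambda_2, which \<open>algebra_simps\<close> can settle.\<close>

lemma sum_bary_triangle:
  "x \<in> body T \<Longrightarrow> complex_of_real (bary T 0 x) = 1 - of_real (bary T 1 x) - of_real
      (bary T 2 x)"
proof -
  assume "x \<in> body T"
  then have "bary T 0 x = 1 - bary T 1 x - bary T 2 x" using sum_bary[OF T, of x] by (simp add: T2 atMost_2)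
  then show ?thesis by simp
qed

lemma radial_one_form:
  assumes "i \<le> 2" "x \<in> body T"
  shows "radial T (one_form T c) i x = of_real (bary T i x) * (\<Sum>l\<le>2. of_real (bary T l x) * (c
      i x - c l x))"
  using assms by (simp add: radial_def T2 one_form_triangle_edge)

lemma rotation_J_one_form: "rotation_J T (one_form T c) = one_form T (\<lambda>k x.
     if k = 1 then - (of_real (bary T 2 x) * (\<Sum>l\<le>2. of_real (bary T l x) * (c 2 x - c l x)))
     else if k = 2 then of_real (bary T 1 x) * (\<Sum>l\<le>2. of_real (bary T l x) * (c 1 x - c l x))
         else 0)"
  unfolding rotation_J_def by (rule one_form_cong[OF T]) (auto simp: radial_one_form intro!: exI[of _ 0])

lemma rotation_J_I:
  "rotation_J T (rotation_I T (one_form T c)) =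
   one_form T (\<lambda>k x. of_real (bary T 0 x * bary T 1 x * bary T 2 x) * c k x)"
  unfolding rotation_I_one_form rotation_J_one_form
  by (rule one_form_triangle_cong) (simp_all add: atMost_2 sum_bary_triangle algebra_simps)

lemma rotation_I_J:
  "rotation_I T (rotation_J T (one_form T c)) =
   one_form T (\<lambda>k x. of_real (bary T 0 x * bary T 1 x * bary T 2 x) * c k x)"
  unfolding rotation_I_one_form rotation_J_one_form
  by (rule one_form_triangle_cong) (simp_all add: atMost_2 sum_bary_triangle algebra_simps)

lemma monomial_triangle: "monomial T (mi [a, b, c]) x = bary T 0 x ^ a * bary T 1 x ^ b * bary T 2 x ^ c"
  by (simp add: monomial_def T2 atMost_2 numeral_2_eq_2)

lemma P_form_triangle:
  assumes "k \<le> 2"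
  shows "P_form T (mi [a, b, c], [k]) = one_form T (\<lambda>j x.
    of_real (bary T 0 x ^ a * bary T 1 x ^ b * bary T 2 x ^ c) * (if j = k then 1 else 0))"
  using assms by (simp add: P_form_def monomial_triangle dbary_wedge_single T T2 one_form_ops)

lemma Pm_form_triangle:
  assumes "i \<le> 2" "j \<le> 2"
  shows "Pm_form T (mi [a, b, c], [i, j]) = one_form T (\<lambda>k x.
    of_real (bary T 0 x ^ a * bary T 1 x ^ b * bary T 2 x ^ c) *
    (of_real (bary T i x) * (if k = j then 1 else 0) - of_real (bary T j x) * (if k = i then 1 else 0)))"
  using assms by (simp add: Pm_form_def monomial_triangle whitney_pair T T2 one_form_ops)

text \<open>The minus sign in the middle case is that of sorting 1, 0, 2.\<close>

lemma rotation_I_P_form: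
  "rotation_I T (P_form T (mi [a, b, c], [0])) = Pm_form T (mi [Suc a, b, c], [Suc 0, 2])"
  "rotation_I T (P_form T (mi [a, b, c], [Suc 0])) = - Pm_form T (mi [a, Suc b, c], [0, 2])"
  "rotation_I T (P_form T (mi [a, b, c], [2])) = Pm_form T (mi [a, b, Suc c], [0, Suc 0])"
  by (simp_all add: P_form_triangle Pm_form_triangle rotation_I_one_form one_form_ops)
    (rule one_form_triangle_cong; simp)+

lemma rotation_J_Pm_form:
  "rotation_J T (Pm_form T (mi [a, b, c], [Suc 0, 2])) = P_form T (mi [a, Suc b, Suc c], [0])"
  "rotation_J T (Pm_form T (mi [a, b, c], [0, 2])) = - P_form T (mi [Suc a, b, Suc c], [Suc 0])"
  "rotation_J T (Pm_form T (mi [a, b, c], [0, Suc 0])) = P_form T (mi [Suc a, Suc b, c], [2])"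
  by (simp_all add: P_form_triangle Pm_form_triangle rotation_J_one_form one_form_ops)
    (rule one_form_triangle_cong; simp add: atMost_2 sum_bary_triangle algebra_simps)+

lemma func_mult_bary_prod_triangle:
  "func_mult (monomial T (mi [a, b, c])) (func_mult (bary_prod T [0]) \<omega>) = func_mult (monomial T
      (mi [Suc a, b, c])) \<omega>"
  "func_mult (monomial T (mi [a, b, c])) (func_mult (bary_prod T [Suc 0]) \<omega>) = func_mult
      (monomial T (mi [a, Suc b, c])) \<omega>"
  "func_mult (monomial T (mi [a, b, c])) (func_mult (bary_prod T [2]) \<omega>) = func_mult (monomial T
      (mi [a, b, Suc c])) \<omega>"
  "func_mult (monomial T (mi [a, b, c])) (func_mult (bary_prod T [0, Suc 0]) \<omega>) = func_mult
      (monomial T (mi [Suc a, Suc b, c])) \<omega>"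
  "func_mult (monomial T (mi [a, b, c])) (func_mult (bary_prod T [0, 2]) \<omega>) = func_mult
      (monomial T (mi [Suc a, b, Suc c])) \<omega>"
  "func_mult (monomial T (mi [a, b, c])) (func_mult (bary_prod T [Suc 0, 2]) \<omega>) = func_mult
      (monomial T (mi [a, Suc b, Suc c])) \<omega>"
  by (simp_all add: func_mult_def monomial_triangle bary_prod_def fun_eq_iff ac_simps)

lemma Sig_1_2: "Sig (Suc 0) 2 = {[0], [Suc 0], [2]}"
  by (simp add: Sig_1 atMost_2)

lemma Sig0_1_2: "Sig0 (Suc 0) 2 = {[0, Suc 0], [0, 2], [Suc 0, 2]}"
  by (auto simp: Sig0_1 numeral_2_eq_2 le_Suc_eq)

text \<open>Checking the pointwise formula on generators identifies the chosen operator with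
  \<open>rotation_I\<close>, but only on the span where it is specified.\<close>

lemma iso_I_triangle:
  assumes "\<omega> \<in> form.span (P_form T ` (multiindices r 2 \<times> Sig (Suc 0) 2))"
  shows "iso_I T (Suc 0) r \<omega> = rotation_I T \<omega>"
proof (rule iso_I_eq[OF linear_rotation_I], unfold T2)
  fix \<alpha> \<sigma> assume "\<alpha> \<in> multiindices r 2" "\<sigma> \<in> Sig (Suc 0) 2"
  then show "rotation_I T (P_form T (\<alpha>, \<sigma>)) = form_scale (eps \<sigma> (compl_index 2
      \<sigma>))
      (func_mult (monomial T \<alpha>) (func_mult (bary_prod T \<sigma>) (whitney T (compl_index 2
          \<sigma>))))"
    by (auto simp: multiindices_2 Sig_1_2 rotation_I_P_form compl_index_2 sort_sign_values
        func_mult_bary_prod_triangle Pm_form_def)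
qed (rule assms)

lemma iso_J_triangle:
  assumes "\<omega> \<in> form.span (Pm_form T ` (multiindices r 2 \<times> Sig0 (Suc 0) 2))"
  shows "iso_J T (Suc 0) r \<omega> = rotation_J T \<omega>"
proof (rule iso_J_eq[OF linear_rotation_J], unfold T2)
  fix \<alpha> \<rho> assume "\<alpha> \<in> multiindices r 2" "\<rho> \<in> Sig0 (Suc 0) 2"
  then show "rotation_J T (Pm_form T (\<alpha>, \<rho>)) = form_scale (eps (compl_index 2 \<rho>) \<rho>)
      (func_mult (monomial T \<alpha>) (func_mult (bary_prod T \<rho>) (dbary_wedge T (compl_index 2
          \<rho>))))"
    by (auto simp: multiindices_2 Sig0_1_2 rotation_J_Pm_form compl_index_2 sort_sign_values
        func_mult_bary_prod_triangle P_form_def)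
qed (rule assms)

text \<open>The image of a generator gains a factor lambda_k for the vertex missing from its Whitney
  form, hence has full support. This places it where extension from T to itself is the
  identity.\<close>

lemma rotation_I_in_span:
  assumes "\<omega> \<in> form.span (P_form T ` (multiindices r 2 \<times> Sig (Suc 0) 2))"
  shows "rotation_I T \<omega> \<in> form.span (Pm_form T ` Pm0_index T (Suc 0) (Suc (Suc r)))"
proof -
  have "rotation_I T ` P_form T ` (multiindices r 2 \<times> Sig (Suc 0) 2)
      \<subseteq> form.span (Pm_form T ` Pm0_index T (Suc 0) (Suc (Suc r)))"
  proof -
    have base: "Pm_form T i \<in> form.span (Pm_form T ` Pm0_index T (Suc 0) (Suc (Suc r)))"
      if "i \<in> Pm0_index T (Suc 0) (Suc (Suc r))" for i
      by (rule form.span_base[OF imageI[OF that]])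
    have "(mi [Suc a, b, c], [Suc 0, 2]) \<in> Pm0_index T (Suc 0) (Suc (Suc r))"
      "(mi [a, Suc b, c], [0, 2]) \<in> Pm0_index T (Suc 0) (Suc (Suc r))"
      "(mi [a, b, Suc c], [0, Suc 0]) \<in> Pm0_index T (Suc 0) (Suc (Suc r))" if "a + b + c = r" for a b c
      using that by (auto simp: T2 mi_in_multiindices Sig0_1_2 support_mi atMost_2 split: if_splits)
    from base[OF this(1)] form.span_neg[OF base[OF this(2)]] base[OF this(3)] show ?thesis
      by (auto simp: multiindices_2 Sig_1_2 rotation_I_P_form)
  qed
  then have "form.span (rotation_I T ` P_form T ` (multiindices r 2 \<times> Sig (Suc 0) 2))
      \<subseteq> form.span (Pm_form T ` Pm0_index T (Suc 0) (Suc (Suc r)))"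
    by (intro form.span_minimal form.subspace_span)
  then show ?thesis using form_pair.linear_span_image[OF linear_rotation_I] assms by blast
qed

text \<open>Here the two new factors cover the vertices missing from dlambda_k, which again gives
  full support.\<close>

lemma rotation_J_in_span:
  assumes "\<omega> \<in> form.span (Pm_form T ` (multiindices r 2 \<times> Sig0 (Suc 0) 2))"
  shows "rotation_J T \<omega> \<in> form.span (P_form T ` P0_index T (Suc 0) (Suc (Suc r)))"
proof -
  have "rotation_J T ` Pm_form T ` (multiindices r 2 \<times> Sig0 (Suc 0) 2)
      \<subseteq> form.span (P_form T ` P0_index T (Suc 0) (Suc (Suc r)))"
  proof -
    have base: "P_form T i \<in> form.span (P_form T ` P0_index T (Suc 0) (Suc (Suc r)))"
      if "i \<in> P0_index T (Suc 0) (Suc (Suc r))" for i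
      by (rule form.span_base[OF imageI[OF that]])
    have "(mi [a, Suc b, Suc c], [0]) \<in> P0_index T (Suc 0) (Suc (Suc r))"
      "(mi [Suc a, b, Suc c], [Suc 0]) \<in> P0_index T (Suc 0) (Suc (Suc r))"
      "(mi [Suc a, Suc b, c], [2]) \<in> P0_index T (Suc 0) (Suc (Suc r))" if "a + b + c = r" for a b c
      using that by (auto simp: T2 mi_in_multiindices Sig_1_2 support_mi atMost_2 split: if_splits)
    from base[OF this(1)] form.span_neg[OF base[OF this(2)]] base[OF this(3)] show ?thesis
      by (auto simp: multiindices_2 Sig0_1_2 rotation_J_Pm_form)
  qed
  then have "form.span (rotation_J T ` Pm_form T ` (multiindices r 2 \<times> Sig0 (Suc 0) 2))
      \<subseteq> form.span (P_form T ` P0_index T (Suc 0) (Suc (Suc r)))"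
    by (intro form.span_minimal form.subspace_span)
  then show ?thesis using form_pair.linear_span_image[OF linear_rotation_J] assms by blast
qed

section \<open>The recursion on triangles\<close>

lemma subsimplices_triangle:
  "subsimplices T = {[T ! 0], [T ! Suc 0], [T ! 2], [T ! 0, T ! Suc 0], [T ! 0, T ! 2], [T ! Suc 0, T !
      2], T}"
proof -
  have "length T = 3" using T2 by (simp add: sdim_def)
  then obtain a b c where "T = [a, b, c]" by (auto simp: length_Suc_conv numeral_3_eq_3)
  then show ?thesis using set_subseqs_eq[of T] by (auto simp: subsimplices_def numeral_2_eq_2)
qed

text \<open>Vertices carry no 1-forms, so the three edges give everything that proper subsimplices
  contribute.\<close>

definition edge_part :: "nat \<Rightarrow> 'a form set" where
  "edge_part r = {form_scale (edge_sign a b) (edge_ext T i j a b) | i j a b. i < j \<and> j \<le> 2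
      \<and> a + b = r}"

definition edge_part_m :: "nat \<Rightarrow> 'a form set" where
  "edge_part_m r = {edge_ext_m T i j a b | i j a b. i < j \<and> j \<le> 2 \<and> a + b = r}"

lemma ex_pair_2: "(\<exists>i j. i < j \<and> j \<le> 2 \<and> P i j) \<longleftrightarrow> P 0 (Suc 0)
    \<or> P 0 2 \<or> P (Suc 0) (2::nat)"
  by (auto simp: numeral_2_eq_2 le_Suc_eq less_Suc_eq)

lemma AP_triangle_Suc: "AP B T (Suc 0) (Suc r) = edge_part (Suc r) \<union> ext_P T T (Suc 0) (Suc r) `
    AP0 B T (Suc 0) (Suc r)"
proof -
  have edge: "ext_P [T ! i, T ! j] T (Suc 0) (Suc r) ` AP0 B [T ! i, T ! j] (Suc 0) (Suc r) =
    {form_scale (edge_sign a b) (edge_ext T i j a b) | a b. a + b = Suc r}" if "i < j" "j \<le> 2" for i j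
    unfolding AP_edge_1[OF edge_of_simplex[OF T that(1) that(2)[folded T2]]]
    using image_sum_set[where r = "Suc r" and f = "ext_P [T ! i, T ! j] T (Suc 0) (Suc r)" and
       g = "\<lambda>a b. form_scale (edge_sign a b) (edge_form [T ! i, T ! j] a b)" and
       h = "\<lambda>a b. form_scale (edge_sign a b) (edge_ext T i j a b)"]
     ext_P_edge[OF T that(1) that(2)[folded T2]] by blast
  have "edge_part (Suc r) = {\<omega>. \<exists>i j. i < j \<and> j \<le> 2 \<and> \<omega> \<in>
      {form_scale (edge_sign a b) (edge_ext T i j a b) | a b. a + b = Suc r}}"
    unfolding edge_part_def by blast
  also have "\<dots> = (\<Union>F\<in>{[T ! 0, T ! Suc 0], [T ! 0, T ! 2], [T ! Suc 0, T ! 2]}. ext_P F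
      T (Suc 0) (Suc r) ` AP0 B F (Suc 0) (Suc r))"
    unfolding ex_pair_2 using edge[of 0 "Suc 0"] edge[of 0 2] edge[of "Suc 0" 2] by auto
  finally show ?thesis
    by (subst AP.simps) (auto simp: T2 subsimplices_triangle AP0_vertex_empty single_vertex)
qed

lemma APm_triangle_Suc: "APm B T (Suc 0) (Suc r) = edge_part_m r \<union> ext_Pm T T (Suc 0) (Suc r) `
    APm0 B T (Suc 0) (Suc r)"
proof -
  have edge: "ext_Pm [T ! i, T ! j] T (Suc 0) (Suc r) ` APm0 B [T ! i, T ! j] (Suc 0) (Suc r) =
    {edge_ext_m T i j a b | a b. a + b = r}" if "i < j" "j \<le> 2" for i j
    unfolding APm0_edge_1[OF edge_of_simplex[OF T that(1) that(2)[folded T2]]]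
    using image_sum_set[where r = r and f = "ext_Pm [T ! i, T ! j] T (Suc 0) (Suc r)" and
       g = "edge_form [T ! i, T ! j]" and h = "edge_ext_m T i j"]
     ext_Pm_edge[OF T that(1) that(2)[folded T2]] by blast
  have "edge_part_m r = {\<omega>. \<exists>i j. i < j \<and> j \<le> 2 \<and> \<omega> \<in>
      {edge_ext_m T i j a b | a b. a + b = r}}"
    unfolding edge_part_m_def by blast
  also have "\<dots> = (\<Union>F\<in>{[T ! 0, T ! Suc 0], [T ! 0, T ! 2], [T ! Suc 0, T ! 2]}. ext_Pm
      F T (Suc 0) (Suc r) ` APm0 B F (Suc 0) (Suc r))"
    unfolding ex_pair_2 using edge[of 0 "Suc 0"] edge[of 0 2] edge[of "Suc 0" 2] by auto
  finally show ?thesis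
    by (subst APm.simps) (auto simp: T2 subsimplices_triangle AP0_vertex_empty single_vertex)
qed

lemma AP0_triangle_low: "r < 2 \<Longrightarrow> AP0 B T (Suc 0) r = {}" "r < 2 \<Longrightarrow> APm0
    B T (Suc 0) r = {}"
  by (subst AP0.simps, simp add: T2) (subst APm0.simps, simp add: T2)

lemma AP0_triangle_eq: "AP0 B T (Suc 0) (Suc (Suc r)) = iso_J T (Suc 0) r ` APm B T (Suc 0) (Suc r)"
  by (subst AP0.simps) (simp add: T2 numeral_2_eq_2)

lemma APm0_triangle_eq: "APm0 B T (Suc 0) (Suc (Suc r)) = iso_I T (Suc 0) r ` AP B T (Suc 0) r"
  by (subst APm0.simps) (simp add: T2 numeral_2_eq_2)

text \<open>The span hypothesis allows the chosen isomorphism to be replaced by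
  \<open>rotation_I\<close>; \<open>bases_in_span\<close> discharges it.\<close>

lemma
  assumes AP: "AP B T (Suc 0) r \<subseteq> form.span (P_form T ` (multiindices r 2 \<times> Sig (Suc
      0) 2))"
  shows APm0_triangle: "APm0 B T (Suc 0) (Suc (Suc r)) = rotation_I T ` AP B T (Suc 0) r"
    and APm_triangle: "APm B T (Suc 0) (Suc (Suc r)) = edge_part_m (Suc r) \<union> rotation_I T ` AP B
        T (Suc 0) r"
proof -
  show eq: "APm0 B T (Suc 0) (Suc (Suc r)) = rotation_I T ` AP B T (Suc 0) r"
    unfolding APm0_triangle_eq using iso_I_triangle AP by (intro image_cong) auto
  have "ext_Pm T T (Suc 0) (Suc (Suc r)) ` rotation_I T ` AP B T (Suc 0) r = rotation_I T ` AP B T (Suc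
      0) r"
    using ext_Pm_self[OF T rotation_I_in_span] AP by (auto simp: image_image intro!: image_cong)
  then show "APm B T (Suc 0) (Suc (Suc r)) = edge_part_m (Suc r) \<union> rotation_I T ` AP B T (Suc 0) r"
    unfolding APm_triangle_Suc eq by simp
qed

lemma
  assumes APm: "APm B T (Suc 0) (Suc r) \<subseteq> form.span (Pm_form T ` (multiindices r 2 \<times>
      Sig0 (Suc 0) 2))"
  shows AP0_triangle: "AP0 B T (Suc 0) (Suc (Suc r)) = rotation_J T ` APm B T (Suc 0) (Suc r)"
    and AP_triangle: "AP B T (Suc 0) (Suc (Suc r)) = edge_part (Suc (Suc r)) \<union> rotation_J T `
        APm B T (Suc 0) (Suc r)"
proof -
  show eq: "AP0 B T (Suc 0) (Suc (Suc r)) = rotation_J T ` APm B T (Suc 0) (Suc r)"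
    unfolding AP0_triangle_eq using iso_J_triangle APm by (intro image_cong) auto
  have "ext_P T T (Suc 0) (Suc (Suc r)) ` rotation_J T ` APm B T (Suc 0) (Suc r) = rotation_J T ` APm B
      T (Suc 0) (Suc r)"
    using ext_P_self[OF T rotation_J_in_span] APm by (auto simp: image_image intro!: image_cong)
  then show "AP B T (Suc 0) (Suc (Suc r)) = edge_part (Suc (Suc r)) \<union> rotation_J T ` APm B T
      (Suc 0) (Suc r)"
    unfolding AP_triangle_Suc eq by simp
qed

lemma edge_part_in_span: "edge_part r \<subseteq> form.span (P_form T ` (multiindices r 2 \<times> Sig
    (Suc 0) 2))"
  using edge_ext_in_span[OF T] T2 by (auto simp: edge_part_def intro!: form.span_scale)

lemma edge_part_m_in_span: "edge_part_m r \<subseteq> form.span (Pm_form T ` (multiindices r 2 \<times>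
    Sig0 (Suc 0) 2))"
  using edge_ext_m_in_span[OF T] T2 by (auto simp: edge_part_m_def)

text \<open>For z = xi and z = xi^2 these are the two prescribed constant forms, the second one
  because xi^4 = xi.\<close>

definition eta :: "complex \<Rightarrow> 'a form" where
  "eta z = one_form T (\<lambda>k x. z ^ k)"

lemma AP_triangle_0: "AP B T (Suc 0) 0 = {eta xi, eta (xi\<^sup>2)}"
proof -
  have eq: "dbary T 0 + form_scale z (dbary T 1) + form_scale w (dbary T 2) = eta z" if "w = z\<^sup>2"
      for z w
    using that by (simp add: eta_def dbary_one_form T T2 one_form_ops) (rule one_form_triangle_cong; simp)
  have "xi = (xi\<^sup>2)\<^sup>2" using xi_cube by (simp add: eval_nat_numeral)
  then show ?thesis using eq[OF refl, of xi] eq[of xi "xi\<^sup>2"]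
    by (subst AP.simps) (simp only: T2 constant_basis_def, simp)
qed

lemma eta_in_span: "eta z \<in> form.span (P_form T ` (multiindices 0 2 \<times> Sig (Suc 0) 2))"
proof -
  have "eta z = form_scale 1 (P_form T (mi [0, 0, 0], [0])) + form_scale z (P_form T (mi [0, 0, 0],
      [Suc 0]))
     + form_scale (z\<^sup>2) (P_form T (mi [0, 0, 0], [2]))"
    by (simp only: eta_def P_form_triangle one_form_ops) (rule one_form_triangle_cong; simp)
  moreover have "P_form T (mi [0, 0, 0], [k]) \<in> form.span (P_form T ` (multiindices 0 2 \<times>
      Sig (Suc 0) 2))" if "k \<le> 2" for k
    using that by (intro form.span_base imageI) (auto simp: mi_in_multiindices Sig_1)
  ultimately show ?thesis by (simp add: form.span_add form.span_scale)
qed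

text \<open>Mutual induction: the coefficients of \<open>APm\<close> in degree r + 1 are monomials
  of degree r times Whitney forms, and each claim at r uses the other one at a smaller
  index.\<close>

lemma bases_in_span:
  "AP B T (Suc 0) r \<subseteq> form.span (P_form T ` (multiindices r 2 \<times> Sig (Suc 0) 2))"
  "APm B T (Suc 0) (Suc r) \<subseteq> form.span (Pm_form T ` (multiindices r 2 \<times> Sig0 (Suc 0) 2))"
proof (induction r rule: less_induct)
  case (less r)
  have m0: "Pm0_index T (Suc 0) (Suc r) \<subseteq> multiindices r 2 \<times> Sig0 (Suc 0) 2" for r
    by (auto simp: T2)
  have p0: "P0_index T (Suc 0) r \<subseteq> multiindices r 2 \<times> Sig (Suc 0) 2" for r
    by (auto simp: T2)
  {
    case 1
    show ?case
    proof (cases r)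
      case 0 then show ?thesis using eta_in_span by (simp add: AP_triangle_0)
    next
      case (Suc q)
      show ?thesis
      proof (cases q)
        case 0
        then show ?thesis unfolding Suc AP_triangle_Suc using AP0_triangle_low(1)[of 1]
            edge_part_in_span[of 1] by simp
      next
        case (Suc p)
        then have r: "r = Suc (Suc p)" using \<open>r = Suc q\<close> by simp
        have IH: "APm B T (Suc 0) (Suc p) \<subseteq> form.span (Pm_form T ` (multiindices p 2 \<times>
            Sig0 (Suc 0) 2))"
          using less(2)[of p] r by simp
        have "rotation_J T ` APm B T (Suc 0) (Suc p) \<subseteq> form.span (P_form T ` (multiindices r
            2 \<times> Sig (Suc 0) 2))"
          using rotation_J_in_span IH form.span_mono[OF image_mono[OF p0[of r], of "P_form T"]] r by blast
        then show ?thesis unfolding r AP_triangle[OF IH] using edge_part_in_span r by simp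
      qed
    qed
  next
    case 2
    show ?case
    proof (cases r)
      case 0
      then show ?thesis unfolding APm_triangle_Suc using AP0_triangle_low(2)[of 1]
          edge_part_m_in_span[of 0] by simp
    next
      case (Suc p)
      have IH: "AP B T (Suc 0) p \<subseteq> form.span (P_form T ` (multiindices p 2 \<times> Sig (Suc
          0) 2))"
        using less(1)[of p] Suc by simp
      have "rotation_I T ` AP B T (Suc 0) p \<subseteq> form.span (Pm_form T ` (multiindices r 2
          \<times> Sig0 (Suc 0) 2))"
        using rotation_I_in_span IH form.span_mono[OF image_mono[OF m0[of r], of "Pm_form T"]] Suc by blast
      then show ?thesis unfolding Suc APm_triangle[OF IH] using edge_part_m_in_span Suc by simp
    qed
  }
qed

end

section \<open>Pullback along vertex permutations\<close>

lemma pullback_scale: "pullback T S (form_scale c \<omega>) = form_scale c (pullback T S \<omega>)"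
  by (auto simp: pullback_def form_scale_def fun_eq_iff)

text \<open>Pullback turns dlambda_i into the differential with index \<open>\<pi> i\<close>;
  reindexing the sum puts \<open>inv \<pi>\<close> on the coefficients.\<close>

lemma pullback_one_form:
  assumes T: "ordered_simplex T" and \<pi>: "\<pi> permutes {..sdim T}"
  shows "pullback T (vertex_map T \<pi>) (one_form T c) = one_form T (\<lambda>i x. c (inv \<pi> i)
      (vertex_map T \<pi> x))"
proof (intro ext)
  fix x vs
  let ?S = "vertex_map T \<pi>" and ?D = "frechet_derivative (vertex_map T \<pi>) (at x)"
  show "pullback T ?S (one_form T c) x vs = one_form T (\<lambda>i x. c (inv \<pi> i) (?S x)) x vs"
  proof (cases "admissible T 1 x vs")
    case True
    then obtain v where v: "vs = [v]" "v \<in> tangent T" "x \<in> body T"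
      by (auto simp: admissible_def length_Suc_conv)
    have "admissible T 1 (?S x) [?D v]"
      using v vertex_map_in_body[OF T \<pi>] vertex_map_tangent[OF T \<pi>] by (simp add: admissible_def)
    then have "pullback T ?S (one_form T c) x vs = (\<Sum>i\<le>sdim T. c i (?S x) * of_real (dlam T i
        (?D v)))"
      using v by (simp add: pullback_def one_form_def)
    also have "\<dots> = (\<Sum>i\<le>sdim T. c (inv \<pi> (\<pi> i)) (?S x) * of_real (dlam T (\<pi>
        i) v))"
      using dlam_vertex_map[OF T \<pi> v(2)] permutes_inverses(2)[OF \<pi>] by simp
    also have "\<dots> = (\<Sum>i\<le>sdim T. c (inv \<pi> i) (?S x) * of_real (dlam T i v))"
      using sum.permute[OF \<pi>, of "\<lambda>i. c (inv \<pi> i) (?S x) * of_real (dlam T i v)"] by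
          (simp add: o_def)
    finally show ?thesis using True v by (simp add: one_form_def)
  next
    case False
    then show ?thesis by (auto simp: pullback_def one_form_def admissible_def)
  qed
qed

lemma vertex_map_inverse:
  assumes T: "ordered_simplex T" and \<pi>: "\<pi> permutes {..sdim T}" and x: "x \<in> body T"
  shows "vertex_map T \<pi> (vertex_map T (inv \<pi>) x) = x"
proof -
  note \<pi>' = permutes_inv[OF \<pi>]
  let ?y = "vertex_map T \<pi> (vertex_map T (inv \<pi>) x)"
  have y': "vertex_map T (inv \<pi>) x \<in> body T" using vertex_map_in_body[OF T \<pi>' x] .
  then have y: "?y \<in> body T" using vertex_map_in_body[OF T \<pi>] by blast
  have "bary T i ?y = bary T i x" if "i \<le> sdim T" for i
  proof -
    have "\<pi> i \<le> sdim T" using permutes_in_image[OF \<pi>, of i] that by simp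
    then show ?thesis
      using bary_vertex_map[OF T \<pi> y' that] bary_vertex_map[OF T \<pi>' x, of "\<pi> i"]
        permutes_inverses(2)[OF \<pi>] by simp
  qed
  then show ?thesis
    using affine_map_eq_bary_comb[OF T affine_map_id y] affine_map_eq_bary_comb[OF T affine_map_id x]
    by simp
qed

text \<open>Undoes a pullback; this is what makes the induced map on a family injective.\<close>

lemma pullback_inverse:
  assumes T: "ordered_simplex T" and \<pi>: "\<pi> permutes {..sdim T}"
  shows "pullback T (vertex_map T (inv \<pi>)) (pullback T (vertex_map T \<pi>) (one_form T c)) =
      one_form T c"
  unfolding pullback_one_form[OF T \<pi>] pullback_one_form[OF T permutes_inv[OF \<pi>]]
  by (rule one_form_cong[OF T])
    (auto simp: vertex_map_inverse[OF T \<pi>] permutes_inv_inv[OF \<pi>] permutes_inverses[OF \<pi>]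
        intro!: exI[of _ 0])

section \<open>Continuous one-forms\<close>

text \<open>Continuity transfers identities from the interior of T to its boundary, where lambda_0
  lambda_1 lambda_2 cannot be cancelled.\<close>

definition cont_forms :: "'a::euclidean_space list \<Rightarrow> 'a form set" where
  "cont_forms T = {one_form T c | c. \<forall>i. continuous_on (body T) (c i)}"

definition real_forms :: "'a::euclidean_space list \<Rightarrow> 'a form set" where
  "real_forms T = {one_form T c | c. \<forall>i x. c i x \<in> \<real>}"

lemma cont_formsE:
  assumes "\<omega> \<in> cont_forms T"
  obtains c where "\<omega> = one_form T c" "\<forall>i. continuous_on (body T) (c i)"
  using assms by (auto simp: cont_forms_def)

lemma one_form_in_cont_forms: "(\<And>i. continuous_on (body T) (c i)) \<Longrightarrow> one_form T c
    \<in> cont_forms T"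
  by (auto simp: cont_forms_def)

lemma one_form_in_real_forms: "(\<And>i x. c i x \<in> \<real>) \<Longrightarrow> one_form T c \<in>
    real_forms T"
  by (auto simp: real_forms_def)

lemma continuous_on_bary: "ordered_simplex T \<Longrightarrow> continuous_on S (bary T i)"
  by (rule affine_map_continuous[OF bary_spec(1)])

lemma cont_forms_scale: "\<omega> \<in> cont_forms T \<Longrightarrow> form_scale c \<omega> \<in>
    cont_forms T"
  by (erule cont_formsE) (auto simp: one_form_ops intro!: one_form_in_cont_forms continuous_intros)

text \<open>Moving from \<open>x\<close> towards the barycenter \<open>b\<close>, whose coordinates
  are all positive, makes all coordinates positive.\<close>

lemma interior_approx:
  assumes T: "ordered_simplex T" and x: "x \<in> body T"
  obtains y where "\<And>n. y n \<in> body T" "\<And>n i. i \<le> sdim T \<Longrightarrow> bary T i (y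
      n) > 0" "y \<longlonglongrightarrow> x"
proof -
  define b where "b = (\<Sum>i\<le>sdim T. (1 / real (Suc (sdim T))) *\<^sub>R T ! i)"
  have b: "b \<in> body T" unfolding b_def
    by (rule convex_sum[OF _ convex_body]) (auto simp: vertex_in_body[OF T] simp del: of_nat_Suc)
  define y where "y n = (1 - 1 / real (Suc n)) *\<^sub>R x + (1 / real (Suc n)) *\<^sub>R b" for n
  have bary_b: "bary T i b > 0" if "i \<le> sdim T" for i
  proof -
    have "bary T i b - bary T i 0 = (\<Sum>j\<le>sdim T. (1 / real (Suc (sdim T))) * (bary T i (T ! j)
        - bary T i 0))"
      unfolding b_def using linear_dlam[OF T, of i, unfolded dlam_def[abs_def]]
      by (simp only: linear_sum[of "\<lambda>v. bary T i v - bary T i 0"] linear_scale[of "\<lambda>v.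
          bary T i v - bary T i 0"] real_scaleR_def)
    then have "bary T i b = (\<Sum>j\<le>sdim T. (1 / real (Suc (sdim T))) * bary T i (T ! j))"
      by (simp add: right_diff_distrib sum_subtractf)
    also have "\<dots> = 1 / real (Suc (sdim T))"
      using that by (simp add: bary_spec(2)[OF T] if_distrib[of "\<lambda>c. _ * c"] cong: if_cong)
    finally show ?thesis by simp
  qed
  have "bary T i (y n) > 0" if i: "i \<le> sdim T" for i n
  proof -
    obtain g c where g: "linear g" "bary T i = (\<lambda>x. g x + c)" using affine_mapE[OF
        bary_spec(1)[OF T]] .
    have lin: "bary T i ((1 - s) *\<^sub>R x + s *\<^sub>R b) = (1 - s) * bary T i x + s * bary T i b" for s
      unfolding g(2) by (simp add: linear_add[OF g(1)] linear_scale[OF g(1)]) (simp add: algebra_simps)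
    have "bary T i (y n) = (1 - 1 / real (Suc n)) * bary T i x + (1 / real (Suc n)) * bary T i b"
      unfolding y_def by (rule lin)
    moreover have "(1 - 1 / real (Suc n)) * bary T i x \<ge> 0" using bary_nonneg[OF T x] by simp
    moreover have "(1 / real (Suc n)) * bary T i b > 0" using bary_b[OF i] by simp
    ultimately show ?thesis by linarith
  qed
  moreover have "y n \<in> body T" for n
    unfolding y_def using x b by (intro convexD[OF convex_body]) (auto simp: field_simps)
  moreover have "y \<longlonglongrightarrow> (1 - 0) *\<^sub>R x + 0 *\<^sub>R b"
    unfolding y_def[abs_def] by (intro tendsto_intros LIMSEQ_Suc[OF lim_1_over_n])
  ultimately show ?thesis using that[of y] by simp
qed

lemma continuous_eq_0_from_interior:
  fixes h :: "'a::euclidean_space \<Rightarrow> complex"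
  assumes T: "ordered_simplex T" and h: "continuous_on (body T) h" and x: "x \<in> body T"
    and 0: "\<And>y. y \<in> body T \<Longrightarrow> (\<And>i. i \<le> sdim T \<Longrightarrow> bary T
        i y > 0) \<Longrightarrow> h y = 0"
  shows "h x = 0"
proof -
  obtain y where y: "\<And>n. y n \<in> body T" "\<And>n i. i \<le> sdim T \<Longrightarrow> bary T i
      (y n) > 0" "y \<longlonglongrightarrow> x"
    using interior_approx[OF T x] by metis
  then have "(h \<circ> y) \<longlonglongrightarrow> h x" using h x unfolding
      continuous_on_sequentially by blast
  moreover have "h \<circ> y = (\<lambda>n. 0)" using 0 y by auto
  ultimately show ?thesis using LIMSEQ_unique tendsto_const by metis
qed

section \<open>Equivariance of the two operators under permutations of three vertices\<close>

lemma perm3_cases: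
  assumes "\<pi> permutes {..2::nat}"
  obtains a b c where "\<pi> 0 = a" "\<pi> (Suc 0) = b" "\<pi> 2 = c" "inv \<pi> a = 0" "inv \<pi> b =
      Suc 0" "inv \<pi> c = 2"
    "(a, b, c) \<in> {(0, Suc 0, 2), (0, 2, Suc 0), (Suc 0, 0, 2), (Suc 0, 2, 0), (2, 0, Suc 0), (2,
        Suc 0, 0)}"
proof (rule that[of "\<pi> 0" "\<pi> (Suc 0)" "\<pi> 2"])
  have m: "\<pi> 0 \<in> {0, Suc 0, 2}" "\<pi> (Suc 0) \<in> {0, Suc 0, 2}" "\<pi> 2 \<in> {0, Suc 0, 2}"
    using permutes_in_image[OF assms] by (auto simp: atMost_2)
  have "\<pi> 0 \<noteq> \<pi> (Suc 0)" "\<pi> 0 \<noteq> \<pi> 2" "\<pi> (Suc 0) \<noteq> \<pi> 2"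
    using permutes_inj[OF assms] by (simp_all add: inj_eq)
  with m show "(\<pi> 0, \<pi> (Suc 0), \<pi> 2) \<in> {(0, Suc 0, 2), (0, 2, Suc 0), (Suc 0, 0, 2),
      (Suc 0, 2, 0), (2, 0, Suc 0), (2, Suc 0, 0)}"
    by (elim insertE emptyE) simp_all
qed (simp_all add: permutes_inverses[OF assms])

context
  fixes T :: "'a::euclidean_space list"
  assumes T: "ordered_simplex T" and T2: "sdim T = 2"
begin

abbreviation pull :: "(nat \<Rightarrow> nat) \<Rightarrow> 'a form \<Rightarrow> 'a form" where
  "pull \<pi> \<equiv> pullback T (vertex_map T \<pi>)"

lemma pull_one_form:
  "\<pi> permutes {..2} \<Longrightarrow> pull \<pi> (one_form T c) = one_form T (\<lambda>i x. c (inv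
      \<pi> i) (vertex_map T \<pi> x))"
  by (rule pullback_one_form[OF T]) (simp add: T2)

lemma bary_vertex_map_2:
  "\<pi> permutes {..2} \<Longrightarrow> x \<in> body T \<Longrightarrow> i \<le> 2 \<Longrightarrow>
      bary T i (vertex_map T \<pi> x) = bary T (\<pi> i) x"
  by (rule bary_vertex_map[OF T]) (simp_all add: T2)

text \<open>The sign is chosen before the form: two eigenforms must receive the same sign, otherwise
  their eigenvalues could become equal.\<close>

definition commutes_up_to_sign :: "('a form \<Rightarrow> 'a form) \<Rightarrow> bool" where
  "commutes_up_to_sign L \<longleftrightarrow> (\<forall>\<pi>. \<pi> permutes {..2} \<longrightarrow>
     (\<exists>s\<in>{1, - 1}. \<forall>c. pull \<pi> (L (one_form T c)) = form_scale s (L (pull \<pi>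
         (one_form T c)))))"

lemma rotation_I_commutes: "commutes_up_to_sign (rotation_I T)"
  unfolding commutes_up_to_sign_def
proof (intro allI impI)
  fix \<pi> :: "nat \<Rightarrow> nat" assume \<pi>: "\<pi> permutes {..2}"
  obtain a b c where p: "\<pi> 0 = a" "\<pi> (Suc 0) = b" "\<pi> 2 = c" "inv \<pi> a = 0" "inv \<pi> b
      = Suc 0" "inv \<pi> c = 2"
    "(a, b, c) \<in> {(0, Suc 0, 2), (0, 2, Suc 0), (Suc 0, 0, 2), (Suc 0, 2, 0), (2, 0, Suc 0), (2,
        Suc 0, 0)}"
    using perm3_cases[OF \<pi>] .
  \<comment> \<open>The sign of the permutation: the listed triples are the even ones.\<close>
  let ?s = "if (a, b, c) \<in> {(0, Suc 0, 2), (Suc 0, 2, 0), (2, 0, Suc 0)} then 1 else - 1 :: complex"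
  have "pull \<pi> (rotation_I T (one_form T c)) = form_scale ?s (rotation_I T (pull \<pi> (one_form T
      c)))" for c
    unfolding rotation_I_one_form[OF T T2] pull_one_form[OF \<pi>] one_form_ops
    by (rule one_form_triangle_cong[OF T T2])
      (use p in \<open>elim insertE emptyE; simp add: bary_vertex_map_2[OF \<pi>] algebra_simps\<close>)+
  then show "\<exists>s\<in>{1, - 1}. \<forall>c. pull \<pi> (rotation_I T (one_form T c)) = form_scale
      s (rotation_I T (pull \<pi> (one_form T c)))"
    by (intro bexI[of _ ?s]) auto
qed

lemma rotation_J_commutes: "commutes_up_to_sign (rotation_J T)"
  unfolding commutes_up_to_sign_def
proof (intro allI impI)
  fix \<pi> :: "nat \<Rightarrow> nat" assume \<pi>: "\<pi> permutes {..2}"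
  obtain a b c where p: "\<pi> 0 = a" "\<pi> (Suc 0) = b" "\<pi> 2 = c" "inv \<pi> a = 0" "inv \<pi> b
      = Suc 0" "inv \<pi> c = 2"
    "(a, b, c) \<in> {(0, Suc 0, 2), (0, 2, Suc 0), (Suc 0, 0, 2), (Suc 0, 2, 0), (2, 0, Suc 0), (2,
        Suc 0, 0)}"
    using perm3_cases[OF \<pi>] .
  let ?s = "if (a, b, c) \<in> {(0, Suc 0, 2), (Suc 0, 2, 0), (2, 0, Suc 0)} then 1 else - 1 :: complex"
  have "pull \<pi> (rotation_J T (one_form T c)) = form_scale ?s (rotation_J T (pull \<pi> (one_form T
      c)))" for c
    unfolding rotation_J_one_form[OF T T2] pull_one_form[OF \<pi>] one_form_ops
    by (rule one_form_triangle_cong[OF T T2])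
      (use p in \<open>elim insertE emptyE; simp add: bary_vertex_map_2[OF \<pi>] atMost_2
          algebra_simps\<close>)+
  then show "\<exists>s\<in>{1, - 1}. \<forall>c. pull \<pi> (rotation_J T (one_form T c)) = form_scale
      s (rotation_J T (pull \<pi> (one_form T c)))"
    by (intro bexI[of _ ?s]) auto
qed

end

section \<open>Symmetric families\<close>

context
  fixes T :: "'a::euclidean_space list"
  assumes T: "ordered_simplex T" and T2: "sdim T = 2"
begin

text \<open>A strengthening of invariance that passes to images and unions. It asks only for some
  target of each pullback; the exclusion of proportional pairs then supplies the bijection.\<close>

definition symmetric_family :: "complex set \<Rightarrow> 'a form set \<Rightarrow> bool" where
  "symmetric_family S W \<longleftrightarrow> finite W \<and> W \<subseteq> cont_forms T \<and>
     (\<forall>\<omega>\<in>W. \<forall>\<eta>\<in>W. \<forall>c. c \<noteq> 0 \<longrightarrow>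
         \<omega> = form_scale c \<eta> \<longrightarrow> \<omega> = \<eta>) \<and>
     (\<forall>\<pi> \<omega>. \<pi> permutes {..2} \<longrightarrow> \<omega> \<in> W \<longrightarrow>
        (\<exists>u\<in>S. cmod u = 1 \<and> (\<exists>\<eta>\<in>W. pullback T (vertex_map T \<pi>)
            \<omega> = form_scale u \<eta>)))"

lemma symmetric_familyD:
  assumes "symmetric_family S W"
  shows "finite W" "W \<subseteq> cont_forms T"
    "\<omega> \<in> W \<Longrightarrow> \<eta> \<in> W \<Longrightarrow> c \<noteq> 0 \<Longrightarrow>
        \<omega> = form_scale c \<eta> \<Longrightarrow> \<omega> = \<eta>"
    "\<pi> permutes {..2} \<Longrightarrow> \<omega> \<in> W \<Longrightarrow>
      \<exists>u\<in>S. cmod u = 1 \<and> (\<exists>\<eta>\<in>W. pullback T (vertex_map T \<pi>)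
          \<omega> = form_scale u \<eta>)"
  using assms unfolding symmetric_family_def by blast+

lemma symmetric_family_empty: "symmetric_family S {}"
  by (simp add: symmetric_family_def)

lemma pull_inverse:
  assumes "\<pi> permutes {..2}" "\<omega> \<in> cont_forms T"
  shows "pullback T (vertex_map T (inv \<pi>)) (pullback T (vertex_map T \<pi>) \<omega>) = \<omega>"
proof -
  obtain c where "\<omega> = one_form T c" using cont_formsE[OF assms(2)] .
  then show ?thesis using pullback_inverse[OF T, of \<pi> c] assms(1) by (simp add: T2)
qed

lemma symmetric_family_invariant:
  assumes W: "symmetric_family S W" shows "invariant_set S T W"
  unfolding invariant_set_def T2
proof (intro conjI allI impI)
  show "finite W" using symmetric_familyD(1)[OF W] .
  fix \<pi> :: "nat \<Rightarrow> nat" assume \<pi>: "\<pi> permutes {..2}"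
  let ?pull = "pullback T (vertex_map T \<pi>)"
  have "\<forall>\<omega>\<in>W. \<exists>u \<eta>. u \<in> S \<and> cmod u = 1 \<and> \<eta> \<in> W
      \<and> ?pull \<omega> = form_scale u \<eta>"
    using symmetric_familyD(4)[OF W \<pi>] by blast
  then obtain c where "\<forall>\<omega>\<in>W. \<exists>\<eta>. c \<omega> \<in> S \<and> cmod (c
      \<omega>) = 1 \<and> \<eta> \<in> W \<and> ?pull \<omega> = form_scale (c \<omega>) \<eta>"
    by (rule bchoice[THEN exE])
  then obtain \<tau> where c: "\<forall>\<omega>\<in>W. c \<omega> \<in> S \<and> cmod (c \<omega>) = 1
      \<and> \<tau> \<omega> \<in> W \<and> ?pull \<omega> = form_scale (c \<omega>) (\<tau> \<omega>)"
    by (rule bchoice[THEN exE])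
  \<comment> \<open>Equal targets make the two pullbacks proportional; undoing the pullback makes
    the forms themselves proportional, hence equal.\<close>
  have "inj_on \<tau> W"
  proof (rule inj_onI)
    fix \<omega> \<eta> assume *: "\<omega> \<in> W" "\<eta> \<in> W" "\<tau> \<omega> = \<tau> \<eta>"
    have nz: "c \<omega> \<noteq> 0" "c \<eta> \<noteq> 0" using c *(1,2) by force+
    have "?pull \<omega> = form_scale (c \<omega> / c \<eta>) (?pull \<eta>)"
      using c *(1,2) nz by (simp add: \<open>\<tau> \<omega> = \<tau> \<eta>\<close>)
    then have "?pull \<omega> = ?pull (form_scale (c \<omega> / c \<eta>) \<eta>)" by (simp add:
        pullback_scale)
    then have "pullback T (vertex_map T (inv \<pi>)) (?pull \<omega>) = 
        pullback T (vertex_map T (inv \<pi>)) (?pull (form_scale (c \<omega> / c \<eta>) \<eta>))" by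
            (rule arg_cong)
    then have "\<omega> = form_scale (c \<omega> / c \<eta>) \<eta>"
      using pull_inverse[OF \<pi>, of \<omega>] pull_inverse[OF \<pi> cont_forms_scale, of \<eta> "c
          \<omega> / c \<eta>"]
        subsetD[OF symmetric_familyD(2)[OF W]] *(1,2) by simp
    then show "\<omega> = \<eta>" using symmetric_familyD(3)[OF W *(1,2), of "c \<omega> / c \<eta>"]
        nz by simp
  qed
  then have "bij_betw \<tau> W W"
    using c symmetric_familyD(1)[OF W] endo_inj_surj[of W \<tau>] by (auto simp: bij_betw_def
        image_subset_iff)
  then show "\<exists>\<tau> c. bij_betw \<tau> W W \<and> (\<forall>\<omega>\<in>W. c \<omega> \<in> S
      \<and> cmod (c \<omega>) = 1 \<and> ?pull \<omega> = form_scale (c \<omega>) (\<tau> \<omega>))"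
    using c by blast
qed

definition symmetry_operator :: "('a form \<Rightarrow> 'a form) \<Rightarrow> bool" where
  "symmetry_operator L \<longleftrightarrow> Vector_Spaces.linear form_scale form_scale L \<and>
      commutes_up_to_sign T L \<and>
     L ` cont_forms T \<subseteq> cont_forms T \<and> inj_on L (cont_forms T) \<and> L ` real_forms T
         \<subseteq> real_forms T"

lemma symmetry_operatorD:
  assumes "symmetry_operator L"
  shows "Vector_Spaces.linear form_scale form_scale L" "L (form_scale c \<omega>) = form_scale c (L
      \<omega>)"
    "\<omega> \<in> cont_forms T \<Longrightarrow> L \<omega> \<in> cont_forms T" "inj_on L (cont_forms T)"
    "\<omega> \<in> real_forms T \<Longrightarrow> L \<omega> \<in> real_forms T"
    "\<pi> permutes {..2} \<Longrightarrow> \<exists>s\<in>{1, - 1}. \<forall>\<omega>\<in>cont_forms T.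
       pullback T (vertex_map T \<pi>) (L \<omega>) = form_scale s (L (pullback T (vertex_map T \<pi>)
           \<omega>))"
proof -
  note L = assms[unfolded symmetry_operator_def]
  show lin: "Vector_Spaces.linear form_scale form_scale L" and "inj_on L (cont_forms T)"
    using L by simp_all
  show "L (form_scale c \<omega>) = form_scale c (L \<omega>)" by (rule form_pair.linear_scale[OF lin])
  show "L \<omega> \<in> cont_forms T" if "\<omega> \<in> cont_forms T" using L that by (simp add:
      image_subset_iff)
  show "L \<omega> \<in> real_forms T" if "\<omega> \<in> real_forms T" using L that by (simp add:
      image_subset_iff)
  assume "\<pi> permutes {..2}"
  then obtain s where "s \<in> {1, - 1}"
    "\<forall>c. pullback T (vertex_map T \<pi>) (L (one_form T c)) = form_scale s (L (pullback T
        (vertex_map T \<pi>) (one_form T c)))"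
    using L unfolding commutes_up_to_sign_def[OF T T2] by meson
  then show "\<exists>s\<in>{1, - 1}. \<forall>\<omega>\<in>cont_forms T.
       pullback T (vertex_map T \<pi>) (L \<omega>) = form_scale s (L (pullback T (vertex_map T \<pi>)
           \<omega>))"
    by (intro bexI[of _ s]) (auto simp: cont_forms_def)
qed

text \<open>Injectivity on continuous forms keeps distinct elements non-proportional, and closure of
  \<open>S\<close> under negation absorbs the sign with which \<open>L\<close> commutes.\<close>

lemma symmetric_family_image:
  assumes L: "symmetry_operator L" and W: "symmetric_family S W" and S: "\<And>c. c \<in> S
      \<Longrightarrow> - c \<in> S"
  shows "symmetric_family S (L ` W)"
  unfolding symmetric_family_def
proof (intro conjI ballI allI impI)
  note C = symmetric_familyD(2)[OF W]
  show "finite (L ` W)" using symmetric_familyD(1)[OF W] by simp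
  show "L ` W \<subseteq> cont_forms T" using C symmetry_operatorD(3)[OF L] by blast
  show "\<omega> = \<eta>" if w: "\<omega> \<in> L ` W" "\<eta> \<in> L ` W" "c \<noteq> 0" "\<omega> =
      form_scale c \<eta>" for \<omega> \<eta> c
  proof -
    obtain \<omega>' \<eta>' where e: "\<omega> = L \<omega>'" "\<eta> = L \<eta>'" "\<omega>' \<in> W"
        "\<eta>' \<in> W" using w by blast
    then have "L \<omega>' = L (form_scale c \<eta>')" using w by (simp add: symmetry_operatorD(2)[OF L])
    then have "\<omega>' = form_scale c \<eta>'"
      using inj_onD[OF symmetry_operatorD(4)[OF L]] subsetD[OF C] e cont_forms_scale[of \<eta>' T c] by simp
    then show ?thesis using symmetric_familyD(3)[OF W e(3,4) w(3)] e by simp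
  qed
  fix \<pi> :: "nat \<Rightarrow> nat" and \<omega> assume \<pi>: "\<pi> permutes {..2}" and "\<omega>
      \<in> L ` W"
  then obtain \<omega>' where w: "\<omega> = L \<omega>'" "\<omega>' \<in> W" by blast
  obtain s where s: "s \<in> {1, - 1}" "\<forall>\<omega>\<in>cont_forms T.
       pullback T (vertex_map T \<pi>) (L \<omega>) = form_scale s (L (pullback T (vertex_map T \<pi>)
           \<omega>))"
    using symmetry_operatorD(6)[OF L \<pi>] by blast
  obtain u \<eta> where h: "u \<in> S" "cmod u = 1" "\<eta> \<in> W" "pullback T (vertex_map T \<pi>)
      \<omega>' = form_scale u \<eta>"
    using symmetric_familyD(4)[OF W \<pi> w(2)] by blast
  have "pullback T (vertex_map T \<pi>) \<omega> = form_scale (s * u) (L \<eta>)"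
    using s(2) w C h(4) by (simp add: subset_iff symmetry_operatorD(2)[OF L])
  moreover have "s * u \<in> S" "cmod (s * u) = 1" using s(1) h(1,2) S by (auto simp: norm_mult)
  ultimately show "\<exists>u\<in>S. cmod u = 1 \<and> (\<exists>\<eta>\<in>L ` W. pullback T
      (vertex_map T \<pi>) \<omega> = form_scale u \<eta>)"
    using h(3) by blast
qed

section \<open>Tangential traces on the edges and cancellation of the interior factor\<close>

definition edge_trace :: "nat \<Rightarrow> nat \<Rightarrow> real \<Rightarrow> 'a form \<Rightarrow>
    complex" where
  "edge_trace i j t \<omega> = \<omega> ((1 - t) *\<^sub>R T ! i + t *\<^sub>R T ! j) [T ! j - T ! i]"

definition traceless :: "'a form \<Rightarrow> bool" where
  "traceless \<omega> \<longleftrightarrow> (\<forall>i j t. i < j \<longrightarrow> j \<le> 2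
      \<longrightarrow> 0 < t \<longrightarrow> t < 1 \<longrightarrow> edge_trace i j t \<omega> = 0)"

lemma edge_trace_scale: "edge_trace i j t (form_scale c \<omega>) = c * edge_trace i j t \<omega>"
  by (simp add: edge_trace_def form_scale_apply)

lemma traceless_scale: "c \<noteq> 0 \<Longrightarrow> traceless (form_scale c \<omega>)
    \<longleftrightarrow> traceless \<omega>"
  by (simp add: traceless_def edge_trace_scale)

lemma edge_trace_one_form:
  assumes "i \<le> 2" "j \<le> 2" "0 < t" "t < 1"
  shows "edge_trace i j t (one_form T c) =
    c j ((1 - t) *\<^sub>R T ! i + t *\<^sub>R T ! j) - c i ((1 - t) *\<^sub>R T ! i + t *\<^sub>R T ! j)"
  unfolding edge_trace_def using assms edge_point_in_body[OF T, of i j t]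
  by (subst one_form_triangle_edge[OF T T2]) (simp_all add: T2)

text \<open>Nonzero scalars preserve \<open>traceless\<close>, so no element of one family is a
  nonzero multiple of an element of the other.\<close>

lemma symmetric_family_Un:
  assumes V: "symmetric_family S V" and W: "symmetric_family S W"
    and V_trace: "\<And>\<omega>. \<omega> \<in> V \<Longrightarrow> \<not> traceless \<omega>" and
        W_trace: "\<And>\<omega>. \<omega> \<in> W \<Longrightarrow> traceless \<omega>"
  shows "symmetric_family S (V \<union> W)"
  unfolding symmetric_family_def
proof (intro conjI ballI allI impI)
  show "finite (V \<union> W)" "V \<union> W \<subseteq> cont_forms T"
    using symmetric_familyD(1,2)[OF V] symmetric_familyD(1,2)[OF W] by auto
  show "\<omega> = \<eta>" if "\<omega> \<in> V \<union> W" "\<eta> \<in> V \<union> W" "c \<noteq> 0"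
      "\<omega> = form_scale c \<eta>" for \<omega> \<eta> c
  proof -
    have "traceless \<omega> \<longleftrightarrow> traceless \<eta>" using traceless_scale that(3,4) by simp
    then show ?thesis
      using that V_trace W_trace symmetric_familyD(3)[OF V, of \<omega> \<eta> c]
          symmetric_familyD(3)[OF W, of \<omega> \<eta> c] by blast
  qed
  show "\<exists>u\<in>S. cmod u = 1 \<and> (\<exists>\<eta>\<in>V \<union> W. pullback T (vertex_map T
      \<pi>) \<omega> = form_scale u \<eta>)"
    if "\<pi> permutes {..2}" "\<omega> \<in> V \<union> W" for \<pi> \<omega>
    using that symmetric_familyD(4)[OF V, of \<pi> \<omega>] symmetric_familyD(4)[OF W, of \<pi>
        \<omega>] by blast
qed

text \<open>On an edge the coordinate of the opposite vertex is 0, and it is a factor of both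
  coefficients in the trace. The exception is \<open>rotation_J\<close> on the edge opposite to
  vertex 0: there the trace is w_1 + w_2 = - w_0, and w_0 contains lambda_0.\<close>

lemma rotations_traceless: "traceless (rotation_I T (one_form T c))" "traceless (rotation_J T (one_form
    T c))"
proof -
  have *: "bary T k ((1 - t) *\<^sub>R T ! i + t *\<^sub>R T ! j) = (if i = k then 1 - t else 0) + (if
      j = k then t else 0)"
    if "i \<le> 2" "j \<le> 2" for i j k t
    using bary_edge_point[OF T, of i j k t] that by (simp add: T2)
  have ij: "i = 0 \<and> j = Suc 0 \<or> i = 0 \<and> j = 2 \<or> i = Suc 0 \<and> j = 2" if "i < j" "j
      \<le> 2" for i j :: nat
    using that by linarith
  have "edge_trace i j t (rotation_I T (one_form T c)) = 0 \<and> edge_trace i j t (rotation_J T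
      (one_form T c)) = 0"
    if t: "i < j" "j \<le> 2" "0 < t" "t < 1" for i j t
  proof -
    define y where "y = (1 - t) *\<^sub>R T ! i + t *\<^sub>R T ! j"
    have b: "bary T k y = (if i = k then 1 - t else 0) + (if j = k then t else 0)" for k
      using * t unfolding y_def by simp
    have E: "edge_trace i j t (one_form T d) = d j y - d i y" for d
      using t unfolding y_def by (intro edge_trace_one_form) auto
    show ?thesis
      unfolding rotation_I_one_form[OF T T2] rotation_J_one_form[OF T T2] E
      using ij[OF t(1,2)] by (elim disjE conjE) (simp_all add: b atMost_2 algebra_simps)
  qed
  then show "traceless (rotation_I T (one_form T c))" "traceless (rotation_J T (one_form T c))"
    by (simp_all add: traceless_def)
qed

text \<open>The common factor is nonzero in the interior; continuity extends the equality of
  coefficient differences to all of T.\<close>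

lemma cont_forms_cancel:
  assumes c: "\<And>i. continuous_on (body T) (c i)" and d: "\<And>i. continuous_on (body T) (d i)"
    and eq: "one_form T (\<lambda>k x. of_real (bary T 0 x * bary T 1 x * bary T 2 x) * c k x) =
      one_form T (\<lambda>k x. of_real (bary T 0 x * bary T 1 x * bary T 2 x) * d k x)"
  shows "one_form T c = one_form T d"
proof -
  have "c i x - c 0 x - (d i x - d 0 x) = 0" if i: "i \<le> 2" and x: "x \<in> body T" for i x
  proof (rule continuous_eq_0_from_interior[OF T _ x])
    show "continuous_on (body T) (\<lambda>x. c i x - c 0 x - (d i x - d 0 x))" by (intro
        continuous_intros c d)
    fix y assume y: "y \<in> body T" and pos: "\<And>i. i \<le> sdim T \<Longrightarrow> bary T i y > 0"
    let ?m = "complex_of_real (bary T 0 y * bary T 1 y * bary T 2 y)"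
    have "?m \<noteq> 0" using pos[of 0] pos[of 1] pos[of 2] by (simp add: T2)
    moreover have "?m * c i y - ?m * c 0 y = ?m * d i y - ?m * d 0 y"
      using arg_cong[OF eq, of "\<lambda>\<omega>. \<omega> y [T ! i - T ! 0]"] i y
      by (simp add: one_form_triangle_edge[OF T T2])
    then have "?m * (c i y - c 0 y - (d i y - d 0 y)) = 0" by (simp add: algebra_simps)
    ultimately show "c i y - c 0 y - (d i y - d 0 y) = 0" by simp
  qed
  from this[of "Suc 0"] this[of 2] show ?thesis
    by (intro one_form_triangle_cong[OF T T2]) simp_all
qed

lemma symmetry_operator_rotation_I: "symmetry_operator (rotation_I T)"
  unfolding symmetry_operator_def
proof (intro conjI linear_rotation_I rotation_I_commutes T T2)
  show "rotation_I T ` cont_forms T \<subseteq> cont_forms T"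
  proof clarify
    fix \<omega> assume "\<omega> \<in> cont_forms T"
    then obtain c where c: "\<omega> = one_form T c" "\<forall>i. continuous_on (body T) (c i)"
      using cont_formsE[OF \<open>\<omega> \<in> cont_forms T\<close>] by blast
    show "rotation_I T \<omega> \<in> cont_forms T"
      unfolding c(1) rotation_I_one_form[OF T T2]
    proof (rule one_form_in_cont_forms, goal_cases)
      case (1 i)
      show ?case
        by (cases "i = 0"; cases "i = 1"; cases "i = 2"; simp;
            intro continuous_intros continuous_on_of_real continuous_on_bary[OF T] c(2)[rule_format])
    qed
  qed
  show "rotation_I T ` real_forms T \<subseteq> real_forms T"
  proof clarify
    fix \<omega> assume "\<omega> \<in> real_forms T"
    then obtain c where c: "\<omega> = one_form T c" "\<forall>i x. c i x \<in> \<real>" unfolding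
        real_forms_def by blast
    show "rotation_I T \<omega> \<in> real_forms T"
      unfolding c(1) rotation_I_one_form[OF T T2]
    proof (rule one_form_in_real_forms, goal_cases)
      case (1 i x)
      show ?case
        by (cases "i = 0"; cases "i = 1"; cases "i = 2"; simp del: of_real_mult;
            intro Reals_mult Reals_diff Reals_minus sum_in_Reals Reals_of_real c(2)[rule_format])
    qed
  qed
  show "inj_on (rotation_I T) (cont_forms T)"
  proof (rule inj_onI)
    fix \<omega> \<eta> assume "\<omega> \<in> cont_forms T" "\<eta> \<in> cont_forms T" and eq:
        "rotation_I T \<omega> = rotation_I T \<eta>"
    obtain c where c: "\<omega> = one_form T c" "\<forall>i. continuous_on (body T) (c i)"
      using cont_formsE[OF \<open>\<omega> \<in> cont_forms T\<close>] by blast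
    obtain d where d: "\<eta> = one_form T d" "\<forall>i. continuous_on (body T) (d i)"
      using cont_formsE[OF \<open>\<eta> \<in> cont_forms T\<close>] by blast
    show "\<omega> = \<eta>" unfolding c(1) d(1)
    proof (rule cont_forms_cancel)
      show "one_form T (\<lambda>k x. of_real (bary T 0 x * bary T 1 x * bary T 2 x) * c k x) =
          one_form T (\<lambda>k x. of_real (bary T 0 x * bary T 1 x * bary T 2 x) * d k x)"
        using arg_cong[OF eq, of "rotation_J T"] unfolding c(1) d(1) rotation_J_I[OF T T2] .
    qed (use c d in simp_all)
  qed
qed

lemma symmetry_operator_rotation_J: "symmetry_operator (rotation_J T)"
  unfolding symmetry_operator_def
proof (intro conjI linear_rotation_J rotation_J_commutes T T2)
  show "rotation_J T ` cont_forms T \<subseteq> cont_forms T"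
  proof clarify
    fix \<omega> assume "\<omega> \<in> cont_forms T"
    then obtain c where c: "\<omega> = one_form T c" "\<forall>i. continuous_on (body T) (c i)"
      using cont_formsE[OF \<open>\<omega> \<in> cont_forms T\<close>] by blast
    show "rotation_J T \<omega> \<in> cont_forms T"
      unfolding c(1) rotation_J_one_form[OF T T2]
    proof (rule one_form_in_cont_forms, goal_cases)
      case (1 i)
      show ?case
        by (cases "i = 0"; cases "i = 1"; cases "i = 2"; simp;
            intro continuous_intros continuous_on_of_real continuous_on_bary[OF T] c(2)[rule_format])
    qed
  qed
  show "rotation_J T ` real_forms T \<subseteq> real_forms T"
  proof clarify
    fix \<omega> assume "\<omega> \<in> real_forms T"
    then obtain c where c: "\<omega> = one_form T c" "\<forall>i x. c i x \<in> \<real>" unfolding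
        real_forms_def by blast
    show "rotation_J T \<omega> \<in> real_forms T"
      unfolding c(1) rotation_J_one_form[OF T T2]
    proof (rule one_form_in_real_forms, goal_cases)
      case (1 i x)
      show ?case
        by (cases "i = 0"; cases "i = 1"; cases "i = 2"; simp del: of_real_mult;
            intro Reals_mult Reals_diff Reals_minus sum_in_Reals Reals_of_real c(2)[rule_format])
    qed
  qed
  show "inj_on (rotation_J T) (cont_forms T)"
  proof (rule inj_onI)
    fix \<omega> \<eta> assume "\<omega> \<in> cont_forms T" "\<eta> \<in> cont_forms T" and eq:
        "rotation_J T \<omega> = rotation_J T \<eta>"
    obtain c where c: "\<omega> = one_form T c" "\<forall>i. continuous_on (body T) (c i)"
      using cont_formsE[OF \<open>\<omega> \<in> cont_forms T\<close>] by blast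
    obtain d where d: "\<eta> = one_form T d" "\<forall>i. continuous_on (body T) (d i)"
      using cont_formsE[OF \<open>\<eta> \<in> cont_forms T\<close>] by blast
    show "\<omega> = \<eta>" unfolding c(1) d(1)
    proof (rule cont_forms_cancel)
      show "one_form T (\<lambda>k x. of_real (bary T 0 x * bary T 1 x * bary T 2 x) * c k x) =
          one_form T (\<lambda>k x. of_real (bary T 0 x * bary T 1 x * bary T 2 x) * d k x)"
        using arg_cong[OF eq, of "rotation_I T"] unfolding c(1) d(1) rotation_I_J[OF T T2] .
    qed (use c d in simp_all)
  qed
qed

end

section \<open>The edge parts as symmetric families\<close>

context
  fixes T :: "'a::euclidean_space list"
  assumes T: "ordered_simplex T" and T2: "sdim T = 2"
begin

text \<open>Common argument for both kinds of edge forms. Reversing an edge swaps the exponents and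
  changes the sign of \<open>e\<close>, so the factor \<open>s\<close> has to be symmetric in a and
  b for the family to be closed up to sign.\<close>

lemma edge_family:
  fixes e :: "nat \<Rightarrow> nat \<Rightarrow> nat \<Rightarrow> nat \<Rightarrow> 'a form" and s ::
      "nat \<Rightarrow> nat \<Rightarrow> complex" and r :: nat
  assumes S: "1 \<in> S" "- 1 \<in> S"
    and s: "\<And>a b. s a b \<in> {1, - 1}" "\<And>a b. s a b = s b a"
    and cont: "\<And>i j a b. e i j a b \<in> cont_forms T"
    and anti: "\<And>i j a b. e j i b a = - e i j a b"
    and pull: "\<And>\<pi> i j a b. \<pi> permutes {..2} \<Longrightarrow> i \<le> 2 \<Longrightarrow>
        j \<le> 2 \<Longrightarrow>
      pullback T (vertex_map T \<pi>) (e i j a b) = e (\<pi> i) (\<pi> j) a b"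
    and own: "\<And>i j a b t. i < j \<Longrightarrow> j \<le> 2 \<Longrightarrow> a + b = r
        \<Longrightarrow> 0 < t \<Longrightarrow> t < 1 \<Longrightarrow>
      edge_trace T i j t (e i j a b) = of_real ((1 - t) ^ a * t ^ b)"
    and other: "\<And>i j k l a b t. i < j \<Longrightarrow> j \<le> 2 \<Longrightarrow> k < l
        \<Longrightarrow> l \<le> 2 \<Longrightarrow> (k, l) \<noteq> (i, j) \<Longrightarrow> 0 < t
            \<Longrightarrow> t < 1 \<Longrightarrow>
      edge_trace T k l t (e i j a b) = 0"
  defines "W \<equiv> {form_scale (s a b) (e i j a b) | i j a b. i < j \<and> j \<le> 2 \<and> a + b = r}"
  shows "symmetric_family T S W" and "\<And>\<omega>. \<omega> \<in> W \<Longrightarrow> \<not>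
      traceless T \<omega>"
proof -
  have s0: "s a b \<noteq> 0" for a b using s(1)[of a b] by auto
  show "\<not> traceless T \<omega>" if "\<omega> \<in> W" for \<omega>
  proof -
    obtain i j a b where *: "\<omega> = form_scale (s a b) (e i j a b)" "i < j" "j \<le> 2" "a + b = r"
      using \<open>\<omega> \<in> W\<close> unfolding W_def by blast
    \<comment> \<open>At the midpoint the trace on the own edge is 2^(-r) up to sign, hence
      nonzero.\<close>
    have "edge_trace T i j (1 / 2) \<omega> \<noteq> 0"
      using own[OF *(2-4), of "1 / 2"] s0 by (simp add: *(1) edge_trace_scale[OF T T2])
    then show ?thesis using *(2,3) unfolding traceless_def[OF T T2] by force
  qed
  have "W \<subseteq> (\<lambda>(i, j, a, b). form_scale (s a b) (e i j a b)) ` ({..2} \<times> {..2}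
      \<times> {..r} \<times> {..r})"
  proof
    fix \<omega> assume "\<omega> \<in> W"
    then obtain i j a b where *: "\<omega> = form_scale (s a b) (e i j a b)" "i < j" "j \<le> 2" "a + b = r"
      unfolding W_def by blast
    then show "\<omega> \<in> (\<lambda>(i, j, a, b). form_scale (s a b) (e i j a b)) ` ({..2} \<times>
        {..2} \<times> {..r} \<times> {..r})"
      by (intro image_eqI[of _ _ "(i, j, a, b)"]) auto
  qed
  then have fin: "finite W" by (rule finite_subset) simp
  have uniq: "\<omega> = \<eta>" if w: "\<omega> \<in> W" "\<eta> \<in> W" "c \<noteq> 0" "\<omega> =
      form_scale c \<eta>" for \<omega> \<eta> c
  proof -
    obtain i j a b where w1: "\<omega> = form_scale (s a b) (e i j a b)" "i < j" "j \<le> 2" "a + b = r"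
      using w(1) unfolding W_def by blast
    obtain k l a' b' where w2: "\<eta> = form_scale (s a' b') (e k l a' b')" "k < l" "l \<le> 2" "a' +
        b' = r"
      using w(2) unfolding W_def by blast
    have tr: "s a b * of_real ((1 - t) ^ a * t ^ b) = c * (s a' b' * edge_trace T i j t (e k l a' b'))"
      if "0 < t" "t < 1" for t
      using arg_cong[OF w(4), of "edge_trace T i j t"] own[OF w1(2-4) that]
      by (simp add: w1(1) w2(1) edge_trace_scale[OF T T2] del: form.scale_scale)
    have "edge_trace T i j (1 / 2) (e k l a' b') \<noteq> 0" using tr[of "1 / 2"] s0[of a b] by auto
    \<comment> \<open>A form from another edge would have zero trace here, so both forms belong to
      the same edge.\<close>
    then have kl: "k = i" "l = j" using other[OF w2(2,3) w1(2,3), of "1 / 2" a' b'] by fastforce+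
    have tr': "s a b * of_real ((1 - t) ^ a * t ^ b) = c * s a' b' * of_real ((1 - t) ^ a' * t ^ b')"
      if "0 < t" "t < 1" for t
      using tr[OF that] own[OF w1(2,3) w2(4) that] by (simp add: kl)
    have half: "(1 / 2) ^ a * (1 / 2) ^ b = ((1 / 2) ^ r :: real)" "(1 / 2) ^ a' * (1 / 2) ^ b' = ((1 /
        2) ^ r :: real)"
      using w1(4) w2(4) by (simp_all flip: power_add)
    have "s a b * of_real ((1 / 2) ^ r) = c * s a' b' * of_real ((1 / 2) ^ r)"
      using tr'[of "1 / 2"] by (simp add: half)
    then have ss: "s a b = c * s a' b'" by simp
    have third: "(2 / 3) ^ m * (1 / 3) ^ n = (2 ^ m * (1 / 3) ^ r :: real)" if "m + n = r" for m n
      using that by (simp add: power_divide power_add flip: that)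
    \<comment> \<open>the midpoint determines the constant, and the point \<open>t = 1/3\<close> then separates the monomials\<close>
    have "complex_of_real ((2 / 3) ^ a * (1 / 3) ^ b) = of_real ((2 / 3) ^ a' * (1 / 3) ^ b')"
      using tr'[of "1 / 3"] s0[of a b] by (simp add: ss)
    then have "(2 ^ a * (1 / 3) ^ r :: real) = 2 ^ a' * (1 / 3) ^ r"
      unfolding of_real_eq_iff third[OF w1(4)] third[OF w2(4)] .
    then have "a = a'" by simp
    moreover have "b = b'" using w1(4) w2(4) \<open>a = a'\<close> by simp
    ultimately show ?thesis using w1(1) w2(1) kl by simp
  qed
  have sym: "\<exists>u\<in>S. cmod u = 1 \<and> (\<exists>\<eta>\<in>W. pullback T (vertex_map T
      \<pi>) \<omega> = form_scale u \<eta>)"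
    if \<pi>: "\<pi> permutes {..2}" and "\<omega> \<in> W" for \<pi> \<omega>
  proof -
    obtain i j a b where w: "\<omega> = form_scale (s a b) (e i j a b)" "i < j" "j \<le> 2" "a + b = r"
      using \<open>\<omega> \<in> W\<close> unfolding W_def by blast
    have p: "\<pi> i \<le> 2" "\<pi> j \<le> 2" using permutes_in_image[OF \<pi>] w by auto
    have "\<pi> i \<noteq> \<pi> j" using w(2) permutes_inj[OF \<pi>] by (simp add: inj_eq)
    have eq: "pullback T (vertex_map T \<pi>) \<omega> = form_scale (s a b) (e (\<pi> i) (\<pi> j) a b)"
      using w pull[OF \<pi>, of i j a b] by (simp add: pullback_scale)
    show ?thesis
    proof (cases "\<pi> i < \<pi> j")
      case True
      then have "form_scale (s a b) (e (\<pi> i) (\<pi> j) a b) \<in> W" unfolding W_def using p w by blast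
      then show ?thesis using eq S(1) by (intro bexI[of _ 1]) auto
    next
      case False
      then have "\<pi> j < \<pi> i" using \<open>\<pi> i \<noteq> \<pi> j\<close> by simp
      then have "form_scale (s b a) (e (\<pi> j) (\<pi> i) b a) \<in> W" unfolding W_def using p(1) w(4)
        by (intro CollectI exI[of _ "\<pi> j"] exI[of _ "\<pi> i"] exI[of _ b] exI[of _ a]) auto
      \<comment> \<open>The edge orientation is reversed: \<open>e\<close> changes sign, and
        \<open>s a b = s b a\<close> leads back to an element of the family.\<close>
      moreover have "form_scale (s a b) (e (\<pi> i) (\<pi> j) a b) = form_scale (- 1) (form_scale (s b
          a) (e (\<pi> j) (\<pi> i) b a))"
        using anti[of "\<pi> j" "\<pi> i" b a] s(2)[of a b] by simp
      ultimately show ?thesis using eq S(2) by (intro bexI[of _ "- 1"]) auto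
    qed
  qed
  have "W \<subseteq> cont_forms T" unfolding W_def using cont cont_forms_scale by blast
  then show "symmetric_family T S W"
    unfolding symmetric_family_def[OF T T2] using fin uniq sym by blast
qed

lemma bary_edge_point_2:
  "i \<le> 2 \<Longrightarrow> j \<le> 2 \<Longrightarrow> bary T k ((1 - t) *\<^sub>R T ! i + t
      *\<^sub>R T ! j) = (if i = k then 1 - t else 0) + (if j = k then t else 0)"
  using bary_edge_point[OF T, of i j k t] by (simp add: T2)

lemma pull_edge_terms:
  assumes \<pi>: "\<pi> permutes {..2}" and ij: "i \<le> 2" "j \<le> 2"
  shows "pullback T (vertex_map T \<pi>) (edge_ext T i j a b) = edge_ext T (\<pi> i) (\<pi> j) a b"
    "pullback T (vertex_map T \<pi>) (edge_ext_m T i j a b) = edge_ext_m T (\<pi> i) (\<pi> j) a b"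
proof -
  have inv: "inv \<pi> k = l \<longleftrightarrow> k = \<pi> l" for k l using permutes_inverses[OF
      \<pi>] by metis
  show "pullback T (vertex_map T \<pi>) (edge_ext T i j a b) = edge_ext T (\<pi> i) (\<pi> j) a b"
    "pullback T (vertex_map T \<pi>) (edge_ext_m T i j a b) = edge_ext_m T (\<pi> i) (\<pi> j) a b"
    unfolding edge_ext_def edge_ext_m_def pull_one_form[OF T T2 \<pi>]
    by (rule one_form_cong[OF T]; use bary_vertex_map_2[OF T T2 \<pi>] ij inv in \<open>simp only: ;
        intro exI[of _ 0]; simp\<close>)+
qed

text \<open>In degree r > 0 the weights a/(a+b) and b/(a+b) sum to 1, so the trace on the own edge
  is the bare monomial.\<close>

lemma edge_part_symmetric:
  assumes "1 \<in> S" "- 1 \<in> S" "r > 0"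
  shows "symmetric_family T S (edge_part T r)" "\<And>\<omega>. \<omega> \<in> edge_part T r
      \<Longrightarrow> \<not> traceless T \<omega>"
proof -
  have s: "edge_sign a b \<in> {1, - 1}" "edge_sign a b = edge_sign b a" for a b by (auto simp:
      edge_sign_def)
  have cont: "edge_ext T i j a b \<in> cont_forms T" for i j a b
    unfolding edge_ext_def
  proof (rule one_form_in_cont_forms, goal_cases)
    case (1 k) show ?case by (intro continuous_intros continuous_on_of_real continuous_on_bary[OF T])
  qed
  have anti: "edge_ext T j i b a = - edge_ext T i j a b" for i j a b
    unfolding edge_ext_def one_form_ops
    by (rule one_form_cong[OF T]) (auto simp: right_diff_distrib ac_simps intro!: exI[of _ 0])
  have own: "edge_trace T i j t (edge_ext T i j a b) = of_real ((1 - t) ^ a * t ^ b)"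
    if "i < j" "j \<le> 2" "a + b = r" "0 < t" "t < 1" for i j a b t
  proof -
    have "of_nat a / of_nat (a + b) + of_nat b / of_nat (a + b) = (1::complex)"
      using that(3) \<open>r > 0\<close> by (simp flip: add_divide_distrib of_nat_add)
    then show ?thesis unfolding edge_ext_def using that
      by (simp add: edge_trace_one_form[OF T T2] bary_edge_point_2 flip: distrib_left
          del: of_nat_add times_divide_eq_right)
  qed
  \<comment> \<open>Suppose the other edge misses i; the case of j is alike. Then dlambda_i = 0
    along it, and the remaining term contains lambda_i^a and the numerator a: it vanishes for a > 0
    by the former and for a = 0 by the latter.\<close>
  have other: "edge_trace T k l t (edge_ext T i j a b) = 0"
    if "i < j" "j \<le> 2" "k < l" "l \<le> 2" "(k, l) \<noteq> (i, j)" "0 < t" "t < 1" for i j k l a b t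
    unfolding edge_ext_def using that
    by (auto simp: edge_trace_one_form[OF T T2] bary_edge_point_2 simp del: of_nat_add)
  show "symmetric_family T S (edge_part T r)"
    unfolding edge_part_def[OF T T2]
    by (rule edge_family(1)[of S edge_sign "edge_ext T" r]) (fact assms s cont anti pull_edge_terms own
        other)+
  show "\<not> traceless T \<omega>" if "\<omega> \<in> edge_part T r" for \<omega>
    by (rule edge_family(2)[of S edge_sign "edge_ext T" r, OF _ _ _ _ _ _ _ _ _ that[unfolded
        edge_part_def[OF T T2]]])
      (fact assms s cont anti pull_edge_terms own other)+
qed

lemma edge_part_m_symmetric:
  assumes "1 \<in> S" "- 1 \<in> S"
  shows "symmetric_family T S (edge_part_m T r)" "\<And>\<omega>. \<omega> \<in> edge_part_m T r
      \<Longrightarrow> \<not> traceless T \<omega>"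
proof -
  have s: "1 \<in> {1, - 1 :: complex}" by simp
  have cont: "edge_ext_m T i j a b \<in> cont_forms T" for i j a b
    unfolding edge_ext_m_def
  proof (rule one_form_in_cont_forms, goal_cases)
    case (1 k)
    show ?case by (cases "k = i"; cases "k = j"; simp; intro continuous_intros continuous_on_of_real
        continuous_on_bary[OF T])
  qed
  have anti: "edge_ext_m T j i b a = - edge_ext_m T i j a b" for i j a b
    unfolding edge_ext_m_def one_form_ops by (rule one_form_cong[OF T]) (auto simp: ac_simps intro!:
        exI[of _ 0])
  have own: "edge_trace T i j t (edge_ext_m T i j a b) = of_real ((1 - t) ^ a * t ^ b)"
    if "i < j" "j \<le> 2" "a + b = r" "0 < t" "t < 1" for i j a b t
    unfolding edge_ext_m_def using that by (simp add: edge_trace_one_form[OF T T2] bary_edge_point_2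
        flip: distrib_left)
  have other: "edge_trace T k l t (edge_ext_m T i j a b) = 0"
    if "i < j" "j \<le> 2" "k < l" "l \<le> 2" "(k, l) \<noteq> (i, j)" "0 < t" "t < 1" for i j k l a b t
    unfolding edge_ext_m_def using that
    by (auto simp: edge_trace_one_form[OF T T2] bary_edge_point_2)
  have eq: "edge_part_m T r = {form_scale 1 (edge_ext_m T i j a b) | i j a b. i < j \<and> j \<le> 2
      \<and> a + b = r}"
    by (simp add: edge_part_m_def[OF T T2])
  show "symmetric_family T S (edge_part_m T r)"
    unfolding eq
    by (rule edge_family(1)[of S "\<lambda>_ _. 1" "edge_ext_m T" r]) (fact assms s refl cont anti
        pull_edge_terms own other)+
  show "\<not> traceless T \<omega>" if "\<omega> \<in> edge_part_m T r" for \<omega>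
    by (rule edge_family(2)[of S "\<lambda>_ _. 1" "edge_ext_m T" r, OF _ _ _ _ _ _ _ _ _ that[unfolded
        eq]])
      (fact assms s refl cont anti pull_edge_terms own other)+
qed

end

context
  fixes T :: "'a::euclidean_space list"
  assumes T: "ordered_simplex T" and T2: "sdim T = 2"
begin

section \<open>The constant forms\<close>

lemma xi_power_4: "xi ^ 4 = xi"
  using xi_cube by (simp add: eval_nat_numeral)

text \<open>Rotations turn the coefficients 1, z, z^2 into a multiple of themselves, reflections
  into a multiple of 1, z^2, z^4, which belong to \<open>eta\<close> at z^2.\<close>

lemma eta_pull:
  assumes \<pi>: "\<pi> permutes {..2}" and z: "z ^ 3 = 1"
  shows "\<exists>k. pullback T (vertex_map T \<pi>) (eta T z) = form_scale (z ^ k) (eta T z) \<or>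
    pullback T (vertex_map T \<pi>) (eta T z) = form_scale (z ^ k) (eta T (z\<^sup>2))"
proof -
  obtain a b c where p: "\<pi> 0 = a" "\<pi> (Suc 0) = b" "\<pi> 2 = c" "inv \<pi> a = 0" "inv \<pi> b
      = Suc 0" "inv \<pi> c = 2"
    "(a, b, c) \<in> {(0, Suc 0, 2), (0, 2, Suc 0), (Suc 0, 0, 2), (Suc 0, 2, 0), (2, 0, Suc 0), (2,
        Suc 0, 0)}"
    using perm3_cases[OF \<pi>] .
  have z': "z * (z * z) = 1" using z by (simp add: eval_nat_numeral)
  \<comment> \<open>It suffices that the permuted coefficients form a geometric sequence with first
    term u and ratio w.\<close>
  have eq: "pullback T (vertex_map T \<pi>) (eta T z) = form_scale u (eta T w)"
    if "z ^ inv \<pi> 0 = u" "z ^ inv \<pi> (Suc 0) = u * w" "z ^ inv \<pi> 2 = u * w\<^sup>2" for u w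
    unfolding eta_def[OF T T2] pull_one_form[OF T T2 \<pi>] one_form_ops
    by (rule one_form_triangle_cong[OF T T2]) (simp_all add: that)
  have "(\<exists>k. z ^ inv \<pi> 0 = z ^ k \<and> z ^ inv \<pi> (Suc 0) = z ^ k * z \<and> z ^ inv
      \<pi> 2 = z ^ k * z\<^sup>2) \<or>
    (\<exists>k. z ^ inv \<pi> 0 = z ^ k \<and> z ^ inv \<pi> (Suc 0) = z ^ k * z\<^sup>2 \<and> z ^
        inv \<pi> 2 = z ^ k * (z\<^sup>2)\<^sup>2)"
    using p(7)
  proof (elim insertE emptyE, goal_cases)
    case 1 then have "inv \<pi> 0 = 0" "inv \<pi> (Suc 0) = Suc 0" "inv \<pi> 2 = 2" using p by auto
    then show ?case by (intro disjI1 exI[of _ 0]) (simp add: z' power2_eq_square mult.assoc)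
  next
    case 2 then have "inv \<pi> 0 = 0" "inv \<pi> (Suc 0) = 2" "inv \<pi> 2 = Suc 0" using p by auto
    then show ?case by (intro disjI2 exI[of _ 0]) (simp add: z' power2_eq_square mult.assoc)
  next
    case 3 then have "inv \<pi> 0 = Suc 0" "inv \<pi> (Suc 0) = 0" "inv \<pi> 2 = 2" using p by auto
    then show ?case by (intro disjI2 exI[of _ 1]) (simp add: z' power2_eq_square mult.assoc)
  next
    case 4 then have "inv \<pi> 0 = 2" "inv \<pi> (Suc 0) = 0" "inv \<pi> 2 = Suc 0" using p by auto
    then show ?case by (intro disjI1 exI[of _ 2]) (simp add: z' power2_eq_square mult.assoc)
  next
    case 5 then have "inv \<pi> 0 = Suc 0" "inv \<pi> (Suc 0) = 2" "inv \<pi> 2 = 0" using p by auto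
    then show ?case by (intro disjI1 exI[of _ 1]) (simp add: z' power2_eq_square mult.assoc)
  next
    case 6 then have "inv \<pi> 0 = 2" "inv \<pi> (Suc 0) = Suc 0" "inv \<pi> 2 = 0" using p by auto
    then show ?case by (intro disjI2 exI[of _ 2]) (simp add: z' power2_eq_square mult.assoc)
  qed
  then show ?thesis using eq by metis
qed

lemma eta_in_cont_forms: "eta T z \<in> cont_forms T"
  unfolding eta_def[OF T T2] by (rule one_form_in_cont_forms) simp

lemma eta_edge: "eta T z (T ! 0) [T ! i - T ! 0] = z ^ i - 1" if "i \<le> 2"
  using vertex_in_body[OF T, of 0] that by (simp add: eta_def[OF T T2] one_form_triangle_edge[OF T T2])

lemma xi_neq_1: "xi \<noteq> 1"
  using xi_neq_real by auto

text \<open>Evaluation along the edges 01 and 02 gives c (xi + 1) = 1 and xi + 1 = c. Hence xi (xi +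
  2) = 0, which contradicts |xi| = 1.\<close>

lemma eta_not_proportional: "eta T xi \<noteq> form_scale c (eta T (xi\<^sup>2))"
proof
  assume eq: "eta T xi = form_scale c (eta T (xi\<^sup>2))"
  have e: "xi ^ i - 1 = c * ((xi\<^sup>2) ^ i - 1)" if "i \<le> 2" for i
    using arg_cong[OF eq, of "\<lambda>\<omega>. \<omega> (T ! 0) [T ! i - T ! 0]"] eta_edge that by
        (simp add: form_scale_apply)
  have f: "(xi\<^sup>2)\<^sup>2 = xi" using xi_power_4 by simp
  have "xi - 1 = c * (xi\<^sup>2 - 1)" "xi\<^sup>2 - 1 = c * (xi - 1)" using e[of 1] e[of 2] f by simp_all
  then have "(xi - 1) * 1 = (xi - 1) * (c * (xi + 1))" "(xi - 1) * (xi + 1) = (xi - 1) * c"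
    by (simp_all add: algebra_simps power2_eq_square)
  then have c: "1 = c * (xi + 1)" "xi + 1 = c" using xi_neq_1 by simp_all
  from c(1) have "1 = (xi + 1) * (xi + 1)" unfolding c(2)[symmetric] .
  then have "xi * (xi + 2) = 0" by (simp add: algebra_simps)
  moreover have "xi \<noteq> 0" using cmod_xi by auto
  ultimately have "xi = - 2" by (simp add: eq_neg_iff_add_eq_0)
  then have "cmod xi = 2" using norm_neg_numeral by metis
  then show False using cmod_xi by simp
qed

lemma constant_forms_symmetric: "symmetric_family T UNIV {eta T xi, eta T (xi\<^sup>2)}"
  unfolding symmetric_family_def[OF T T2]
proof (intro conjI ballI allI impI)
  let ?W = "{eta T xi, eta T (xi\<^sup>2)}"
  show "?W \<subseteq> cont_forms T" by (simp add: eta_in_cont_forms)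
  show "\<omega> = \<eta>" if "\<omega> \<in> ?W" "\<eta> \<in> ?W" "c \<noteq> 0" "\<omega> =
      form_scale c \<eta>" for \<omega> \<eta> c
  proof -
    have "\<eta> = form_scale (inverse c) \<omega>" using that(3,4) by simp
    then show ?thesis using that(1,2,4) eta_not_proportional by (elim insertE emptyE) metis+
  qed
  fix \<pi> :: "nat \<Rightarrow> nat" and \<omega> assume \<pi>: "\<pi> permutes {..2}" and "\<omega>
      \<in> ?W"
  then obtain z where z: "\<omega> = eta T z" "z = xi \<or> z = xi\<^sup>2" by blast
  have "(xi\<^sup>2) ^ 3 = (xi ^ 3)\<^sup>2" "(xi\<^sup>2)\<^sup>2 = xi" using xi_power_4 by (simp_all
      flip: power_mult)
  then have z3: "z ^ 3 = 1" and zz: "eta T z \<in> ?W" "eta T (z\<^sup>2) \<in> ?W" and "cmod z = 1"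
    using z(2) xi_cube cmod_xi by (auto simp: norm_power)
  obtain k where "pullback T (vertex_map T \<pi>) (eta T z) = form_scale (z ^ k) (eta T z) \<or>
    pullback T (vertex_map T \<pi>) (eta T z) = form_scale (z ^ k) (eta T (z\<^sup>2))" using
        eta_pull[OF \<pi> z3] by blast
  then show "\<exists>u\<in>UNIV. cmod u = 1 \<and> (\<exists>\<eta>\<in>?W. pullback T (vertex_map T
      \<pi>) \<omega> = form_scale u \<eta>)"
    using zz z(1) \<open>cmod z = 1\<close> by (intro bexI[of _ "z ^ k"]) (auto simp: norm_power)
qed simp

section \<open>The obstruction to real invariance\<close>

text \<open>An eigenform \<open>\<omega>\<close> with non-real eigenvalue; outside the real forms, W
  may contain only one further form \<open>\<eta>\<close>, with a different eigenvalue for the same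
  permutation. Continuity is recorded because \<open>obstructed_image\<close> relies on injectivity
  on continuous forms.\<close>

definition obstructed :: "'a form set \<Rightarrow> bool" where
  "obstructed W \<longleftrightarrow> (\<exists>\<pi> \<omega> \<eta> u v. \<pi> permutes {..2} \<and>
      \<omega> \<in> W \<and> \<omega> \<noteq> 0 \<and> \<omega> \<in> cont_forms T \<and> \<eta>
          \<in> cont_forms T \<and>
     W \<subseteq> real_forms T \<union> {\<omega>, \<eta>} \<and> u \<notin> \<real> \<and> v \<noteq>
         u \<and>
     pullback T (vertex_map T \<pi>) \<omega> = form_scale u \<omega> \<and> pullback T (vertex_map T
         \<pi>) \<eta> = form_scale v \<eta>)"

lemma real_form_value: "\<omega> \<in> real_forms T \<Longrightarrow> \<omega> x vs \<in> \<real>"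
  by (auto simp: real_forms_def one_form_def intro!: sum_in_Reals Reals_mult)

text \<open>Real invariance would write u times \<open>\<omega>\<close> as a real multiple k of some
  \<open>\<zeta>\<close> in W, which is then itself an eigenform for u. A real
  \<open>\<zeta>\<close> would make u real, \<open>\<zeta> = \<omega>\<close> would give u = k, and
  \<open>\<zeta> = \<eta>\<close> would give u = v.\<close>

lemma obstructed_not_invariant:
  assumes W: "obstructed W" shows "\<not> invariant_set \<real> T W"
proof
  assume inv: "invariant_set \<real> T W"
  obtain \<pi> \<omega> \<eta> u v where *: "\<pi> permutes {..2}" "\<omega> \<in> W" "\<omega>
      \<noteq> 0" "W \<subseteq> real_forms T \<union> {\<omega>, \<eta>}" "u \<notin> \<real>" "v
          \<noteq> u"
    "pullback T (vertex_map T \<pi>) \<omega> = form_scale u \<omega>" "pullback T (vertex_map T \<pi>)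
        \<eta> = form_scale v \<eta>"
    using W unfolding obstructed_def by blast
  obtain \<tau> c where "bij_betw \<tau> W W" "\<forall>\<omega>\<in>W. c \<omega> \<in> \<real> \<and>
      cmod (c \<omega>) = 1 \<and>
      pullback T (vertex_map T \<pi>) \<omega> = form_scale (c \<omega>) (\<tau> \<omega>)"
    using inv *(1) unfolding invariant_set_def T2 by blast
  then obtain \<zeta> k where z: "\<zeta> \<in> W" "k \<in> \<real>" "cmod k = 1" "form_scale u
      \<omega> = form_scale k \<zeta>"
    using *(2,7) bij_betwE by metis
  have u0: "u \<noteq> 0" using *(5) by auto
  have k0: "k \<noteq> 0" using z(3) by auto
  have zeta: "\<zeta> = form_scale (u / k) \<omega>"
  proof -
    have "form_scale (inverse k) (form_scale u \<omega>) = form_scale (inverse k) (form_scale k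
        \<zeta>)" using z(4) by simp
    then show ?thesis using k0 by (simp add: field_simps)
  qed
  have zeta_pull: "pullback T (vertex_map T \<pi>) \<zeta> = form_scale u \<zeta>"
    unfolding zeta pullback_scale *(7) by (simp add: mult.commute)
  obtain x vs where nz: "\<omega> x vs \<noteq> 0" using *(3) by (metis ext zero_fun_apply)
  have z0: "\<zeta> x vs \<noteq> 0" using nz u0 k0 by (simp add: zeta form_scale_apply)
  consider "\<zeta> \<in> real_forms T" | "\<zeta> = \<omega>" | "\<zeta> = \<eta>" using z(1) *(4) by blast
  then show False
  proof cases
    case 1
    then obtain c where c: "\<zeta> = one_form T c" "\<forall>i x. c i x \<in> \<real>" unfolding
        real_forms_def by blast
    have "pullback T (vertex_map T \<pi>) \<zeta> \<in> real_forms T"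
      unfolding c(1) pull_one_form[OF T T2 *(1)] using c(2) by (intro one_form_in_real_forms) blast
    then have "u * \<zeta> x vs \<in> \<real>" using real_form_value[of "form_scale u \<zeta>" x vs] by
        (simp add: zeta_pull form_scale_apply)
    then have "u * \<zeta> x vs / \<zeta> x vs \<in> \<real>" using real_form_value[OF 1] by (intro
        Reals_divide)
    then show False using z0 *(5) by simp
  next
    case 2
    then have "u * \<omega> x vs = k * \<omega> x vs" using arg_cong[OF z(4), of "\<lambda>\<omega>.
        \<omega> x vs"] by (simp add: form_scale_apply)
    then show False using nz z(2) *(5) by simp
  next
    case 3
    then have "form_scale u \<zeta> = form_scale v \<zeta>" using zeta_pull *(8) by metis
    then have "u * \<zeta> x vs = v * \<zeta> x vs" by (metis form_scale_apply)
    then show False using z0 *(6) by simp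
  qed
qed

lemma obstructed_image:
  assumes L: "symmetry_operator T L" and W: "obstructed W"
  shows "obstructed (L ` W)"
proof -
  note LD = symmetry_operatorD[OF T T2 L]
  obtain \<pi> \<omega> \<eta> u v where *: "\<pi> permutes {..2}" "\<omega> \<in> W" "\<omega>
      \<noteq> 0" "\<omega> \<in> cont_forms T" "\<eta> \<in> cont_forms T"
    "W \<subseteq> real_forms T \<union> {\<omega>, \<eta>}" "u \<notin> \<real>" "v \<noteq> u"
    "pullback T (vertex_map T \<pi>) \<omega> = form_scale u \<omega>" "pullback T (vertex_map T \<pi>)
        \<eta> = form_scale v \<eta>"
    using W unfolding obstructed_def by blast
  obtain s where s: "s = 1 \<or> s = - 1" "\<forall>\<omega>\<in>cont_forms T.
       pullback T (vertex_map T \<pi>) (L \<omega>) = form_scale s (L (pullback T (vertex_map T \<pi>)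
           \<omega>))"
    using LD(6)[OF *(1)] by blast
  have "L \<omega> \<noteq> 0"
  proof
    assume "L \<omega> = 0"
    \<comment> \<open>Injectivity is applied to \<open>\<omega>\<close> and its double, both of
      which would be sent to 0.\<close>
    then have "L (form_scale 2 \<omega>) = L \<omega>" by (simp add: LD(2))
    then have "form_scale 2 \<omega> = \<omega>" using inj_onD[OF LD(4)] *(4) cont_forms_scale by blast
    then have "form_scale (2 - 1) \<omega> = 0" by (simp only: form.scale_left_diff_distrib) simp
    then show False using *(3) by simp
  qed
  moreover have "L ` W \<subseteq> real_forms T \<union> {L \<omega>, L \<eta>}" using *(6) LD(5) by blast
  moreover have "s * u \<notin> \<real>" "s * v \<noteq> s * u" using s(1) *(7,8) by auto
  moreover have "pullback T (vertex_map T \<pi>) (L \<omega>) = form_scale (s * u) (L \<omega>)"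
    "pullback T (vertex_map T \<pi>) (L \<eta>) = form_scale (s * v) (L \<eta>)"
    using s(2) *(4,5,9,10) by (simp_all add: LD(2))
  ultimately show ?thesis
    unfolding obstructed_def using *(1,2) LD(3)[OF *(4)] LD(3)[OF *(5)] by blast
qed

lemma obstructed_Un: "obstructed W \<Longrightarrow> V \<subseteq> real_forms T \<Longrightarrow>
    obstructed (V \<union> W)"
  unfolding obstructed_def by (elim exE) (intro exI conjI; blast)

text \<open>Under the 3-cycle 0 -> 1 -> 2 -> 0 the form \<open>eta T z\<close> has eigenvalue z^2.
  For xi this is the non-real number xi^2, for xi^2 it is xi^4 = xi, which is different.\<close>

lemma constant_forms_obstructed: "obstructed {eta T xi, eta T (xi\<^sup>2)}"
proof -
  let ?\<pi> = "Transposition.transpose 0 (Suc 0) \<circ> Transposition.transpose (Suc 0) (2::nat)"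
  have \<pi>: "?\<pi> permutes {..2}" by (intro permutes_compose permutes_swap_id) auto
  have inv: "inv ?\<pi> 0 = 2" "inv ?\<pi> (Suc 0) = 0" "inv ?\<pi> 2 = Suc 0"
    using permutes_inv_eq[OF \<pi>] by (simp_all add: Transposition.transpose_def)
  have pull: "pullback T (vertex_map T ?\<pi>) (eta T z) = form_scale (z\<^sup>2) (eta T z)" if z: "z ^
      3 = 1" for z
  proof -
    have z': "z * (z * z) = 1" using z by (simp add: eval_nat_numeral)
    show ?thesis
      unfolding eta_def[OF T T2] pull_one_form[OF T T2 \<pi>] one_form_ops
      by (rule one_form_triangle_cong[OF T T2]) (simp_all add: inv z' power2_eq_square mult.assoc del:
          o_apply)
  qed
  have x4: "(xi\<^sup>2)\<^sup>2 = xi" using xi_power_4 by simp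
  have x6: "(xi\<^sup>2) ^ 3 = 1" using xi_cube by (metis power_mult mult.commute power_one)
  have "xi\<^sup>2 \<notin> \<real>"
  proof
    assume "xi\<^sup>2 \<in> \<real>"
    then have "(xi\<^sup>2)\<^sup>2 \<in> \<real>" by (rule Reals_power)
    then show False using x4 xi_neq_real by simp
  qed
  have "xi \<noteq> xi\<^sup>2" using xi_neq_1 cmod_xi by (auto simp: power2_eq_square)
  have "eta T xi \<noteq> 0"
    using eta_edge[of 1 xi] xi_neq_1 by auto
  show ?thesis unfolding obstructed_def
    by (rule exI[of _ ?\<pi>], rule exI[of _ "eta T xi"], rule exI[of _ "eta T (xi\<^sup>2)"],
        rule exI[of _ "xi\<^sup>2"], rule exI[of _ xi])
      (use \<pi> pull[OF xi_cube] pull[OF x6, unfolded x4] eta_in_cont_forms \<open>xi\<^sup>2 \<notin>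
          \<real>\<close> \<open>xi \<noteq> xi\<^sup>2\<close> \<open>eta T xi \<noteq> 0\<close>
        in simp)
qed

lemma edge_parts_real: "edge_part T r \<subseteq> real_forms T" "edge_part_m T r \<subseteq> real_forms T"
proof -
  have "form_scale (edge_sign a b) (edge_ext T i j a b) \<in> real_forms T" for a b i j
    unfolding edge_ext_def one_form_ops
    by (rule one_form_in_real_forms) (auto simp: edge_sign_def simp del: of_nat_add intro!: Reals_mult
        Reals_diff Reals_divide)
  then show "edge_part T r \<subseteq> real_forms T" unfolding edge_part_def[OF T T2] by blast
  have "edge_ext_m T i j a b \<in> real_forms T" for a b i j
    unfolding edge_ext_m_def by (rule one_form_in_real_forms) (auto intro!: Reals_mult Reals_diff)
  then show "edge_part_m T r \<subseteq> real_forms T" unfolding edge_part_m_def[OF T T2] by blast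
qed

section \<open>The induction\<close>

text \<open>The flag \<open>b\<close> marks families that are invariant over the complex numbers
  only. Both alternatives pass to images under the rotations and to unions with an edge part, so one
  induction treats them together.\<close>

definition invariance_type :: "bool \<Rightarrow> 'a form set \<Rightarrow> bool" where
  "invariance_type b W \<longleftrightarrow> symmetric_family T UNIV W \<and> (if b then obstructed W
      else symmetric_family T \<real> W)"

lemma invariance_typeD:
  assumes "invariance_type b W"
  shows "C_invariant T W" "R_invariant T W \<longleftrightarrow> \<not> b"
  using assms symmetric_family_invariant[OF T T2] obstructed_not_invariant
  by (auto simp: invariance_type_def split: if_splits)

lemma invariance_type_empty: "invariance_type False {}"
  by (simp add: invariance_type_def symmetric_family_empty[OF T T2])

lemma invariance_type_image:
  "symmetry_operator T L \<Longrightarrow> invariance_type b W \<Longrightarrow> invariance_type b (L ` W)"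
  using symmetric_family_image[OF T T2] obstructed_image by (auto simp: invariance_type_def)

text \<open>The symmetry of \<open>V\<close> is required for every \<open>S\<close> containing 1 and
  -1, so that it serves the complex and the real half alike.\<close>

lemma invariance_type_Un:
  assumes V: "\<And>S. 1 \<in> S \<Longrightarrow> - 1 \<in> S \<Longrightarrow> symmetric_family T S
      V" "\<And>\<omega>. \<omega> \<in> V \<Longrightarrow> \<not> traceless T \<omega>"
      "V \<subseteq> real_forms T"
    and W: "invariance_type b W" "\<And>\<omega>. \<omega> \<in> W \<Longrightarrow> traceless T \<omega>"
  shows "invariance_type b (V \<union> W)"
proof -
  have "symmetric_family T S (V \<union> W)" if "1 \<in> S" "- 1 \<in> S" "symmetric_family T S W" for S
    by (rule symmetric_family_Un[OF T T2 V(1)[OF that(1,2)] that(3) V(2) W(2)])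
  then show ?thesis using W(1) obstructed_Un[OF _ V(3)] by (auto simp: invariance_type_def)
qed

lemma invariance_type_rotation:
  assumes "invariance_type b W"
  shows "invariance_type b (rotation_I T ` W)" "invariance_type b (rotation_J T ` W)"
    "\<And>\<omega>. \<omega> \<in> rotation_I T ` W \<Longrightarrow> traceless T \<omega>"
        "\<And>\<omega>. \<omega> \<in> rotation_J T ` W \<Longrightarrow> traceless T \<omega>"
proof -
  show "invariance_type b (rotation_I T ` W)" "invariance_type b (rotation_J T ` W)"
    using invariance_type_image assms symmetry_operator_rotation_I[OF T T2]
        symmetry_operator_rotation_J[OF T T2] by blast+
  have W: "W \<subseteq> cont_forms T"
    using assms symmetric_familyD(2)[OF T T2] unfolding invariance_type_def by blast
  show "traceless T \<omega>" if "\<omega> \<in> rotation_I T ` W" for \<omega>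
    using that W rotations_traceless(1)[OF T T2] by (auto simp: cont_forms_def)
  show "traceless T \<omega>" if "\<omega> \<in> rotation_J T ` W" for \<omega>
    using that W rotations_traceless(2)[OF T T2] by (auto simp: cont_forms_def)
qed

text \<open>Degree bookkeeping: \<open>AP\<close> in degree p feeds \<open>APm\<close> in degree p +
  2, and \<open>APm\<close> in degree q feeds \<open>AP\<close> in degree q + 1. Residue 0 of
  \<open>AP\<close> thus becomes residue 2 of \<open>APm\<close>, stated here as r mod 3 = 1 in
  degree r + 1, and then residue 0 again.\<close>

lemma invariance_types:
  "invariance_type (r mod 3 = 0) (AP B T (Suc 0) r)"
  "invariance_type (r mod 3 = 1) (APm B T (Suc 0) (Suc r))"
proof (induction r rule: less_induct)
  case (less r)
  have E: "invariance_type b (edge_part T q \<union> W)"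
    if "q > 0" "invariance_type b W" "\<And>\<omega>. \<omega> \<in> W \<Longrightarrow> traceless T
        \<omega>" for q b W
    by (rule invariance_type_Un[OF edge_part_symmetric(1)[OF T T2 _ _ that(1)]
          edge_part_symmetric(2)[OF T T2 _ _ that(1), of UNIV] edge_parts_real(1) that(2,3)]) simp_all
  have Em: "invariance_type b (edge_part_m T q \<union> W)"
    if "invariance_type b W" "\<And>\<omega>. \<omega> \<in> W \<Longrightarrow> traceless T \<omega>"
        for q b W
    by (rule invariance_type_Un[OF edge_part_m_symmetric(1)[OF T T2] edge_part_m_symmetric(2)[OF T T2,
        of UNIV]
          edge_parts_real(2) that]) simp_all
  {
    case 1
    consider "r = 0" | "r = 1" | p where "r = Suc (Suc p)" by (metis One_nat_def not0_implies_Suc)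
    then show ?case
    proof cases
      case 1
      then show ?thesis
        using constant_forms_symmetric constant_forms_obstructed by (simp add: AP_triangle_0[OF T T2]
            invariance_type_def)
    next
      \<comment> \<open>In degree 1 \<open>AP0\<close> is still empty because n - k + 1 = 2.\<close>
      case 2
      then show ?thesis
        using AP_triangle_Suc[OF T T2, of B 0] AP0_triangle_low(1)[OF T T2, of 1 B]
          E[of 1 False "{}"] invariance_type_empty by simp
    next
      case 3
      have "invariance_type (p mod 3 = 1) (APm B T (Suc 0) (Suc p))" using less(2)[of p] 3 by simp
      from E[OF _ invariance_type_rotation(2,4)[OF this], of r]
      have "invariance_type (p mod 3 = 1) (AP B T (Suc 0) r)"
        unfolding 3 AP_triangle[OF T T2 bases_in_span(2)[OF T T2]] by simp
      moreover have "p mod 3 = 1 \<longleftrightarrow> r mod 3 = 0" using 3 by presburger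
      ultimately show ?thesis by simp
    qed
  next
    case 2
    show ?case
    proof (cases r)
      case 0
      then show ?thesis
        using APm_triangle_Suc[OF T T2, of B 0] AP0_triangle_low(2)[OF T T2, of 1 B]
          Em[of False "{}" 0] invariance_type_empty by simp
    next
      case (Suc p)
      have "invariance_type (p mod 3 = 0) (AP B T (Suc 0) p)" using less(1)[of p] Suc by simp
      from Em[OF invariance_type_rotation(1,3)[OF this], of r]
      have "invariance_type (p mod 3 = 0) (APm B T (Suc 0) (Suc r))"
        unfolding Suc APm_triangle[OF T T2 bases_in_span(1)[OF T T2]] by simp
      moreover have "p mod 3 = 0 \<longleftrightarrow> r mod 3 = 1" using Suc by presburger
      ultimately show ?thesis by simp
    qed
  }
qed

text \<open>For r = 0 the basis \<open>AP0\<close> is empty and therefore real invariant although 3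
  divides r; this is why the exceptional degrees are 3N + 3 and not 3N.\<close>

lemma invariance_types_traceless:
  "invariance_type (r mod 3 = 0 \<and> r > 0) (AP0 B T (Suc 0) r)"
  "invariance_type (r mod 3 = 2) (APm0 B T (Suc 0) r)"
  "invariance_type (r mod 3 = 2) (APm B T (Suc 0) r)"
proof -
  consider "r = 0" | "r = 1" | p where "r = Suc (Suc p)" by (metis One_nat_def not0_implies_Suc)
  then have "invariance_type (r mod 3 = 0 \<and> r > 0) (AP0 B T (Suc 0) r) \<and> invariance_type (r
      mod 3 = 2) (APm0 B T (Suc 0) r)"
  proof cases
    case 3
    have "invariance_type (p mod 3 = 1) (AP0 B T (Suc 0) r)"
      unfolding 3 AP0_triangle[OF T T2 bases_in_span(2)[OF T T2]]
      by (rule invariance_type_rotation(2)[OF invariance_types(2)])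
    moreover have "invariance_type (p mod 3 = 0) (APm0 B T (Suc 0) r)"
      unfolding 3 APm0_triangle[OF T T2 bases_in_span(1)[OF T T2]]
      by (rule invariance_type_rotation(1)[OF invariance_types(1)])
    moreover have "p mod 3 = 1 \<longleftrightarrow> r mod 3 = 0 \<and> r > 0" "p mod 3 = 0
        \<longleftrightarrow> r mod 3 = 2" using 3 by presburger+
    ultimately show ?thesis by simp
  qed (use AP0_triangle_low[OF T T2, of r B] invariance_type_empty in auto)
  then show "invariance_type (r mod 3 = 0 \<and> r > 0) (AP0 B T (Suc 0) r)" "invariance_type (r mod 3
      = 2) (APm0 B T (Suc 0) r)"
    by auto
  show "invariance_type (r mod 3 = 2) (APm B T (Suc 0) r)"
  proof (cases r)
    case 0
    then show ?thesis using invariance_type_empty by (subst APm.simps) simp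
  next
    case (Suc p)
    then have "r mod 3 = 2 \<longleftrightarrow> p mod 3 = 1" by presburger
    then show ?thesis using invariance_types(2)[of p B] Suc by simp
  qed
qed

end

theorem theorem8p2:
  fixes T :: "'a::euclidean_space list" and r :: nat
    and B :: "'a list \<Rightarrow> nat \<Rightarrow> 'a form set"
  assumes "choice_of_constant_bases B"
    and "ordered_simplex T" and "sdim T = 2"
  shows "(C_invariant T (AP B T 1 r) \<and> C_invariant T (APm B T 1 r) \<and>
          C_invariant T (AP0 B T 1 r) \<and> C_invariant T (APm0 B T 1 r)) \<and>
         (R_invariant T (AP B T 1 r) \<longleftrightarrow> \<not> (\<exists>m::nat. r = 3 * m)) \<and>
         (R_invariant T (APm B T 1 r) \<longleftrightarrow> \<not> (\<exists>m::nat. r = 3 * m + 2)) \<and>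
         (R_invariant T (AP0 B T 1 r) \<longleftrightarrow> \<not> (\<exists>m::nat. r = 3 * m + 3)) \<and>
         (R_invariant T (APm0 B T 1 r) \<longleftrightarrow> \<not> (\<exists>m::nat. r = 3 * m + 2))"
proof -
  note T = assms(2,3)
  have "(\<exists>m. r = 3 * m) \<longleftrightarrow> r mod 3 = 0" "(\<exists>m. r = 3 * m + 2)
      \<longleftrightarrow> r mod 3 = 2"
    "(\<exists>m. r = 3 * m + 3) \<longleftrightarrow> r mod 3 = 0 \<and> r > 0"
    by presburger+
  then show ?thesis
    using invariance_typeD[OF T invariance_types(1)[OF T, of r B]]
      invariance_typeD[OF T invariance_types_traceless(1)[OF T, of r B]]
      invariance_typeD[OF T invariance_types_traceless(2)[OF T, of r B]]
      invariance_typeD[OF T invariance_types_traceless(3)[OF T, of r B]] by simp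
qed

end
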